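(* Let $\mu>0$, $R\ge1$, $p>1/2$, $0<c_A\le C_A<\infty$. Assume $c_Ai^{-p}\le\lambda_i\le C_Ai^{-p}$ for $i=1,\dots,D$, $\xi=\delta Z$ with $Z\sim\mathcal N(0,I_D)$, $\delta\in(0,1)$, and $|\kappa-\delta^2D|\le C_\kappa\delta^2\sqrt D$ for some $C_\kappa\ge0$. Let $\|f\|_\mu\le R$, let $\tau=\inf\{t\in[0,d]:R_t^2\le\kappa\}$ and write $\mathcal R^{\mathrm{rec}}=R^{(4p+2)/(4\mu p+2p+1)}\delta^{8\mu p/(4\mu p+2p+1)}$. Then, provided $(R^2\delta^{-2})^{1/(4\mu p+2p+1)}\lesssim D$, we have for all $z\ge1$ with probability at least $1-6e^{-z}$ $$\|\widehat f_\tau-f^\dagger\|^2\le C\Big(\mathcal R^{\mathrm{rec}}+\delta^2\big(\sqrt D\sqrt z+z^{(4p+1)/(4p)}\big)^{2p+1}\Big),$$ and the bound in expectation $$\mathbb{E}\big[\|\widehat f_\tau-f^\dagger\|^2\big]\le\widetilde C\big(\mathcal R^{\mathrm{rec}}+\delta^2D^{p+1/2}\big),$$ where $C,\widetilde C>0$ are constants depending only on $\mu,p,c_A,C_A,C_\kappa$. This gives the minimax rate (for the reconstruction error over signals with $\|f\|_\mu\le R$) for all regularities $\mu>0$ such that $\sqrt D\lesssim(R^2\delta^{-2})^{1/(4\mu p+2p+1)}\lesssim_{\mu,p,c_A}D$.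
   Context: Model: $D\ge 3$ and $P\ge D$ are integers, $A\in\mathbb{R}^{D\times P}$ has rank $D$, $f\in\mathbb{R}^P$, $g=Af$, $\xi\in\mathbb{R}^D$ is an error vector, and $Y=g+\xi$ is observed. $\|\cdot\|$ is the Euclidean norm, $A^\dagger=A^\top(AA^\top)^{-1}$, $f^\dagger=A^\dagger g$ is the minimum-norm solution of $g=Af$. Let $\lambda_1\ge\dots\ge\lambda_D>0$ be the nonzero singular values of $A$ (with multiplicity), $u_i$, $v_i$ the left and right singular vectors, $\tilde\lambda_1>\dots>\tilde\lambda_d>0$ the distinct singular values. Put $Y_i=\langle Y,u_i\rangle$, $f_i=\langle f,v_i\rangle$. For a function $h$ on $[0,\infty)$ and $w\in\mathbb{R}^D$, $h(AA^\top)w=\sum_{i=1}^D h(\lambda_i^2)\langle w,u_i\rangle u_i$. Standing assumption: $\sum_{j:\lambda_j=\lambda_i}Y_j^2>0$ for all $i=1,\dots,D$ (this holds almost surely under Gaussian noise). Source condition: $\|f\|_\mu=\big(\sum_{i=1}^D\lambda_i^{-4\mu}f_i^2\big)^{1/2}$. Interpolated conjugate gradients: for $k=0,\dots,d$, $r_k$ is the unique minimiser of $\|p(AA^\top)Y\|^2$ over real polynomials $p$ of degree at most $k$ with $p(0)=1$. For $t=k+\alpha$, $k\in\{0,\dots,d-1\}$, $\alpha\in(0,1]$, $r_t=(1-\alpha)r_k+\alpha r_{k+1}$. For $t\in[0,d]$: $\widehat f_t=A^\dagger(I_D-r_t(AA^\top))Y$ and $R_t^2=\|A\widehat f_t-Y\|^2=\|r_t(AA^\top)Y\|^2$.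 The number $\kappa>0$ is the critical value of the stopping rule. Notation: $\lesssim$ denotes an inequality up to an absolute constant; indices, as in $\lesssim_{\mu,p,c_A}$, indicate that the constant may depend on the listed quantities. The minimax rate for the reconstruction error is the order of $\inf_{\widehat f}\sup_{f:\|f\|_\mu\le R}\mathbb{E}_f[\|\widehat f-f^\dagger\|^2]$, the infimum being over all $\mathbb{R}^P$-valued estimators and $\mathbb{E}_f$ the expectation when the true signal is $f$. *)

theory Defs
  imports
    "HOL-Probability.Probability"
    "Jordan_Normal_Form.DL_Rank"
    "Jordan_Normal_Form.Gauss_Jordan_Elimination"
begin

no_notation inner (infix "\<bullet>" 70)
no_notation vec_nth (infixl "$" 90)

abbreviation sq_norm :: "real vec \<Rightarrow> real" where
  "sq_norm w \<equiv> w \<bullet> w"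

text \<open>Singular values and vectors are indexed from 1 to the number of rows, as is natural for
  bounds of the form \<open>i powr (- p)\<close>.  Coordinates of vectors are indexed from 0.\<close>

definition is_svd ::
  "real mat \<Rightarrow> (nat \<Rightarrow> real) \<Rightarrow> (nat \<Rightarrow> real vec) \<Rightarrow> (nat \<Rightarrow> real vec) \<Rightarrow> bool" where
  "is_svd A lam u v \<longleftrightarrow>
     (\<forall>i\<in>{1..dim_row A}.
        lam i > 0 \<and> u i \<in> carrier_vec (dim_row A) \<and> v i \<in> carrier_vec (dim_col A) \<and>
        A *\<^sub>v v i = lam i \<cdot>\<^sub>v u i \<and> transpose_mat A *\<^sub>v u i = lam i \<cdot>\<^sub>v v i) \<and>
     (\<forall>i\<in>{1..dim_row A}. \<forall>j\<in>{1..dim_row A}.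
        (i \<le> j \<longrightarrow> lam j \<le> lam i) \<and>
        u i \<bullet> u j = (if i = j then 1 else 0) \<and> v i \<bullet> v j = (if i = j then 1 else 0))"

definition model ::
  "nat \<Rightarrow> nat \<Rightarrow> real mat \<Rightarrow> (nat \<Rightarrow> real) \<Rightarrow> (nat \<Rightarrow> real vec) \<Rightarrow> (nat \<Rightarrow> real vec) \<Rightarrow> bool" where
  "model D P A lam u v \<longleftrightarrow>
     3 \<le> D \<and> D \<le> P \<and> A \<in> carrier_mat D P \<and> vec_space.rank D A = D \<and> is_svd A lam u v"

definition pinv :: "real mat \<Rightarrow> real mat" where
  "pinv A = transpose_mat A * the (mat_inverse (A * transpose_mat A))"

definition min_norm_sol :: "real mat \<Rightarrow> real vec \<Rightarrow> real vec" where
  "min_norm_sol A f = pinv A *\<^sub>v (A *\<^sub>v f)"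

text \<open>The vector \<open>h(A A\<^sup>T) w\<close>.\<close>

definition spectral_apply ::
  "(nat \<Rightarrow> real) \<Rightarrow> (nat \<Rightarrow> real vec) \<Rightarrow> (real \<Rightarrow> real) \<Rightarrow> real vec \<Rightarrow> real vec" where
  "spectral_apply lam u h w =
     vec (dim_vec w) (\<lambda>j. \<Sum>i=1..dim_vec w. h ((lam i)\<^sup>2) * (w \<bullet> u i) * (u i $ j))"

definition num_distinct :: "(nat \<Rightarrow> real) \<Rightarrow> nat \<Rightarrow> nat" where
  "num_distinct lam D = card (lam ` {1..D})"

definition residual_polys :: "nat \<Rightarrow> real poly set" where
  "residual_polys k = {q. Polynomial.degree q \<le> k \<and> poly q 0 = 1}"

text \<open>For \<open>k\<close> up to the number of distinct singular values, the minimiser exists and is unique as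
  soon as \<open>Y\<close> has a nonzero component in every eigenspace of \<open>A A\<^sup>T\<close>.  For Gaussian noise this holds
  almost surely; outside this event the value is unspecified.\<close>

definition cg_poly ::
  "(nat \<Rightarrow> real) \<Rightarrow> (nat \<Rightarrow> real vec) \<Rightarrow> real vec \<Rightarrow> nat \<Rightarrow> real poly" where
  "cg_poly lam u Y k =
     (THE r. r \<in> residual_polys k \<and>
        (\<forall>q\<in>residual_polys k.
           sq_norm (spectral_apply lam u (poly r) Y) \<le> sq_norm (spectral_apply lam u (poly q) Y)))"

text \<open>For \<open>t > 0\<close>, \<open>t = k + \<alpha>\<close> with \<open>\<alpha> \<in> (0,1]\<close> forces \<open>k = \<lceil>t\<rceil> - 1\<close>.  For \<open>t = 0\<close> natural
  subtraction gives \<open>k = 0\<close> and \<open>\<alpha> = 0\<close>, hence the polynomial for \<open>k = 0\<close>.\<close>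

definition cg_interp ::
  "(nat \<Rightarrow> real) \<Rightarrow> (nat \<Rightarrow> real vec) \<Rightarrow> real vec \<Rightarrow> real \<Rightarrow> real poly" where
  "cg_interp lam u Y t =
     (let k = nat \<lceil>t\<rceil> - 1; \<alpha> = t - real k
      in Polynomial.smult (1 - \<alpha>) (cg_poly lam u Y k) + Polynomial.smult \<alpha> (cg_poly lam u Y (Suc k)))"

definition cg_est ::
  "real mat \<Rightarrow> (nat \<Rightarrow> real) \<Rightarrow> (nat \<Rightarrow> real vec) \<Rightarrow> real vec \<Rightarrow> real \<Rightarrow> real vec" where
  "cg_est A lam u Y t = pinv A *\<^sub>v (Y - spectral_apply lam u (poly (cg_interp lam u Y t)) Y)"

definition cg_sq_residual ::
  "real mat \<Rightarrow> (nat \<Rightarrow> real) \<Rightarrow> (nat \<Rightarrow> real vec) \<Rightarrow> real vec \<Rightarrow> real \<Rightarrow> real" where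
  "cg_sq_residual A lam u Y t = sq_norm (A *\<^sub>v cg_est A lam u Y t - Y)"

definition cg_stop ::
  "real mat \<Rightarrow> (nat \<Rightarrow> real) \<Rightarrow> (nat \<Rightarrow> real vec) \<Rightarrow> real \<Rightarrow> real vec \<Rightarrow> real" where
  "cg_stop A lam u \<kappa> Y =
     Inf {t \<in> {0..real (num_distinct lam (dim_row A))}. cg_sq_residual A lam u Y t \<le> \<kappa>}"

definition cg_stopped_est ::
  "real mat \<Rightarrow> (nat \<Rightarrow> real) \<Rightarrow> (nat \<Rightarrow> real vec) \<Rightarrow> real \<Rightarrow> real vec \<Rightarrow> real vec" where
  "cg_stopped_est A lam u \<kappa> Y = cg_est A lam u Y (cg_stop A lam u \<kappa> Y)"

definition source_norm ::
  "nat \<Rightarrow> (nat \<Rightarrow> real) \<Rightarrow> (nat \<Rightarrow> real vec) \<Rightarrow> real \<Rightarrow> real vec \<Rightarrow> real" where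
  "source_norm D lam v \<mu> f = sqrt (\<Sum>i=1..D. lam i powr (- 4 * \<mu>) * (f \<bullet> v i)\<^sup>2)"

definition signals ::
  "nat \<Rightarrow> nat \<Rightarrow> (nat \<Rightarrow> real) \<Rightarrow> (nat \<Rightarrow> real vec) \<Rightarrow> real \<Rightarrow> real \<Rightarrow> real vec set" where
  "signals D P lam v \<mu> R = {f \<in> carrier_vec P. source_norm D lam v \<mu> f \<le> R}"

text \<open>The law of \<open>Z \<sim> N(0, I\<^sub>D)\<close>.  It is completed because the stopped estimator is only
  determined up to a null set, on which Borel measurability cannot be guaranteed.\<close>

definition std_gauss :: "nat \<Rightarrow> (nat \<Rightarrow> real) measure" where
  "std_gauss D = completion (PiM {..<D} (\<lambda>_. density lborel std_normal_density))"

definition obs :: "real mat \<Rightarrow> real vec \<Rightarrow> real \<Rightarrow> (nat \<Rightarrow> real) \<Rightarrow> real vec" where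
  "obs A f \<delta> z = A *\<^sub>v f + \<delta> \<cdot>\<^sub>v vec (dim_row A) z"

definition rec_loss ::
  "real mat \<Rightarrow> real \<Rightarrow> (real vec \<Rightarrow> real vec) \<Rightarrow> real vec \<Rightarrow> (nat \<Rightarrow> real) \<Rightarrow> real" where
  "rec_loss A \<delta> est f z = sq_norm (est (obs A f \<delta> z) - min_norm_sol A f)"

definition rec_risk ::
  "real mat \<Rightarrow> real \<Rightarrow> (real vec \<Rightarrow> real vec) \<Rightarrow> real vec \<Rightarrow> ennreal" where
  "rec_risk A \<delta> est f = (\<integral>\<^sup>+ z. ennreal (rec_loss A \<delta> est f z) \<partial>std_gauss (dim_row A))"

definition estimators :: "nat \<Rightarrow> nat \<Rightarrow> (real vec \<Rightarrow> real vec) set" where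
  "estimators D P =
     {est. (\<forall>y\<in>carrier_vec D. est y \<in> carrier_vec P) \<and>
        (\<forall>j<P. (\<lambda>y. est (vec D y) $ j) \<in> borel_measurable (PiM {..<D} (\<lambda>_. borel)))}"

definition minimax_risk ::
  "real mat \<Rightarrow> (nat \<Rightarrow> real) \<Rightarrow> (nat \<Rightarrow> real vec) \<Rightarrow> real \<Rightarrow> real \<Rightarrow> real \<Rightarrow> ennreal" where
  "minimax_risk A lam v \<mu> R \<delta> =
     (INF est\<in>estimators (dim_row A) (dim_col A).
        SUP f\<in>signals (dim_row A) (dim_col A) lam v \<mu> R. rec_risk A \<delta> est f)"

definition rec_rate :: "real \<Rightarrow> real \<Rightarrow> real \<Rightarrow> real \<Rightarrow> real" where
  "rec_rate \<mu> p R \<delta> =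
     R powr ((4 * p + 2) / (4 * \<mu> * p + 2 * p + 1)) *
     \<delta> powr (8 * \<mu> * p / (4 * \<mu> * p + 2 * p + 1))"

definition eff_dim :: "real \<Rightarrow> real \<Rightarrow> real \<Rightarrow> real \<Rightarrow> real" where
  "eff_dim \<mu> p R \<delta> = (R\<^sup>2 / \<delta>\<^sup>2) powr (1 / (4 * \<mu> * p + 2 * p + 1))"

end

theory Submission
  imports Defs
begin

text \<open>In singular coordinates the residual polynomial at the stopping time is a product of factors
  \<open>1 - b x\<close> with \<open>b > 0\<close>. Let \<open>\<rho> = \<bar>r'(0)\<bar>\<close> be the sum of the \<open>b\<close> and \<open>x\<^sub>1\<close> the smallest zero of \<open>r\<close>. Below
  \<open>x\<^sub>1\<close>, \<open>r\<close> decreases within \<open>[0,1]\<close> and \<open>1 - \<rho> x \<le> r(x) \<le> exp (- \<rho> x)\<close>, so the estimator acts like a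
  spectral cut-off at the index \<open>m = \<rho> powr (1 / (2 p))\<close>.

  The stopping rule is used twice. Since the squared residual is at most \<open>\<kappa>\<close>, the weak bias below
  \<open>x\<^sub>1\<close> and the residual above \<open>x\<^sub>1\<close> are of order \<open>\<delta>\<^sup>2 (a + m)\<close>, where \<open>a\<close> is of order \<open>sqrt (D z) + z\<close> with
  probability at least \<open>1 - 6 exp (- z)\<close>. Conversely, Nemirovskii's inequality bounds \<open>\<kappa>\<close> by the data
  below \<open>x\<^sub>1\<close> weighted with \<open>r\<close>, which forces \<open>m \<lesssim> N + a\<close> for the effective dimension \<open>N\<close>, unless
  \<open>D \<lesssim> a\<close>; in that case bounding by the smallest singular value suffices. Splitting the strong bias
  at a suitable spectral level then gives the error bound \<open>\<delta>\<^sup>2 (N + a) powr (2 p + 1)\<close>. As \<open>r\<close> depends on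
  the noise, the random sums are controlled uniformly over monotone weights by Abel summation.

  The minimax lower bound is Assouad's method on the first \<open>min \<lfloor>N\<rfloor> D\<close> singular directions.\<close>

section \<open>Deterministic error analysis\<close>

text \<open>The obstacle is that conjugate gradients are nonlinear in the data: \<open>r\<close> and
  \<open>\<rho>\<close> depend on the noise, so expectations do not split into bias and variance,
  and above its smallest zero \<open>r\<close> has no pointwise bound at all. Hence all randomness
  is confined to a few inequalities for sums over initial or final index segments. They are
  deterministic hypotheses of \<open>filtered_noise\<close> and hold on one event. Only the total
  noise energy must be known up to \<open>a\<close>, and this is where \<open>sqrt (D z) + z\<close>
  originates: \<open>\<kappa>\<close> and the noise energy both equal
  \<open>\<delta>\<^sup>2 * D\<close> up to \<open>\<delta>\<^sup>2 * a\<close>, so the dimension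
  cancels whenever they are compared. Partial sums need only a factor of two, and cross terms only a
  fraction of the signal energy; such deviations are exponentially small in \<open>a\<close>, and a
  union over \<open>D\<close> segments is affordable. The factor \<open>6\<close> counts the bad
  events. The minimisers are replaced by the explicit \<open>gs_residual\<close> because their
  definition says nothing about measurability; up to index \<open>d\<close> the two agree once every
  data coefficient is nonzero, hence almost surely.\<close>

lemma sum_decreasing_weights_le:
  fixes s d :: "nat \<Rightarrow> real"
  assumes part: "\<And>j. 1 \<le> j \<Longrightarrow> j \<le> n \<Longrightarrow> (\<Sum>i=1..j. d i) \<le> a"
    and anti: "\<And>i j. 1 \<le> i \<Longrightarrow> i \<le> j \<Longrightarrow> j \<le> n \<Longrightarrow> s j \<le> s i"
    and bounds: "\<And>i. 1 \<le> i \<Longrightarrow> i \<le> n \<Longrightarrow> 0 \<le> s i \<and> s i \<le> 1"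
    and a: "0 \<le> a"
  shows "(\<Sum>i=1..n. s i * d i) \<le> a"
proof (cases "n = 0")
  case True
  then show ?thesis using a by simp
next
  case False
  \<comment> \<open>Abel summation as an induction invariant: each drop
    \<open>s k - s (Suc k)\<close> of the weight multiplies a partial sum of \<open>d\<close> and so
    costs at most \<open>a\<close> times the drop.\<close>
  have abel: "(\<Sum>i=1..k. s i * d i) \<le> a * (s 1 - s k) + s k * (\<Sum>i=1..k. d i)"
    if "1 \<le> k" "k \<le> n" for k
    using that
  proof (induction k rule: nat_induct_at_least)
    case base
    then show ?case by simp
  next
    case (Suc k)
    have "(s k - s (Suc k)) * (\<Sum>i=1..k. d i) \<le> (s k - s (Suc k)) * a"
      using Suc by (intro mult_left_mono part) (auto intro: anti)
    then show ?case using Suc by (simp add: algebra_simps)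
  qed
  have "(\<Sum>i=1..n. s i * d i) \<le> a * (s 1 - s n) + s n * (\<Sum>i=1..n. d i)"
    using False by (intro abel) auto
  also have "\<dots> \<le> a * (s 1 - s n) + s n * a"
    using False part[of n] bounds[of n] by (intro add_left_mono mult_left_mono) auto
  also have "\<dots> = a * s 1" by (simp add: algebra_simps)
  also have "\<dots> \<le> a" using bounds[of 1] False a by (simp add: mult_left_le)
  finally show ?thesis .
qed

lemma sum_increasing_weights_le:
  fixes s d :: "nat \<Rightarrow> real"
  assumes part: "\<And>j. 1 \<le> j \<Longrightarrow> j \<le> n \<Longrightarrow> (\<Sum>i=j..n. d i) \<le> a"
    and mono: "\<And>i j. 1 \<le> i \<Longrightarrow> i \<le> j \<Longrightarrow> j \<le> n \<Longrightarrow> s i \<le> s j"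
    and bounds: "\<And>i. 1 \<le> i \<Longrightarrow> i \<le> n \<Longrightarrow> 0 \<le> s i \<and> s i \<le> 1"
    and a: "0 \<le> a"
  shows "(\<Sum>i=1..n. s i * d i) \<le> a"
proof -
  have "(\<Sum>i=1..n. s i * d i) = (\<Sum>i=1..n. s (n + 1 - i) * d (n + 1 - i))"
    by (rule sum.atLeastAtMost_rev)
  also have "\<dots> \<le> a"
  proof (rule sum_decreasing_weights_le[OF _ _ _ a])
    fix j assume j: "1 \<le> j" "j \<le> n"
    have "(\<Sum>i=1..j. d (n + 1 - i)) = (\<Sum>i=n + 1 - j..n. d i)"
      using j by (intro sum.reindex_bij_witness[where i="\<lambda>i. n + 1 - i" and j="\<lambda>i. n + 1 - i"]) auto
    also have "\<dots> \<le> a" using j by (intro part) auto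
    finally show "(\<Sum>i=1..j. d (n + 1 - i)) \<le> a" .
  qed (use bounds in \<open>auto intro!: mono\<close>)
  finally show ?thesis .
qed

text \<open>Comparison with the integral of \<open>t powr (- \<beta>)\<close>. Keeping the upper end
  point makes the bound telescope, and the induction step becomes the mean value theorem on one unit
  interval.\<close>

lemma sum_powr_tail_le:
  fixes \<beta> :: real
  assumes \<beta>: "\<beta> > 1" and n: "n \<ge> 1" and D: "n \<le> D"
  shows "(\<Sum>i=Suc n..D. real i powr (- \<beta>))
    \<le> (real n powr (1 - \<beta>) - real D powr (1 - \<beta>)) / (\<beta> - 1)"
  using D
proof (induction D rule: nat_induct_at_least)
  case base
  then show ?case by simp
next
  case (Suc D)
  have "\<exists>z>real D. z < real D + 1 \<and> (real D + 1) powr (1 - \<beta>) - real D powr (1 - \<beta>)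
      = (real D + 1 - real D) * ((1 - \<beta>) * z powr (1 - \<beta> - 1))"
    using Suc n by (intro MVT2) (auto intro!: derivative_eq_intros)
  then obtain z where z: "z > real D" "z < real D + 1"
      "(real D + 1) powr (1 - \<beta>) - real D powr (1 - \<beta>) = (1 - \<beta>) * z powr (- \<beta>)"
    by auto
  have "(real D + 1) powr (- \<beta>) \<le> z powr (- \<beta>)"
    using z \<beta> by (intro powr_mono2') auto
  then have "(\<beta> - 1) * (real D + 1) powr (- \<beta>) \<le> (\<beta> - 1) * z powr (- \<beta>)"
    using \<beta> by (intro mult_left_mono) auto
  also have "\<dots> = real D powr (1 - \<beta>) - (real D + 1) powr (1 - \<beta>)"
    using z(3) by (simp add: algebra_simps)
  finally have "(real D + 1) powr (- \<beta>)
      \<le> (real D powr (1 - \<beta>) - (real D + 1) powr (1 - \<beta>)) / (\<beta> - 1)"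
    using \<beta> by (simp add: field_simps)
  then show ?case using Suc
    by (simp add: diff_divide_distrib add.commute)
qed

text \<open>Effective rank of a polynomially decaying filter: about \<open>q\<close> indices count
  \<open>1\<close> each, and the tail beyond the ceiling of \<open>q\<close> adds at most
  \<open>q / (\<beta> - 1)\<close>.\<close>

lemma sum_min_powr_le:
  fixes \<beta> q :: real
  assumes \<beta>: "\<beta> > 1" and q: "q \<ge> 0"
  shows "(\<Sum>i=1..D. min 1 ((q / real i) powr \<beta>)) \<le> (1 + 1 / (\<beta> - 1)) * q + 1"
proof (cases "q = 0")
  case True
  then show ?thesis using \<beta> by simp
next
  case False
  with q have q: "q > 0" by simp
  define n where "n = nat \<lceil>q\<rceil>"
  have n: "real n \<ge> q" "real n \<le> q + 1" "n \<ge> 1"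
    using q by (auto simp: n_def le_nat_iff)
  show ?thesis
  proof (cases "D \<le> n")
    case True
    have "(\<Sum>i=1..D. min 1 ((q / real i) powr \<beta>)) \<le> (\<Sum>i=1..D. 1)"
      by (intro sum_mono) auto
    also have "\<dots> \<le> q + 1" using True n by simp
    also have "\<dots> \<le> (1 + 1 / (\<beta> - 1)) * q + 1" using q \<beta> by (simp add: field_simps)
    finally show ?thesis .
  next
    case False
    then have D: "n \<le> D" by simp
    have split: "{1..D} = {1..n} \<union> {Suc n..D}" using D n by auto
    have "(\<Sum>i=1..D. min 1 ((q / real i) powr \<beta>))
      = (\<Sum>i=1..n. min 1 ((q / real i) powr \<beta>)) + (\<Sum>i=Suc n..D. min 1 ((q / real i) powr \<beta>))"
      unfolding split by (intro sum.union_disjoint) auto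
    also have "\<dots> \<le> (\<Sum>i=1..n. 1) + (\<Sum>i=Suc n..D. q powr \<beta> * real i powr (- \<beta>))"
      using q by (intro add_mono sum_mono) (auto simp: powr_divide powr_minus field_simps min.coboundedI2)
    also have "\<dots> = real n + q powr \<beta> * (\<Sum>i=Suc n..D. real i powr (- \<beta>))"
      by (simp add: sum_distrib_left)
    also have "\<dots> \<le> (q + 1) + q powr \<beta> * (real n powr (1 - \<beta>) / (\<beta> - 1))"
    proof (intro add_mono mult_left_mono)
      have "(\<Sum>i=Suc n..D. real i powr (- \<beta>))
         \<le> (real n powr (1 - \<beta>) - real D powr (1 - \<beta>)) / (\<beta> - 1)"
        by (rule sum_powr_tail_le[OF \<beta> n(3) D])
      also have "\<dots> \<le> real n powr (1 - \<beta>) / (\<beta> - 1)"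
        using \<beta> by (intro divide_right_mono) auto
      finally show "(\<Sum>i=Suc n..D. real i powr (- \<beta>)) \<le> real n powr (1 - \<beta>) / (\<beta> - 1)" .
    qed (use n in auto)
    also have "\<dots> \<le> (q + 1) + q powr \<beta> * (q powr (1 - \<beta>) / (\<beta> - 1))"
      using n q \<beta> by (intro add_left_mono mult_left_mono divide_right_mono powr_mono2') auto
    also have "q powr \<beta> * (q powr (1 - \<beta>) / (\<beta> - 1)) = q / (\<beta> - 1)"
      using q by (simp flip: powr_add)
    finally show ?thesis by (simp add: algebra_simps)
  qed
qed

text \<open>The power \<open>s\<close> of \<open>y \<le> exp y\<close> at \<open>y = t / s\<close>.
  It trades exponential damping for a power, both under the source condition and in a summability
  argument.\<close>

lemma powr_mult_exp_minus_le:
  fixes s t :: real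
  assumes "s > 0" "t \<ge> 0"
  shows "t powr s * exp (- t) \<le> s powr s"
proof -
  have "t / s \<le> exp (t / s)" using exp_ge_add_one_self[of "t / s"] by linarith
  then have "(t / s) powr s \<le> exp (t / s) powr s" using assms by (intro powr_mono2) auto
  also have "\<dots> = exp t" using assms by (simp add: powr_def)
  finally have "t powr s \<le> s powr s * exp t"
    using assms by (simp add: powr_divide field_simps)
  then show ?thesis by (simp add: exp_minus field_simps)
qed

section \<open>Effective dimension and rate\<close>

lemma eff_dim_pos: "0 < R \<Longrightarrow> 0 < \<delta> \<Longrightarrow> 0 < eff_dim \<mu> p R \<delta>"
  by (simp add: eff_dim_def)

text \<open>The balance behind \<open>eff_dim\<close>: at cut-off index \<open>N\<close> the squared
  bias \<open>R\<^sup>2 * N powr (- 4 * \<mu> * p)\<close> equals the variance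
  \<open>\<delta>\<^sup>2 * N powr (2 * p + 1)\<close>.\<close>

lemma eff_dim_powr:
  assumes "\<mu> > 0" "p > 0" "0 < R" "0 < \<delta>"
  shows "\<delta>\<^sup>2 * eff_dim \<mu> p R \<delta> powr (4 * \<mu> * p + 2 * p + 1) = R\<^sup>2"
proof -
  have "4 * \<mu> * p + 2 * p + 1 > 0" using assms by (simp add: add_pos_pos)
  then have "eff_dim \<mu> p R \<delta> powr (4 * \<mu> * p + 2 * p + 1) = R\<^sup>2 / \<delta>\<^sup>2"
    using assms by (simp add: eff_dim_def powr_powr)
  then show ?thesis using assms by simp
qed

text \<open>The rate is the variance order of a spectral cut-off at the effective dimension. All
  later estimates are carried out in this form.\<close>

lemma rec_rate_eff_dim:
  assumes "\<mu> > 0" "p > 0" "0 < R" "0 < \<delta>"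
  shows "rec_rate \<mu> p R \<delta> = \<delta>\<^sup>2 * eff_dim \<mu> p R \<delta> powr (2 * p + 1)"
proof -
  define \<theta> where "\<theta> = 4 * \<mu> * p + 2 * p + 1"
  have \<theta>: "\<theta> > 0" using assms by (simp add: \<theta>_def add_pos_pos)
  have sq: "y\<^sup>2 powr s = y powr (2 * s)" if "y > 0" for y s :: real
    using that by (simp add: powr_powr flip: powr_numeral)
  have e: "2 - 2 * ((2 * p + 1) / \<theta>) = 8 * \<mu> * p / \<theta>"
    using \<theta> by (simp add: field_simps) (simp add: \<theta>_def)
  have "\<delta>\<^sup>2 * eff_dim \<mu> p R \<delta> powr (2 * p + 1) = \<delta> powr 2 * (R\<^sup>2 / \<delta>\<^sup>2) powr ((2 * p + 1) / \<theta>)"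
    using assms by (simp add: eff_dim_def powr_powr \<theta>_def)
  also have "\<dots> = R powr (2 * ((2 * p + 1) / \<theta>)) * (\<delta> powr 2 * \<delta> powr (- (2 * ((2 * p + 1) / \<theta>))))"
    using assms by (simp add: powr_divide sq powr_minus field_simps)
  also have "\<delta> powr 2 * \<delta> powr (- (2 * ((2 * p + 1) / \<theta>))) = \<delta> powr (8 * \<mu> * p / \<theta>)"
    unfolding e[symmetric] powr_add[symmetric] by simp
  also have "2 * ((2 * p + 1) / \<theta>) = (4 * p + 2) / \<theta>" by simp
  finally show ?thesis by (simp add: rec_rate_def \<theta>_def)
qed

text \<open>Here \<open>r\<close> stands for the stopped residual polynomial, \<open>\<rho>\<close> for the sum and \<open>\<beta>\<close> for the maximum of the
  reciprocals of its zeros (both \<open>0\<close> if \<open>r = 1\<close>), so \<open>\<beta> * x < 1\<close> means that \<open>x\<close> lies below all zeros.\<close>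

locale filtered_noise =
  fixes D :: nat and \<mu> p cA CA K :: real and lam f \<epsilon> :: "nat \<Rightarrow> real"
    and \<delta> R \<kappa> a :: real and r :: "real \<Rightarrow> real" and \<rho> \<beta> :: real
  assumes \<mu>: "\<mu> > 0" and p: "p > 1/2" and cA: "cA > 0" and CA: "cA \<le> CA" and K: "K > 0"
    and D: "D \<ge> 1"
    and lam_lower: "\<And>i. 1 \<le> i \<Longrightarrow> i \<le> D \<Longrightarrow> cA * real i powr (- p) \<le> lam i"
    and lam_upper: "\<And>i. 1 \<le> i \<Longrightarrow> i \<le> D \<Longrightarrow> lam i \<le> CA * real i powr (- p)"
    and lam_anti: "\<And>i j. 1 \<le> i \<Longrightarrow> i \<le> j \<Longrightarrow> j \<le> D \<Longrightarrow> lam j \<le> lam i"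
    and source: "(\<Sum>i=1..D. lam i powr (- 4 * \<mu>) * (f i)\<^sup>2) \<le> R\<^sup>2"
    and R: "R > 0" and \<delta>: "\<delta> > 0" and a: "a \<ge> 1"
    and \<kappa>: "\<bar>\<kappa> - \<delta>\<^sup>2 * real D\<bar> \<le> \<delta>\<^sup>2 * a"
    and eff_dim_le: "eff_dim \<mu> p R \<delta> \<le> K * real D"
    and noise_total: "\<bar>(\<Sum>i=1..D. (\<epsilon> i)\<^sup>2) - real D\<bar> \<le> a"
    and noise_lower: "\<And>j. 1 \<le> j \<Longrightarrow> j \<le> D \<Longrightarrow> real j / 2 - a \<le> (\<Sum>i=1..j. (\<epsilon> i)\<^sup>2)"
    and noise_upper: "\<And>j. 1 \<le> j \<Longrightarrow> j \<le> D \<Longrightarrow> (\<Sum>i=1..j. (\<epsilon> i)\<^sup>2) \<le> 2 * real j + a"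
    and cross: "\<And>j. 1 \<le> j \<Longrightarrow> j \<le> D \<Longrightarrow>
      \<bar>\<Sum>i=j..D. lam i * f i * (\<delta> * \<epsilon> i)\<bar> \<le> (\<Sum>i=j..D. (lam i * f i)\<^sup>2) / 8 + \<delta>\<^sup>2 * a"
    and \<beta>: "0 \<le> \<beta>" "\<beta> \<le> \<rho>"
    and r_nonneg: "\<And>x. 0 \<le> x \<Longrightarrow> \<beta> * x < 1 \<Longrightarrow> 0 \<le> r x"
    and r_le: "\<And>x. 0 \<le> x \<Longrightarrow> \<beta> * x < 1 \<Longrightarrow> r x \<le> exp (- \<rho> * x)"
    and r_ge: "\<And>x. 0 \<le> x \<Longrightarrow> \<beta> * x < 1 \<Longrightarrow> 1 - \<rho> * x \<le> r x"
    and r_anti: "\<And>x y. 0 \<le> x \<Longrightarrow> x \<le> y \<Longrightarrow> \<beta> * y < 1 \<Longrightarrow> r y \<le> r x"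
    and residual_le: "(\<Sum>i=1..D. (lam i * f i + \<delta> * \<epsilon> i)\<^sup>2 * (r ((lam i)\<^sup>2))\<^sup>2) \<le> \<kappa>"
    and residual_ge: "0 < \<rho> \<Longrightarrow>
      \<kappa> \<le> (\<Sum>i=1..D. if \<beta> * (lam i)\<^sup>2 < 1
             then (lam i * f i + \<delta> * \<epsilon> i)\<^sup>2 * r ((lam i)\<^sup>2) else 0)"
begin

section \<open>The spectral filter below the smallest zero\<close>

definition "x i = (lam i)\<^sup>2"
definition "g i = lam i * f i"
text \<open>Setting the filter to \<open>0\<close> above the smallest zero keeps it in
  \<open>[0,1]\<close> and increasing in the index, as Abel summation requires; the part of
  \<open>r\<close> that is cut away is accounted for by \<open>tail_res\<close>.\<close>

definition "w i = (if \<beta> * x i < 1 then r (x i) else 0)"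
text \<open>A majorant of \<open>1 - w i\<close>. Unlike \<open>1 - w i\<close>, it can be summed
  directly from the decay of the singular values.\<close>

definition "s i = min 1 (\<rho> * x i)"
definition "N = eff_dim \<mu> p R \<delta>"
definition "m = \<rho> powr (1 / (2 * p))"
definition "tail_res = (\<Sum>i=1..D. if \<beta> * x i < 1 then 0 else (g i + \<delta> * \<epsilon> i)\<^sup>2 * (r (x i))\<^sup>2)"
definition "loss = (\<Sum>i=1..D. ((1 - r (x i)) * (g i + \<delta> * \<epsilon> i) / lam i - f i)\<^sup>2)"

lemma p_pos: "p > 0" using p by simp

lemma CA_pos: "CA > 0" using cA CA by simp

lemma \<rho>_nonneg: "0 \<le> \<rho>" using \<beta> by simp

lemma N_pos: "N > 0" unfolding N_def using R \<delta> by (rule eff_dim_pos)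

lemma m_nonneg: "m \<ge> 0" by (simp add: m_def)

lemma \<rho>_m: "\<rho> = m powr (2 * p)"
  using \<rho>_nonneg p by (simp add: m_def powr_powr)

lemma lam_pos: "1 \<le> i \<Longrightarrow> i \<le> D \<Longrightarrow> lam i > 0"
  by (rule less_le_trans[OF _ lam_lower]) (use cA in auto)

lemma x_pos: "1 \<le> i \<Longrightarrow> i \<le> D \<Longrightarrow> x i > 0"
  using lam_pos[of i] by (simp add: x_def)

lemma x_anti: "1 \<le> i \<Longrightarrow> i \<le> j \<Longrightarrow> j \<le> D \<Longrightarrow> x j \<le> x i"
  unfolding x_def using lam_anti[of i j] lam_pos[of j] by (intro power_mono) auto

lemma x_upper:
  assumes "1 \<le> i" "i \<le> D" shows "x i \<le> CA\<^sup>2 * real i powr (- 2 * p)"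
proof -
  have "x i \<le> (CA * real i powr (- p))\<^sup>2"
    unfolding x_def using assms lam_upper lam_pos by (intro power_mono) (auto simp: less_imp_le)
  also have "\<dots> = CA\<^sup>2 * real i powr (- 2 * p)"
    using assms by (simp add: power_mult_distrib powr_powr mult.commute flip: powr_numeral)
  finally show ?thesis .
qed

lemma x_lower:
  assumes "1 \<le> i" "i \<le> D" shows "cA\<^sup>2 * real i powr (- 2 * p) \<le> x i"
proof -
  have "cA\<^sup>2 * real i powr (- 2 * p) = (cA * real i powr (- p))\<^sup>2"
    using assms by (simp add: power_mult_distrib powr_powr mult.commute flip: powr_numeral)
  also have "\<dots> \<le> x i"
    unfolding x_def using assms lam_lower cA by (intro power_mono) auto
  finally show ?thesis .
qed

lemma f_sq: "1 \<le> i \<Longrightarrow> i \<le> D \<Longrightarrow> (f i)\<^sup>2 = x i powr (2 * \<mu>) * (lam i powr (- 4 * \<mu>) * (f i)\<^sup>2)"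
  using lam_pos[of i] unfolding x_def
  by (simp add: powr_powr powr_minus flip: powr_numeral)

lemma g_sq: "1 \<le> i \<Longrightarrow> i \<le> D \<Longrightarrow> (g i)\<^sup>2 = x i * (f i)\<^sup>2"
  by (simp add: g_def x_def power_mult_distrib)

lemma w_nonneg: "1 \<le> i \<Longrightarrow> i \<le> D \<Longrightarrow> 0 \<le> w i"
  using r_nonneg x_pos by (simp add: w_def less_imp_le)

lemma w_le_exp: "1 \<le> i \<Longrightarrow> i \<le> D \<Longrightarrow> w i \<le> exp (- \<rho> * x i)"
  using r_le[of "x i"] x_pos[of i] by (simp add: w_def less_imp_le)

lemma w_le_one: "1 \<le> i \<Longrightarrow> i \<le> D \<Longrightarrow> w i \<le> 1"
  by (rule order_trans[OF w_le_exp]) (use x_pos[of i] \<rho>_nonneg in auto)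

lemma w_mono:
  assumes "1 \<le> i" "i \<le> j" "j \<le> D" shows "w i \<le> w j"
proof (cases "\<beta> * x i < 1")
  case True
  have "\<beta> * x j \<le> \<beta> * x i" using assms x_anti \<beta> by (intro mult_left_mono) auto
  then show ?thesis
    using True assms r_anti[of "x j" "x i"] x_anti[of i j] x_pos[of j] by (simp add: w_def)
next
  case False
  then show ?thesis using assms w_nonneg[of j] by (simp add: w_def)
qed

lemma s_nonneg: "1 \<le> i \<Longrightarrow> i \<le> D \<Longrightarrow> 0 \<le> s i"
  using x_pos[of i] \<rho>_nonneg by (simp add: s_def)

lemma s_le_one: "s i \<le> 1" by (simp add: s_def)

lemma s_le: "s i \<le> \<rho> * x i" by (simp add: s_def)

lemma s_tail: 
  assumes "1 \<le> i" "i \<le> D" "\<not> \<beta> * x i < 1" shows "s i = 1"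
proof -
  have "\<beta> * x i \<le> \<rho> * x i" using assms x_pos \<beta> by (intro mult_right_mono) (auto simp: less_imp_le)
  then show ?thesis using assms by (simp add: s_def)
qed

lemma one_minus_w_le: "1 \<le> i \<Longrightarrow> i \<le> D \<Longrightarrow> 1 - w i \<le> s i"
  using r_ge[of "x i"] x_pos[of i] s_tail[of i] w_nonneg[of i] by (auto simp: w_def s_def less_imp_le)

lemma s_anti: "1 \<le> i \<Longrightarrow> i \<le> j \<Longrightarrow> j \<le> D \<Longrightarrow> s j \<le> s i"
  unfolding s_def using x_anti[of i j] \<rho>_nonneg by (intro min.mono mult_left_mono) auto

text \<open>\<open>cross\<close> controls final segments of the index range only. As the weights
  increase with the index, Abel summation applies to the cross term minus its allowance
  \<open>(g i)\<^sup>2 / 8\<close>, once for each sign, and covers every noise-dependent monotone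
  filter simultaneously.\<close>

lemma weighted_cross:
  assumes bounds: "\<And>i. 1 \<le> i \<Longrightarrow> i \<le> D \<Longrightarrow> 0 \<le> v i \<and> v i \<le> 1"
    and mono: "\<And>i j. 1 \<le> i \<Longrightarrow> i \<le> j \<Longrightarrow> j \<le> D \<Longrightarrow> v i \<le> v j"
  shows "\<bar>\<Sum>i=1..D. v i * (g i * (\<delta> * \<epsilon> i))\<bar> \<le> (\<Sum>i=1..D. v i * (g i)\<^sup>2) / 8 + \<delta>\<^sup>2 * a"
proof -
  have "(\<Sum>i=1..D. v i * (\<sigma> * (g i * (\<delta> * \<epsilon> i)) - (g i)\<^sup>2 / 8)) \<le> \<delta>\<^sup>2 * a" if "\<bar>\<sigma>\<bar> = 1" for \<sigma>
  proof (rule sum_increasing_weights_le)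
    fix j assume j: "1 \<le> j" "j \<le> D"
    have "(\<Sum>i=j..D. \<sigma> * (g i * (\<delta> * \<epsilon> i)) - (g i)\<^sup>2 / 8)
       = \<sigma> * (\<Sum>i=j..D. g i * (\<delta> * \<epsilon> i)) - (\<Sum>i=j..D. (g i)\<^sup>2) / 8"
      by (simp add: sum_subtractf sum_distrib_left sum_divide_distrib)
    also have "\<sigma> * (\<Sum>i=j..D. g i * (\<delta> * \<epsilon> i)) \<le> \<bar>\<Sum>i=j..D. g i * (\<delta> * \<epsilon> i)\<bar>"
      by (metis abs_le_D1 abs_mult lambda_one order_refl that)
    finally show "(\<Sum>i=j..D. \<sigma> * (g i * (\<delta> * \<epsilon> i)) - (g i)\<^sup>2 / 8) \<le> \<delta>\<^sup>2 * a"
      using cross[OF j] by (simp add: g_def)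
  qed (use assms a in auto)
  note * = this
  have **: "\<sigma> * (\<Sum>i=1..D. v i * (g i * (\<delta> * \<epsilon> i))) - (\<Sum>i=1..D. v i * (g i)\<^sup>2) / 8 \<le> \<delta>\<^sup>2 * a"
    if "\<bar>\<sigma>\<bar> = 1" for \<sigma>
  proof -
    have "(\<Sum>i=1..D. v i * (\<sigma> * (g i * (\<delta> * \<epsilon> i)) - (g i)\<^sup>2 / 8))
      = \<sigma> * (\<Sum>i=1..D. v i * (g i * (\<delta> * \<epsilon> i))) - (\<Sum>i=1..D. v i * (g i)\<^sup>2) / 8"
      unfolding sum_distrib_left sum_divide_distrib sum_subtractf[symmetric]
      by (intro sum.cong) (auto simp: algebra_simps)
    then show ?thesis using *[OF that] by simp
  qed
  show ?thesis using **[of 1] **[of "-1"] by (simp add: abs_le_iff)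
qed

section \<open>Residual, bias and loss in terms of the filter\<close>

definition "C1 = (1 + 1 / (2 * p - 1)) * CA powr (1 / p)"

lemma C1_nonneg: "C1 \<ge> 0" using p by (simp add: C1_def)

text \<open>The filter has effective rank of order \<open>m\<close>: with
  \<open>q = CA powr (1 / p) * m\<close> the upper decay bound gives
  \<open>\<rho> * x i \<le> (q / i) powr (2 * p)\<close>, and this is where \<open>p > 1/2\<close>
  provides summability.\<close>

lemma sum_s_le: "(\<Sum>i=1..D. s i) \<le> C1 * m + 1"
proof -
  define q where "q = CA powr (1 / p) * m"
  have q: "q \<ge> 0" using m_nonneg by (simp add: q_def)
  have "s i \<le> min 1 ((q / real i) powr (2 * p))" if "i \<in> {1..D}" for i
  proof -
    have "\<rho> * x i \<le> \<rho> * (CA\<^sup>2 * real i powr (- 2 * p))"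
      using that x_upper \<rho>_nonneg by (intro mult_left_mono) auto
    also have "\<dots> = (q / real i) powr (2 * p)"
      using that p CA_pos m_nonneg
      by (subst \<rho>_m) (simp add: q_def powr_divide powr_mult powr_powr powr_minus field_simps)
    finally show ?thesis by (auto simp: s_def)
  qed
  then have "(\<Sum>i=1..D. s i) \<le> (\<Sum>i=1..D. min 1 ((q / real i) powr (2 * p)))"
    by (rule sum_mono)
  also have "\<dots> \<le> (1 + 1 / (2 * p - 1)) * q + 1"
    using p q by (intro sum_min_powr_le) auto
  finally show ?thesis by (simp add: C1_def q_def)
qed

lemma sum_s_noise_le: "(\<Sum>i=1..D. s i * (\<epsilon> i)\<^sup>2) \<le> (2 * C1 + 3) * (m + a)"
proof -
  \<comment> \<open>Centring at \<open>2\<close> instead of the mean \<open>1\<close> matches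
    \<open>noise_upper\<close>: the excess over \<open>2 * j\<close> is at most \<open>a\<close> on
    every initial segment, which suits the decreasing weights \<open>s\<close>.\<close>
  have "(\<Sum>i=1..D. s i * ((\<epsilon> i)\<^sup>2 - 2)) \<le> a"
  proof (rule sum_decreasing_weights_le)
    fix j assume j: "1 \<le> j" "j \<le> D"
    show "(\<Sum>i=1..j. (\<epsilon> i)\<^sup>2 - 2) \<le> a" using noise_upper[OF j] by (simp add: sum_subtractf)
  qed (use s_nonneg s_le_one s_anti a in auto)
  then have "(\<Sum>i=1..D. s i * (\<epsilon> i)\<^sup>2) \<le> a + 2 * (\<Sum>i=1..D. s i)"
    by (simp add: sum_subtractf right_diff_distrib sum_distrib_left mult.commute)
  also have "\<dots> \<le> a + 2 * (C1 * m + 1)" using sum_s_le by simp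
  also have "\<dots> \<le> (2 * C1 + 3) * (m + a)"
    using m_nonneg a mult_nonneg_nonneg[OF C1_nonneg, of a] by (simp add: algebra_simps)
  finally show ?thesis .
qed

text \<open>Expanding the square in \<open>residual_le\<close>, the term
  \<open>\<delta>\<^sup>2 * D\<close> cancels between \<open>\<kappa>\<close> and the noise energy.
  What remains on the right is the noise that the filter has fitted, with
  \<open>1 - (w i)\<^sup>2 \<le> 2 * s i\<close>. The \<open>4\<close> collects one \<open>a\<close>
  from \<open>\<kappa>\<close>, one from the noise energy and two from the doubled cross term, which
  also reduces the signal by \<open>2/8\<close> and leaves \<open>3/4\<close>.\<close>

lemma residual_split:
  "tail_res + 3/4 * (\<Sum>i=1..D. (w i)\<^sup>2 * (g i)\<^sup>2)
    \<le> 4 * \<delta>\<^sup>2 * a + 2 * \<delta>\<^sup>2 * (\<Sum>i=1..D. s i * (\<epsilon> i)\<^sup>2)"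
proof -
  have "(\<Sum>i=1..D. (g i + \<delta> * \<epsilon> i)\<^sup>2 * (r (x i))\<^sup>2)
      = tail_res + (\<Sum>i=1..D. (w i)\<^sup>2 * (g i + \<delta> * \<epsilon> i)\<^sup>2)"
    unfolding tail_res_def sum.distrib[symmetric] by (intro sum.cong) (auto simp: w_def)
  also have "(\<Sum>i=1..D. (w i)\<^sup>2 * (g i + \<delta> * \<epsilon> i)\<^sup>2)
      = (\<Sum>i=1..D. (w i)\<^sup>2 * (g i)\<^sup>2) + 2 * (\<Sum>i=1..D. (w i)\<^sup>2 * (g i * (\<delta> * \<epsilon> i)))
        + (\<delta>\<^sup>2 * (\<Sum>i=1..D. (\<epsilon> i)\<^sup>2) - \<delta>\<^sup>2 * (\<Sum>i=1..D. (1 - (w i)\<^sup>2) * (\<epsilon> i)\<^sup>2))"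
    unfolding sum_distrib_left sum.distrib[symmetric] sum_subtractf[symmetric]
    by (intro sum.cong) (auto simp: power2_eq_square algebra_simps)
  finally have eq: "(\<Sum>i=1..D. (g i + \<delta> * \<epsilon> i)\<^sup>2 * (r (x i))\<^sup>2)
      = tail_res + ((\<Sum>i=1..D. (w i)\<^sup>2 * (g i)\<^sup>2) + 2 * (\<Sum>i=1..D. (w i)\<^sup>2 * (g i * (\<delta> * \<epsilon> i)))
        + (\<delta>\<^sup>2 * (\<Sum>i=1..D. (\<epsilon> i)\<^sup>2) - \<delta>\<^sup>2 * (\<Sum>i=1..D. (1 - (w i)\<^sup>2) * (\<epsilon> i)\<^sup>2)))" .
  have c: "\<bar>\<Sum>i=1..D. (w i)\<^sup>2 * (g i * (\<delta> * \<epsilon> i))\<bar> \<le> (\<Sum>i=1..D. (w i)\<^sup>2 * (g i)\<^sup>2) / 8 + \<delta>\<^sup>2 * a"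
    using w_nonneg w_le_one w_mono
    by (intro weighted_cross) (auto intro!: power_le_one power_mono)
  have "(\<Sum>i=1..D. (1 - (w i)\<^sup>2) * (\<epsilon> i)\<^sup>2) \<le> (\<Sum>i=1..D. 2 * (s i * (\<epsilon> i)\<^sup>2))"
  proof (intro sum_mono)
    fix i assume i: "i \<in> {1..D}"
    have "1 - (w i)\<^sup>2 = (1 - w i) * (1 + w i)" by (simp add: power2_eq_square algebra_simps)
    also have "\<dots> \<le> (1 - w i) * 2" using i w_le_one by (intro mult_left_mono) auto
    also have "\<dots> \<le> 2 * s i" using i one_minus_w_le[of i] by simp
    finally show "(1 - (w i)\<^sup>2) * (\<epsilon> i)\<^sup>2 \<le> 2 * (s i * (\<epsilon> i)\<^sup>2)"
      using mult_right_mono[of _ _ "(\<epsilon> i)\<^sup>2"] by fastforce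
  qed
  then have d: "\<delta>\<^sup>2 * (\<Sum>i=1..D. (1 - (w i)\<^sup>2) * (\<epsilon> i)\<^sup>2) \<le> \<delta>\<^sup>2 * (2 * (\<Sum>i=1..D. s i * (\<epsilon> i)\<^sup>2))"
    by (intro mult_left_mono) (auto simp: sum_distrib_left)
  have e: "\<delta>\<^sup>2 * (real D - (\<Sum>i=1..D. (\<epsilon> i)\<^sup>2)) \<le> \<delta>\<^sup>2 * a"
    using noise_total by (intro mult_left_mono) auto
  show ?thesis using eq c d e \<kappa> residual_le unfolding g_def x_def
    by (simp add: algebra_simps abs_le_iff)
qed

definition "C2 = 4 + 2 * (2 * C1 + 3)"

lemma residual_bound:
  "4 * \<delta>\<^sup>2 * a + 2 * \<delta>\<^sup>2 * (\<Sum>i=1..D. s i * (\<epsilon> i)\<^sup>2) \<le> \<delta>\<^sup>2 * (C2 * (m + a))"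
proof -
  have "4 * a + 2 * (\<Sum>i=1..D. s i * (\<epsilon> i)\<^sup>2) \<le> 4 * (m + a) + 2 * ((2 * C1 + 3) * (m + a))"
    using sum_s_noise_le m_nonneg by (intro add_mono mult_left_mono) auto
  also have "\<dots> = C2 * (m + a)" by (simp add: C2_def algebra_simps)
  finally show ?thesis using mult_left_mono[of _ _ "\<delta>\<^sup>2"] by (fastforce simp: algebra_simps)
qed

lemma tail_res_nonneg: "tail_res \<ge> 0"
  unfolding tail_res_def by (intro sum_nonneg) auto

lemma tail_res_le: "tail_res \<le> \<delta>\<^sup>2 * (C2 * (m + a))"
proof -
  have "0 \<le> (\<Sum>i=1..D. (w i)\<^sup>2 * (g i)\<^sup>2)" by (intro sum_nonneg) auto
  then show ?thesis using residual_split residual_bound by linarith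
qed

lemma weak_bias_le: "(\<Sum>i=1..D. (w i)\<^sup>2 * (g i)\<^sup>2) \<le> 4/3 * (\<delta>\<^sup>2 * (C2 * (m + a)))"
  using residual_split residual_bound tail_res_nonneg by linarith

text \<open>This elementary splitting at the level \<open>t\<close> replaces the interpolation (Hoelder) inequality
  between the weak norm of the bias and the source norm.\<close>

lemma bias_le:
  assumes t: "t > 0"
  shows "(\<Sum>i=1..D. (w i)\<^sup>2 * (f i)\<^sup>2) \<le> (\<Sum>i=1..D. (w i)\<^sup>2 * (g i)\<^sup>2) / t + t powr (2 * \<mu>) * R\<^sup>2"
proof -
  have "(w i)\<^sup>2 * (f i)\<^sup>2 \<le> (w i)\<^sup>2 * (g i)\<^sup>2 / t + t powr (2 * \<mu>) * (lam i powr (- 4 * \<mu>) * (f i)\<^sup>2)"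
    if "i \<in> {1..D}" for i
  proof (cases "x i \<ge> t")
    case True
    have "(f i)\<^sup>2 \<le> (g i)\<^sup>2 / t" using that True t by (simp add: g_sq field_simps mult_right_mono)
    then have "(w i)\<^sup>2 * (f i)\<^sup>2 \<le> (w i)\<^sup>2 * (g i)\<^sup>2 / t"
      using mult_left_mono[of _ _ "(w i)\<^sup>2"] by fastforce
    then show ?thesis by (simp add: add_increasing2)
  next
    case False
    have "(w i)\<^sup>2 * (f i)\<^sup>2 \<le> 1 * (f i)\<^sup>2"
      using that w_nonneg w_le_one by (intro mult_right_mono) (auto simp: power_le_one)
    also have "1 * (f i)\<^sup>2 = x i powr (2 * \<mu>) * (lam i powr (- 4 * \<mu>) * (f i)\<^sup>2)"
      using that f_sq[of i] by simp
    also have "\<dots> \<le> t powr (2 * \<mu>) * (lam i powr (- 4 * \<mu>) * (f i)\<^sup>2)"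
      using False that x_pos[of i] \<mu> by (intro mult_right_mono powr_mono2) auto
    finally show ?thesis using t by (simp add: add_increasing)
  qed
  then have "(\<Sum>i=1..D. (w i)\<^sup>2 * (f i)\<^sup>2)
      \<le> (\<Sum>i=1..D. (w i)\<^sup>2 * (g i)\<^sup>2 / t + t powr (2 * \<mu>) * (lam i powr (- 4 * \<mu>) * (f i)\<^sup>2))"
    by (rule sum_mono)
  also have "\<dots> = (\<Sum>i=1..D. (w i)\<^sup>2 * (g i)\<^sup>2) / t
      + t powr (2 * \<mu>) * (\<Sum>i=1..D. lam i powr (- 4 * \<mu>) * (f i)\<^sup>2)"
    by (simp add: sum.distrib sum_distrib_left sum_divide_distrib)
  also have "\<dots> \<le> (\<Sum>i=1..D. (w i)\<^sup>2 * (g i)\<^sup>2) / t + t powr (2 * \<mu>) * R\<^sup>2"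
    using source by (intro add_left_mono mult_left_mono) auto
  finally show ?thesis .
qed

text \<open>Below the smallest zero the error splits into noise and bias, and
  \<open>(1 - w i)\<^sup>2 / x i \<le> \<rho> * s i\<close> since \<open>1 - w i\<close> is at most
  \<open>s i\<close> and hence at most \<open>\<rho> * x i\<close>. Above it the error is written as
  noise minus residual, both divided by \<open>lam i\<close>: there
  \<open>\<rho> * x i \<ge> 1\<close>, so the inversion costs at most the factor
  \<open>\<rho>\<close>, and no pointwise bound on \<open>r\<close> is required.\<close>

lemma loss_split:
  "loss \<le> 2 * \<rho> * \<delta>\<^sup>2 * (\<Sum>i=1..D. s i * (\<epsilon> i)\<^sup>2) + 2 * (\<Sum>i=1..D. (w i)\<^sup>2 * (f i)\<^sup>2) + 2 * \<rho> * tail_res"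
proof -
  have pointwise: "((1 - r (x i)) * (g i + \<delta> * \<epsilon> i) / lam i - f i)\<^sup>2
      \<le> 2 * \<rho> * \<delta>\<^sup>2 * (s i * (\<epsilon> i)\<^sup>2) + 2 * ((w i)\<^sup>2 * (f i)\<^sup>2)
        + 2 * \<rho> * (if \<beta> * x i < 1 then 0 else (g i + \<delta> * \<epsilon> i)\<^sup>2 * (r (x i))\<^sup>2)"
    if i: "i \<in> {1..D}" for i
  proof -
    have l: "lam i > 0" "x i > 0" using i lam_pos x_pos by auto
    have sq: "(u + v)\<^sup>2 \<le> 2 * u\<^sup>2 + 2 * v\<^sup>2" for u v :: real
      using sum_squares_ge_zero[of "u - v" 0] by (simp add: power2_eq_square algebra_simps)
    show ?thesis
    proof (cases "\<beta> * x i < 1")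
      case True
      have "((1 - r (x i)) * (g i + \<delta> * \<epsilon> i) / lam i - f i)
          = (1 - w i) * (\<delta> * \<epsilon> i) / lam i + (- (w i * f i))"
        using l True by (simp add: w_def g_def field_simps)
      then have "((1 - r (x i)) * (g i + \<delta> * \<epsilon> i) / lam i - f i)\<^sup>2
          \<le> 2 * ((1 - w i) * (\<delta> * \<epsilon> i) / lam i)\<^sup>2 + 2 * (w i * f i)\<^sup>2"
        using sq[of "(1 - w i) * (\<delta> * \<epsilon> i) / lam i" "- (w i * f i)"] by simp
      also have "((1 - w i) * (\<delta> * \<epsilon> i) / lam i)\<^sup>2 = (1 - w i)\<^sup>2 / x i * (\<delta>\<^sup>2 * (\<epsilon> i)\<^sup>2)"
        by (simp add: x_def power_mult_distrib power_divide)
      also have "(1 - w i)\<^sup>2 / x i \<le> \<rho> * s i"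
      proof -
        have "(1 - w i) * (1 - w i) \<le> s i * (\<rho> * x i)"
          using i w_le_one[of i] one_minus_w_le[of i] s_le[of i] s_nonneg[of i] by (intro mult_mono) auto
        then show ?thesis using l by (simp add: power2_eq_square field_simps)
      qed
      finally show ?thesis using True by (simp add: power_mult_distrib mult_right_mono algebra_simps)
    next
      case False
      have "((1 - r (x i)) * (g i + \<delta> * \<epsilon> i) / lam i - f i)
          = (\<delta> * \<epsilon> i) / lam i + (- ((g i + \<delta> * \<epsilon> i) * r (x i) / lam i))"
        using l by (simp add: g_def field_simps)
      then have "((1 - r (x i)) * (g i + \<delta> * \<epsilon> i) / lam i - f i)\<^sup>2
          \<le> 2 * ((\<delta> * \<epsilon> i) / lam i)\<^sup>2 + 2 * ((g i + \<delta> * \<epsilon> i) * r (x i) / lam i)\<^sup>2"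
        using sq[of "(\<delta> * \<epsilon> i) / lam i" "- ((g i + \<delta> * \<epsilon> i) * r (x i) / lam i)"] by simp
      also have "\<dots> = (1 / x i) * (2 * (\<delta>\<^sup>2 * (\<epsilon> i)\<^sup>2) + 2 * ((g i + \<delta> * \<epsilon> i)\<^sup>2 * (r (x i))\<^sup>2))"
        by (simp add: x_def power_mult_distrib power_divide add_divide_distrib distrib_left)
      also have "\<dots> \<le> \<rho> * (2 * (\<delta>\<^sup>2 * (\<epsilon> i)\<^sup>2) + 2 * ((g i + \<delta> * \<epsilon> i)\<^sup>2 * (r (x i))\<^sup>2))"
      proof (rule mult_right_mono)
        have "1 \<le> \<rho> * x i" using s_tail[of i] s_le[of i] i False by simp
        then show "1 / x i \<le> \<rho>" using l by (simp add: field_simps)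
      qed auto
      finally show ?thesis using False i s_tail[of i] by (simp add: w_def algebra_simps)
    qed
  qed
  show ?thesis
    unfolding loss_def tail_res_def sum_distrib_left sum.distrib[symmetric]
    by (rule sum_mono) (rule pointwise)
qed

section \<open>Upper bound for the cut-off index\<close>

definition "\<theta> = 2 * p + 4 * \<mu> * p"
definition "C3 = (1 + 2 * \<mu>) powr (1 + 2 * \<mu>)"

lemma \<theta>_pos: "\<theta> > 0" using \<mu> p by (simp add: \<theta>_def add_pos_pos)

lemma C3_pos: "C3 > 0" using \<mu> by (simp add: C3_def)

lemma R_sq: "R\<^sup>2 = \<delta>\<^sup>2 * (N * N powr \<theta>)"
  using eff_dim_powr[OF \<mu> p_pos R \<delta>] N_pos
  by (simp add: N_def \<theta>_def powr_add algebra_simps)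

text \<open>The source condition supplies \<open>x i powr (1 + 2 * \<mu>)\<close>, which the damping
  \<open>exp (- \<rho> * x i)\<close> bounds by \<open>C3 * \<rho> powr (- (1 + 2 * \<mu>)) = C3 * m
  powr (- \<theta>)\<close>. Substituting the balance for \<open>R\<^sup>2\<close> gives a form that
  is of order \<open>\<delta>\<^sup>2 * N\<close> as soon as \<open>m \<ge> N\<close>.\<close>

lemma strong_bias_le:
  assumes \<rho>: "\<rho> > 0"
  shows "(\<Sum>i=1..D. w i * (g i)\<^sup>2) \<le> \<delta>\<^sup>2 * (C3 * N * (N / m) powr \<theta>)"
proof -
  have m: "m > 0" using \<rho> by (simp add: m_def)
  define h where "h i = lam i powr (- 4 * \<mu>) * (f i)\<^sup>2" for i
  have h: "h i \<ge> 0" for i by (simp add: h_def)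
  have "w i * (g i)\<^sup>2 \<le> (C3 * \<rho> powr (- (1 + 2 * \<mu>))) * h i" if i: "i \<in> {1..D}" for i
  proof -
    have xi: "x i > 0" using i x_pos by simp
    have "(g i)\<^sup>2 = x i * (x i powr (2 * \<mu>) * h i)"
      using i f_sq[of i] by (simp add: g_sq h_def)
    also have "\<dots> = x i powr (1 + 2 * \<mu>) * h i" using xi by (simp add: powr_add)
    finally have "w i * (g i)\<^sup>2 = (w i * x i powr (1 + 2 * \<mu>)) * h i" by simp
    also have "\<dots> \<le> (exp (- (\<rho> * x i)) * x i powr (1 + 2 * \<mu>)) * h i"
      using i w_le_exp[of i] h by (intro mult_right_mono) auto
    also have "\<dots> = (((\<rho> * x i) powr (1 + 2 * \<mu>) * exp (- (\<rho> * x i))) * \<rho> powr (- (1 + 2 * \<mu>))) * h i"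
      using xi \<rho> by (simp only: powr_mult powr_minus) (simp add: field_simps)
    also have "\<dots> \<le> (C3 * \<rho> powr (- (1 + 2 * \<mu>))) * h i"
      unfolding C3_def using \<mu> xi \<rho> h by (intro mult_right_mono powr_mult_exp_minus_le) auto
    finally show ?thesis .
  qed
  then have "(\<Sum>i=1..D. w i * (g i)\<^sup>2) \<le> (\<Sum>i=1..D. (C3 * \<rho> powr (- (1 + 2 * \<mu>))) * h i)"
    by (rule sum_mono)
  also have "\<dots> = (C3 * \<rho> powr (- (1 + 2 * \<mu>))) * (\<Sum>i=1..D. h i)" by (simp add: sum_distrib_left)
  also have "\<dots> \<le> (C3 * \<rho> powr (- (1 + 2 * \<mu>))) * R\<^sup>2"
    using source C3_pos unfolding h_def by (intro mult_left_mono) auto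
  also have "\<rho> powr (- (1 + 2 * \<mu>)) = m powr (- \<theta>)"
    by (subst \<rho>_m) (simp add: powr_powr \<theta>_def algebra_simps)
  also have "C3 * m powr (- \<theta>) * R\<^sup>2 = \<delta>\<^sup>2 * (C3 * N * (N / m) powr \<theta>)"
    using N_pos m by (simp add: R_sq powr_divide powr_minus field_simps)
  finally show ?thesis .
qed

text \<open>The converse use of the stopping rule. In \<open>residual_ge\<close> the dimension
  cancels again, so the noise fitted by the filter is at most the filtered signal energy plus order
  \<open>\<delta>\<^sup>2 * a\<close>. The filter has, however, fitted at least half of the noise in
  each of the first \<open>j\<close> directions, so \<open>j\<close> cannot be large.\<close>

lemma stochastic_lower:
  assumes \<rho>: "\<rho> > 0" and j: "j \<le> D" "real j \<le> cA powr (1 / p) * m"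
  shows "real j \<le> 18 * a + 5 * C3 * N * (N / m) powr \<theta>"
proof -
  define A where "A = (\<Sum>i=1..D. w i * (g i)\<^sup>2)"
  have "(\<Sum>i=1..D. if \<beta> * (lam i)\<^sup>2 < 1 then (lam i * f i + \<delta> * \<epsilon> i)\<^sup>2 * r ((lam i)\<^sup>2) else 0)
      = (\<Sum>i=1..D. w i * (g i + \<delta> * \<epsilon> i)\<^sup>2)"
    by (intro sum.cong) (auto simp: w_def g_def x_def)
  also have "\<dots> = A + 2 * (\<Sum>i=1..D. w i * (g i * (\<delta> * \<epsilon> i)))
        + (\<delta>\<^sup>2 * (\<Sum>i=1..D. (\<epsilon> i)\<^sup>2) - \<delta>\<^sup>2 * (\<Sum>i=1..D. (1 - w i) * (\<epsilon> i)\<^sup>2))"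
    unfolding A_def sum_distrib_left sum.distrib[symmetric] sum_subtractf[symmetric]
    by (intro sum.cong) (auto simp: power2_eq_square algebra_simps)
  finally have \<kappa>_le: "\<kappa> \<le> \<dots>" using residual_ge[OF \<rho>] by simp
  have c: "\<bar>\<Sum>i=1..D. w i * (g i * (\<delta> * \<epsilon> i))\<bar> \<le> A / 8 + \<delta>\<^sup>2 * a"
    unfolding A_def using w_nonneg w_le_one w_mono by (intro weighted_cross) auto
  have e: "\<delta>\<^sup>2 * ((\<Sum>i=1..D. (\<epsilon> i)\<^sup>2) - real D) \<le> \<delta>\<^sup>2 * a"
    using noise_total by (intro mult_left_mono) auto
  have "\<delta>\<^sup>2 * (\<Sum>i=1..D. (1 - w i) * (\<epsilon> i)\<^sup>2) \<le> \<delta>\<^sup>2 * (4 * a) + 5/4 * A"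
    using \<kappa>_le c e \<kappa> by (simp add: algebra_simps abs_le_iff)
  also have "\<dots> \<le> \<delta>\<^sup>2 * (4 * a) + 5/4 * (\<delta>\<^sup>2 * (C3 * N * (N / m) powr \<theta>))"
    using strong_bias_le[OF \<rho>] by (simp add: A_def)
  also have "\<dots> = \<delta>\<^sup>2 * (4 * a + 5/4 * (C3 * N * (N / m) powr \<theta>))"
    by (simp add: algebra_simps)
  finally have up: "(\<Sum>i=1..D. (1 - w i) * (\<epsilon> i)\<^sup>2) \<le> 4 * a + 5/4 * (C3 * N * (N / m) powr \<theta>)"
    using \<delta> by simp
  have "1/2 * (\<Sum>i=1..j. (\<epsilon> i)\<^sup>2) = (\<Sum>i=1..j. 1/2 * (\<epsilon> i)\<^sup>2)" by (simp add: sum_distrib_left)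
  also have "\<dots> \<le> (\<Sum>i=1..j. (1 - w i) * (\<epsilon> i)\<^sup>2)"
  proof (intro sum_mono mult_right_mono)
    \<comment> \<open>The lower decay bound and \<open>i \<le> cA powr (1 / p) * m\<close> give
      \<open>\<rho> * x i \<ge> 1\<close>, hence
      \<open>w i \<le> exp (- 1) \<le> 1/2\<close>.\<close>
    fix i assume i: "i \<in> {1..j}"
    have "real i powr (2 * p) \<le> (cA powr (1 / p) * m) powr (2 * p)"
      using i j p by (intro powr_mono2) auto
    also have "\<dots> = cA\<^sup>2 * \<rho>"
      using cA p m_nonneg by (simp add: powr_mult powr_powr \<rho>_m[symmetric] )
    finally have "1 \<le> \<rho> * (cA\<^sup>2 * real i powr (- 2 * p))"
      using i by (simp add: powr_minus field_simps)
    also have "\<dots> \<le> \<rho> * x i" using i j \<rho> x_lower[of i] by (intro mult_left_mono) auto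
    finally have "exp (- \<rho> * x i) \<le> exp (- 1 :: real)" by simp
    also have "\<dots> \<le> 1/2" using exp_ge_add_one_self[of "1::real"] by (simp add: exp_minus field_simps)
    finally show "1/2 \<le> 1 - w i" using w_le_exp[of i] i j by simp
  qed auto
  also have "\<dots> \<le> (\<Sum>i=1..D. (1 - w i) * (\<epsilon> i)\<^sup>2)"
    using j w_le_one by (intro sum_mono2) auto
  finally have low: "1/2 * (\<Sum>i=1..j. (\<epsilon> i)\<^sup>2) \<le> \<dots>" .
  \<comment> \<open>Multiplying by \<open>4\<close> produces the constants:
    \<open>18 = 4 * (4 + 1/2)\<close> and \<open>5 = 4 * 5/4\<close>.\<close>
  have "real j / 2 - a \<le> (\<Sum>i=1..j. (\<epsilon> i)\<^sup>2)"
    using noise_lower[of j] j a by (cases "j = 0") auto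
  then show ?thesis using low up by (simp add: mult.assoc)
qed

definition "C4 = K * (10 * C3 * K) powr (1 / \<theta>)"
definition "C5 = 1 + (19 + 5 * C3) / cA powr (1 / p) + C4 * (18 + 5 * C3)"

lemma C4_pos: "C4 > 0" using K C3_pos by (simp add: C4_def)

lemma C5_ge: "C5 \<ge> 1" using C4_pos C3_pos by (simp add: C5_def)

text \<open>The index fed into \<open>stochastic_lower\<close> is of order \<open>m\<close>, but it
  cannot exceed \<open>D\<close>, whereas \<open>m\<close> is not bounded by \<open>D\<close> in
  advance. If \<open>m\<close> is too large, the test is made with \<open>j = D\<close>, and the
  assumption \<open>N \<le> K * D\<close> has to exclude an \<open>m\<close> far beyond
  \<open>D\<close>.\<close>

lemma m_le:
  assumes D36: "real D > 36 * a"
  shows "m \<le> C5 * (N + a)"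
proof (cases "m < N")
  case True
  have "m \<le> 1 * (N + a)" using True a by simp
  also have "\<dots> \<le> C5 * (N + a)" using C5_ge N_pos a by (intro mult_right_mono) auto
  finally show ?thesis .
next
  case False
  then have m: "m > 0" "m \<ge> N" using N_pos by auto
  have \<rho>: "\<rho> > 0" using m \<rho>_nonneg unfolding m_def by (metis less_eq_real_def less_irrefl powr_eq_0_iff)
  have q: "(N / m) powr \<theta> \<le> 1" using m N_pos \<theta>_pos by (simp add: powr_le1)
  define c' where "c' = cA powr (1 / p)"
  have c': "c' > 0" using cA by (simp add: c'_def)
  have bound: "18 * a + 5 * C3 * N * (N / m) powr \<theta> \<le> 18 * a + 5 * C3 * N"
    using q C3_pos N_pos by (intro add_left_mono mult_left_le) auto
  show ?thesis
  proof (cases "c' * m < real D")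
    case True
    define j where "j = nat \<lfloor>c' * m\<rfloor>"
    have "c' * m - 1 \<le> real j" "real j \<le> c' * m" using c' m by (auto simp: j_def)
    moreover have "j \<le> D" using True \<open>real j \<le> c' * m\<close> by linarith
    ultimately have "c' * m \<le> 1 + (18 * a + 5 * C3 * N)"
      using stochastic_lower[OF \<rho>, of j] bound by (simp add: c'_def)
    also have "\<dots> \<le> (19 + 5 * C3) * (N + a)"
    proof -
      have "0 \<le> 19 * N + 5 * C3 * a" using C3_pos N_pos a by simp
      then show ?thesis using a by (simp add: algebra_simps)
    qed
    finally have "m \<le> (19 + 5 * C3) / c' * (N + a)" using c' by (simp add: field_simps)
    also have "\<dots> \<le> C5 * (N + a)"
      unfolding C5_def c'_def using C4_pos C3_pos N_pos a by (intro mult_right_mono) auto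
    finally show ?thesis .
  next
    case False
    then have D1: "real D \<le> 18 * a + 5 * C3 * N * (N / m) powr \<theta>"
      using stochastic_lower[OF \<rho>, of D] by (simp add: c'_def)
    \<comment> \<open>\<open>C4\<close> is chosen so that a larger \<open>m\<close> forces
      \<open>(N / m) powr \<theta> \<le> 1 / (10 * C3 * K)\<close>. With
      \<open>N \<le> K * D\<close> the bias term in \<open>D1\<close> is then at most
      \<open>D / 2\<close>, leaving \<open>D \<le> 36 * a\<close>; this explains the threshold
      \<open>36 = 2 * 18\<close>.\<close>
    have "m < C4 * real D"
    proof (rule ccontr)
      assume "\<not> m < C4 * real D"
      then have "m \<ge> C4 * real D" by simp
      then have "N / m \<le> (K * real D) / (C4 * real D)"
        using eff_dim_le C4_pos D N_pos K by (intro frac_le) (auto simp: N_def)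
      also have "\<dots> = (10 * C3 * K) powr (- 1 / \<theta>)"
        using D K C3_pos by (simp add: C4_def powr_minus field_simps)
      finally have "(N / m) powr \<theta> \<le> ((10 * C3 * K) powr (- 1 / \<theta>)) powr \<theta>"
        using N_pos m \<theta>_pos by (intro powr_mono2) auto
      also have "\<dots> = 1 / (10 * C3 * K)"
      proof -
        have "- 1 / \<theta> * \<theta> = - 1" using \<theta>_pos by simp
        then show ?thesis using C3_pos K by (simp only: powr_powr) (simp add: powr_neg_one)
      qed
      finally have "5 * C3 * N * (N / m) powr \<theta> \<le> 5 * C3 * (K * real D) * (1 / (10 * C3 * K))"
        using eff_dim_le C3_pos N_pos K by (intro mult_mono) (auto simp: N_def)
      also have "\<dots> = real D / 2" using C3_pos K by (simp add: field_simps)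
      finally show False using D1 D36 by simp
    qed
    also have "C4 * real D \<le> C4 * (18 * a + 5 * C3 * N)"
      using D1 bound C4_pos by (intro mult_left_mono) auto
    also have "\<dots> \<le> C4 * ((18 + 5 * C3) * (N + a))"
      using C4_pos C3_pos N_pos a by (intro mult_left_mono) (auto simp: algebra_simps)
    also have "\<dots> \<le> C5 * (N + a)"
      unfolding mult.assoc[symmetric] C5_def using C3_pos c' N_pos a
      by (intro mult_right_mono) (auto simp: c'_def)
    finally show ?thesis by simp
  qed
qed

section \<open>Assembly of the loss bound\<close>

definition "C6 = 2 * (2 * C1 + 3) + 2 * C2 + 8/3 * C2 + 2"
definition "C7 = 2 / cA\<^sup>2 * 36 powr (2 * p) * 74"
definition "C8 = C6 * (1 + C5) powr (2 * p + 1) + C7"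

lemma C2_pos: "C2 > 0" using C1_nonneg by (simp add: C2_def)

lemma C6_pos: "C6 > 0" using C1_nonneg C2_pos by (simp add: C6_def add_pos_pos)

text \<open>If \<open>D\<close> is of order \<open>a\<close>, the cut-off is irrelevant: noise and
  residual both have squared norm at most \<open>37 * \<delta>\<^sup>2 * a\<close>, and inverting
  the smallest singular value amplifies them by at most
  \<open>D powr (2 * p) / cA\<^sup>2\<close>.\<close>

lemma loss_trivial:
  assumes D36: "real D \<le> 36 * a"
  shows "loss \<le> \<delta>\<^sup>2 * (C7 * a powr (2 * p + 1))"
proof -
  have sq: "(u - v)\<^sup>2 \<le> 2 * u\<^sup>2 + 2 * v\<^sup>2" for u v :: real
    using sum_squares_ge_zero[of "u + v" 0] by (simp add: power2_eq_square algebra_simps)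
  have "((1 - r (x i)) * (g i + \<delta> * \<epsilon> i) / lam i - f i)\<^sup>2
      \<le> (real D powr (2 * p) / cA\<^sup>2) * (2 * (\<delta>\<^sup>2 * (\<epsilon> i)\<^sup>2) + 2 * ((g i + \<delta> * \<epsilon> i)\<^sup>2 * (r (x i))\<^sup>2))"
    if i: "i \<in> {1..D}" for i
  proof -
    have l: "lam i > 0" "x i > 0" using i lam_pos x_pos by auto
    have "((1 - r (x i)) * (g i + \<delta> * \<epsilon> i) / lam i - f i)
        = (\<delta> * \<epsilon> i - (g i + \<delta> * \<epsilon> i) * r (x i)) / lam i"
      using l by (simp add: g_def field_simps)
    then have "((1 - r (x i)) * (g i + \<delta> * \<epsilon> i) / lam i - f i)\<^sup>2
        = (1 / x i) * (\<delta> * \<epsilon> i - (g i + \<delta> * \<epsilon> i) * r (x i))\<^sup>2"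
      by (simp add: power_divide x_def)
    also have "\<dots> \<le> (real D powr (2 * p) / cA\<^sup>2) * (2 * (\<delta> * \<epsilon> i)\<^sup>2 + 2 * ((g i + \<delta> * \<epsilon> i) * r (x i))\<^sup>2)"
    proof (intro mult_mono sq)
      have "1 / x i \<le> 1 / (cA\<^sup>2 * real i powr (- 2 * p))"
        using i l cA x_lower[of i] by (intro divide_left_mono) auto
      also have "\<dots> = real i powr (2 * p) / cA\<^sup>2" using i by (simp add: powr_minus field_simps)
      also have "\<dots> \<le> real D powr (2 * p) / cA\<^sup>2"
        using i p by (intro divide_right_mono powr_mono2) auto
      finally show "1 / x i \<le> real D powr (2 * p) / cA\<^sup>2" .
    qed auto
    finally show ?thesis by (simp add: power_mult_distrib)
  qed
  then have "loss \<le> (\<Sum>i=1..D. (real D powr (2 * p) / cA\<^sup>2) *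
      (2 * (\<delta>\<^sup>2 * (\<epsilon> i)\<^sup>2) + 2 * ((g i + \<delta> * \<epsilon> i)\<^sup>2 * (r (x i))\<^sup>2)))"
    unfolding loss_def by (rule sum_mono)
  also have "\<dots> = (real D powr (2 * p) / cA\<^sup>2) *
      (2 * (\<delta>\<^sup>2 * (\<Sum>i=1..D. (\<epsilon> i)\<^sup>2)) + 2 * (\<Sum>i=1..D. (g i + \<delta> * \<epsilon> i)\<^sup>2 * (r (x i))\<^sup>2))"
    unfolding sum_distrib_left sum.distrib[symmetric] by (rule refl)
  also have "\<dots> \<le> ((36 * a) powr (2 * p) / cA\<^sup>2) * (2 * (\<delta>\<^sup>2 * (37 * a)) + 2 * (\<delta>\<^sup>2 * (37 * a)))"
  proof (intro mult_mono add_mono divide_right_mono powr_mono2)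
    show "(\<Sum>i=1..D. (\<epsilon> i)\<^sup>2) \<le> 37 * a" using noise_total D36 by simp
    have "\<kappa> \<le> \<delta>\<^sup>2 * (real D + a)" using \<kappa> by (simp add: algebra_simps)
    also have "\<dots> \<le> \<delta>\<^sup>2 * (37 * a)" using D36 by (intro mult_left_mono) auto
    finally show "(\<Sum>i=1..D. (g i + \<delta> * \<epsilon> i)\<^sup>2 * (r (x i))\<^sup>2) \<le> \<delta>\<^sup>2 * (37 * a)"
      using residual_le by (simp add: g_def x_def)
  qed (use D36 p a in \<open>auto intro!: add_nonneg_nonneg mult_nonneg_nonneg sum_nonneg\<close>)
  also have "\<dots> = \<delta>\<^sup>2 * (C7 * a powr (2 * p + 1))"
    using a by (simp add: C7_def powr_mult powr_add field_simps)
  finally show ?thesis .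
qed

lemma loss_le: "loss \<le> C8 * (\<delta>\<^sup>2 * (N + a) powr (2 * p + 1))"
proof (cases "real D \<le> 36 * a")
  case True
  have "C7 * a powr (2 * p + 1) \<le> C8 * (N + a) powr (2 * p + 1)"
    using p a N_pos C6_pos cA by (intro mult_mono powr_mono2) (auto simp: C8_def C7_def)
  then have "\<delta>\<^sup>2 * (C7 * a powr (2 * p + 1)) \<le> \<delta>\<^sup>2 * (C8 * (N + a) powr (2 * p + 1))"
    by (rule mult_left_mono) simp
  then show ?thesis using loss_trivial[OF True] by (simp add: mult_ac)
next
  case False
  \<comment> \<open>A common scale for cut-off, effective dimension and noise level;
    \<open>m\<close> is replaced by a multiple of \<open>N + a\<close> only at the very end.\<close>
  define E where "E = N + a + m"
  have E: "E > 0" "m \<le> E" "N \<le> E" "m + a \<le> E" using N_pos a m_nonneg by (auto simp: E_def)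
  \<comment> \<open>The order of a squared singular value at index \<open>E\<close>. At this level
    the weak bias divided by \<open>t\<close> and the source term
    \<open>t powr (2 * \<mu>) * R\<^sup>2\<close> are both of order
    \<open>\<delta>\<^sup>2 * E powr (2 * p + 1)\<close>.\<close>
  define t where "t = E powr (- 2 * p)"
  have t: "t > 0" using E by (simp add: t_def)
  have \<rho>: "\<rho> \<le> E powr (2 * p)"
    by (rule ord_eq_le_trans[OF \<rho>_m]) (use E m_nonneg p in \<open>auto intro!: powr_mono2\<close>)
  have 1: "2 * \<rho> * \<delta>\<^sup>2 * (\<Sum>i=1..D. s i * (\<epsilon> i)\<^sup>2) \<le> 2 * E powr (2 * p) * \<delta>\<^sup>2 * ((2 * C1 + 3) * E)"
  proof (intro mult_mono)
    have "(2 * C1 + 3) * (m + a) \<le> (2 * C1 + 3) * E"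
      using E C1_nonneg by (intro mult_left_mono) auto
    then show "(\<Sum>i=1..D. s i * (\<epsilon> i)\<^sup>2) \<le> (2 * C1 + 3) * E" using sum_s_noise_le by simp
    show "0 \<le> (\<Sum>i=1..D. s i * (\<epsilon> i)\<^sup>2)" using s_nonneg by (intro sum_nonneg) auto
  qed (use \<rho> \<rho>_nonneg in auto)
  have C2E: "C2 * (m + a) \<le> C2 * E" using E C2_pos by (intro mult_left_mono) auto
  have 2: "2 * \<rho> * tail_res \<le> 2 * E powr (2 * p) * (\<delta>\<^sup>2 * (C2 * E))"
  proof (intro mult_mono)
    show "tail_res \<le> \<delta>\<^sup>2 * (C2 * E)"
      using tail_res_le mult_left_mono[OF C2E, of "\<delta>\<^sup>2"] by simp
  qed (use \<rho> \<rho>_nonneg tail_res_nonneg in auto)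
  have "(\<Sum>i=1..D. (w i)\<^sup>2 * (g i)\<^sup>2) / t \<le> (4/3 * (\<delta>\<^sup>2 * (C2 * E))) / t"
    using weak_bias_le mult_left_mono[OF C2E, of "\<delta>\<^sup>2"] t by (intro divide_right_mono) auto
  also have "\<dots> = (4/3 * (\<delta>\<^sup>2 * (C2 * E))) * E powr (2 * p)"
    using E by (simp add: t_def powr_minus field_simps)
  finally have 3: "(\<Sum>i=1..D. (w i)\<^sup>2 * (g i)\<^sup>2) / t \<le> \<dots>" .
  have "t powr (2 * \<mu>) * R\<^sup>2 = \<delta>\<^sup>2 * (E powr (- 4 * \<mu> * p) * N powr (1 + \<theta>))"
    using N_pos by (simp add: t_def powr_powr R_sq powr_add algebra_simps)
  also have "\<dots> \<le> \<delta>\<^sup>2 * (E powr (- 4 * \<mu> * p) * E powr (1 + \<theta>))"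
    using E N_pos \<theta>_pos by (intro mult_left_mono powr_mono2) auto
  also have "E powr (- 4 * \<mu> * p) * E powr (1 + \<theta>) = E powr (2 * p + 1)"
    by (simp add: \<theta>_def algebra_simps flip: powr_add)
  finally have 4: "t powr (2 * \<mu>) * R\<^sup>2 \<le> \<delta>\<^sup>2 * E powr (2 * p + 1)" .
  have "loss \<le> 2 * E powr (2 * p) * \<delta>\<^sup>2 * ((2 * C1 + 3) * E)
      + 2 * ((4/3 * (\<delta>\<^sup>2 * (C2 * E))) * E powr (2 * p) + \<delta>\<^sup>2 * E powr (2 * p + 1))
      + 2 * E powr (2 * p) * (\<delta>\<^sup>2 * (C2 * E))"
    by (intro order_trans[OF loss_split] add_mono 1 2 mult_left_mono
      order_trans[OF bias_le[OF t]] 3 4) auto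
  also have "\<dots> = C6 * (\<delta>\<^sup>2 * E powr (2 * p + 1))"
    using E by (simp add: C6_def powr_add algebra_simps)
  also have "\<dots> \<le> C6 * (\<delta>\<^sup>2 * ((1 + C5) * (N + a)) powr (2 * p + 1))"
    using C6_pos m_le E False p
    by (intro mult_left_mono powr_mono2) (auto simp: E_def algebra_simps)
  also have "\<dots> = (C6 * (1 + C5) powr (2 * p + 1)) * (\<delta>\<^sup>2 * (N + a) powr (2 * p + 1))"
    using C5_ge N_pos a by (simp add: powr_mult)
  also have "\<dots> \<le> C8 * (\<delta>\<^sup>2 * (N + a) powr (2 * p + 1))"
    using cA by (intro mult_right_mono) (auto simp: C8_def C7_def)
  finally show ?thesis .
qed

end

section \<open>Residual polynomials of conjugate gradients\<close>

declare mult_pCons_left [simp del] mult_pCons_right [simp del]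

section \<open>Sign changes and products of linear factors\<close>

lemma poly_constant_sign:
  fixes q :: "real poly"
  assumes "\<And>t. t > 0 \<Longrightarrow> poly q t \<noteq> 0"
  shows "(\<forall>t>0. poly q t \<ge> 0) \<or> (\<forall>t>0. poly q t \<le> 0)"
proof (rule ccontr)
  assume "\<not> ?thesis"
  then obtain s t where st: "s > 0" "t > 0" "poly q s < 0" "poly q t > 0" by (auto simp: not_le)
  have "s \<noteq> t" using st by auto
  then consider "s < t" | "t < s" by linarith
  then show False
  proof cases
    case 1
    then obtain z where "s < z" "poly q z = 0" using poly_IVT_pos[of s t q] st by auto
    then show ?thesis using assms[of z] st by auto
  next
    case 2
    then obtain z where "t < z" "poly q z = 0" using poly_IVT_neg[of t s q] st by auto
    then show ?thesis using assms[of z] st by auto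
  qed
qed

text \<open>\<open>F\<close> consists of the positive zeros of odd multiplicity. Zeros are split off
  one at a time; when a zero meets a copy of itself already in \<open>F\<close>, the pair forms a
  square and moves into the factor \<open>e\<close> of constant sign.\<close>

lemma poly_sign_split:
  fixes q :: "real poly"
  assumes "q \<noteq> 0"
  shows "\<exists>F e. finite F \<and> F \<subseteq> {0<..} \<and> q = (\<Prod>a\<in>F. [:-a, 1:]) * e
    \<and> ((\<forall>t>0. poly e t \<ge> 0) \<or> (\<forall>t>0. poly e t \<le> 0))"
  using assms
proof (induction "Polynomial.degree q" arbitrary: q rule: less_induct)
  case less
  show ?case
  proof (cases "\<exists>a>0. poly q a = 0")
    case False
    then have "(\<forall>t>0. poly q t \<ge> 0) \<or> (\<forall>t>0. poly q t \<le> 0)"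
      by (intro poly_constant_sign) auto
    then show ?thesis by (intro exI[of _ "{}"] exI[of _ q]) auto
  next
    case True
    then obtain a where a: "a > 0" "poly q a = 0" by auto
    then obtain q' where q': "q = [:-a, 1:] * q'" by (auto simp: poly_eq_0_iff_dvd dvd_def)
    have nz: "q' \<noteq> 0" using less.prems q' by auto
    have "Polynomial.degree q = 1 + Polynomial.degree q'"
      using nz unfolding q' by (subst degree_mult_eq) auto
    then obtain F e where F: "finite F" "F \<subseteq> {0<..}" "q' = (\<Prod>a\<in>F. [:-a, 1:]) * e"
      and e: "(\<forall>t>0. poly e t \<ge> 0) \<or> (\<forall>t>0. poly e t \<le> 0)"
      using less.hyps[of q'] nz by auto
    show ?thesis
    proof (cases "a \<in> F")
      case False
      have "q = (\<Prod>a\<in>insert a F. [:-a, 1:]) * e" using F False by (simp add: q' mult.assoc)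
      then show ?thesis using F e a by (intro exI[of _ "insert a F"] exI[of _ e]) auto
    next
      case True
      have "q = (\<Prod>a\<in>F - {a}. [:-a, 1:]) * ([:-a, 1:]\<^sup>2 * e)"
        using prod.remove[OF F(1) True, of "\<lambda>a. [:-a, 1:]"] by (simp add: q' F power2_eq_square mult_ac)
      moreover have "(\<forall>t>0. poly ([:-a, 1:]\<^sup>2 * e) t \<ge> 0) \<or> (\<forall>t>0. poly ([:-a, 1:]\<^sup>2 * e) t \<le> 0)"
        using e by (elim disj_forward) (auto intro!: mult_nonneg_nonneg mult_nonneg_nonpos)
      ultimately show ?thesis using F by (intro exI[of _ "F - {a}"] exI[of _ "[:-a, 1:]\<^sup>2 * e"]) auto
    qed
  qed
qed

lemma prod_linear_dvd:
  fixes q :: "real poly"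
  assumes "finite F" "\<And>a. a \<in> F \<Longrightarrow> poly q a = 0"
  shows "(\<Prod>a\<in>F. [:-a, 1:]) dvd q"
  using assms
proof (induction F arbitrary: q rule: finite_induct)
  case empty
  then show ?case by simp
next
  case (insert a F)
  obtain q' where q': "q = [:-a, 1:] * q'"
    using insert.prems[of a] by (auto simp: poly_eq_0_iff_dvd dvd_def)
  have "poly q' b = 0" if "b \<in> F" for b
    using insert.prems[of b] that insert.hyps by (auto simp: q')
  then show ?case using insert by (simp add: q' mult_dvd_mono)
qed

lemma degree_prod_linear: "finite F \<Longrightarrow> Polynomial.degree (\<Prod>a\<in>F. [:-a, 1::real:]) = card F"
  by (subst degree_prod_eq_sum_degree) auto

text \<open>Residual polynomials are handled through the multiset of the reciprocals of their zeros.\<close>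

definition lin_prod :: "real multiset \<Rightarrow> real poly" where
  "lin_prod B = (\<Prod>b\<in>#B. [:1, -b:])"

lemma lin_prod_empty [simp]: "lin_prod {#} = 1" by (simp add: lin_prod_def)

lemma lin_prod_add [simp]: "lin_prod (add_mset b B) = [:1, -b:] * lin_prod B"
  by (simp add: lin_prod_def)

lemma poly_lin_prod_0 [simp]: "poly (lin_prod B) 0 = 1"
  by (induction B) auto

lemma degree_lin_prod_le: "Polynomial.degree (lin_prod B) \<le> size B"
proof (induction B)
  case (add b B)
  have "Polynomial.degree [:1, -b:] \<le> 1" by simp
  then show ?case using add degree_mult_le[of "[:1, -b:]" "lin_prod B"] by (simp del: degree_pCons_eq_if)
qed auto

lemma coeff_lin_prod: "coeff (lin_prod B) (size B) = (\<Prod>b\<in>#B. -b)"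
proof (induction B)
  case (add b B)
  have "coeff (lin_prod B) (Suc (size B)) = 0"
    using degree_lin_prod_le[of B] by (intro coeff_eq_0) auto
  then show ?case using add by (simp add: mult_pCons_left)
qed auto

text \<open>The leading sign is determined by the number of factors alone. Comparing leading signs
  is how the positivity of a last zero and of a quotient of leading coefficients is obtained
  below.\<close>

lemma coeff_lin_prod_sign:
  assumes "\<And>b. b \<in># B \<Longrightarrow> b > 0"
  shows "(-1) ^ size B * coeff (lin_prod B) (size B) > 0"
  unfolding coeff_lin_prod using assms
proof (induction B)
  case (add b B)
  then have "b * ((-1) ^ size B * (\<Prod>b\<in>#B. -b)) > 0" by (intro mult_pos_pos[of b]) auto
  then show ?case by (simp add: mult.left_commute)
qed auto

text \<open>The condition \<open>\<beta> * t < 1\<close> keeps every factor in \<open>[0,1]\<close>.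
  The lower bound is Weierstrass' product inequality; the upper one applies
  \<open>1 - b * t \<le> exp (- b * t)\<close> to each factor.\<close>

lemma lin_prod_bounds:
  assumes "\<And>b. b \<in># B \<Longrightarrow> 0 < b \<and> b \<le> \<beta>" "0 \<le> t" "\<beta> * t < 1"
  shows "0 \<le> poly (lin_prod B) t \<and> poly (lin_prod B) t \<le> exp (- (sum_mset B) * t)
    \<and> 1 - sum_mset B * t \<le> poly (lin_prod B) t \<and> poly (lin_prod B) t \<le> 1"
  using assms
proof (induction B)
  case (add b B)
  have IH: "0 \<le> poly (lin_prod B) t" "poly (lin_prod B) t \<le> exp (- (sum_mset B) * t)"
    "1 - sum_mset B * t \<le> poly (lin_prod B) t" "poly (lin_prod B) t \<le> 1"
    using add by auto
  have b: "0 < b" "b * t \<le> \<beta> * t" using add.prems by (auto intro: mult_right_mono)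
  then have bt: "0 \<le> b * t" "b * t < 1" using add.prems mult_nonneg_nonneg[of b t] by linarith+
  have 1: "poly (lin_prod (add_mset b B)) t = (1 - b * t) * poly (lin_prod B) t"
    by (simp add: algebra_simps)
  have 2: "1 - b * t \<le> exp (- (b * t))" using exp_ge_add_one_self[of "- (b * t)"] by simp
  have "(1 - b * t) * poly (lin_prod B) t \<le> exp (- (b * t)) * exp (- (sum_mset B) * t)"
    using IH bt 2 by (intro mult_mono) auto
  also have "\<dots> = exp (- (sum_mset (add_mset b B)) * t)" by (simp add: algebra_simps flip: exp_add)
  finally have 3: "(1 - b * t) * poly (lin_prod B) t \<le> \<dots>" .
  have "b * t * poly (lin_prod B) t \<le> b * t * 1" using IH bt by (intro mult_left_mono) auto
  then have 4: "1 - sum_mset (add_mset b B) * t \<le> (1 - b * t) * poly (lin_prod B) t"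
    using IH by (simp add: algebra_simps)
  have 5: "(1 - b * t) * poly (lin_prod B) t \<le> 1" using IH bt by (intro mult_le_one) auto
  show ?case unfolding 1 using 3 4 5 IH bt by simp
qed auto

lemma lin_prod_antimono:
  assumes "\<And>b. b \<in># B \<Longrightarrow> 0 < b \<and> b \<le> \<beta>" "0 \<le> s" "s \<le> t" "\<beta> * t < 1"
  shows "poly (lin_prod B) t \<le> poly (lin_prod B) s"
  using assms
proof (induction B)
  case (add b B)
  have b: "0 < b" "b * t \<le> \<beta> * t" "b * s \<le> b * t"
    using add.prems by (auto intro: mult_right_mono)
  then have bt: "b * t < 1" "b * s < 1" using add.prems by linarith+
  have "(1 - b * t) * poly (lin_prod B) t \<le> (1 - b * s) * poly (lin_prod B) s"
    using add.IH add.prems b(3) bt lin_prod_bounds[of B \<beta> t] by (intro mult_mono) auto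
  then show ?case by (simp add: algebra_simps)
qed auto

text \<open>Explicit Gram--Schmidt construction of the residual polynomials; it exhibits them as rational
  functions of the weights, which is what makes the stopped estimator measurable.\<close>

fun gs_poly :: "nat \<Rightarrow> (nat \<Rightarrow> real) \<Rightarrow> (nat \<Rightarrow> real) \<Rightarrow> nat \<Rightarrow> real poly" where
  "gs_poly D x y n = Polynomial.monom 1 n - (\<Sum>j<n. Polynomial.smult
     ((\<Sum>i=1..D. (x i * y i)\<^sup>2 * x i ^ n * poly (gs_poly D x y j) (x i)) /
      (\<Sum>i=1..D. (x i * y i)\<^sup>2 * (poly (gs_poly D x y j) (x i))\<^sup>2)) (gs_poly D x y j))"

declare gs_poly.simps [simp del]

text \<open>The constant \<open>1\<close> minus its projection onto the span of the products of the
  variable with \<open>gs_poly D x y j\<close> for \<open>j < k\<close>, orthogonal with respect to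
  the data weights \<open>(y i)\<^sup>2\<close>.\<close>

definition gs_residual :: "nat \<Rightarrow> (nat \<Rightarrow> real) \<Rightarrow> (nat \<Rightarrow> real) \<Rightarrow> nat \<Rightarrow> real poly" where
  "gs_residual D x y k = 1 - [:0, 1:] * (\<Sum>j<k. Polynomial.smult
     ((\<Sum>i=1..D. x i * (y i)\<^sup>2 * poly (gs_poly D x y j) (x i)) /
      (\<Sum>i=1..D. (x i * y i)\<^sup>2 * (poly (gs_poly D x y j) (x i))\<^sup>2)) (gs_poly D x y j))"

definition sq_residual :: "nat \<Rightarrow> (nat \<Rightarrow> real) \<Rightarrow> (nat \<Rightarrow> real) \<Rightarrow> real poly \<Rightarrow> real" where
  "sq_residual D x y q = (\<Sum>i=1..D. (y i)\<^sup>2 * (poly q (x i))\<^sup>2)"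

definition stop_index :: "nat \<Rightarrow> (nat \<Rightarrow> real) \<Rightarrow> real \<Rightarrow> (nat \<Rightarrow> real) \<Rightarrow> nat" where
  "stop_index D x \<kappa> y = (LEAST k. sq_residual D x y (gs_residual D x y k) \<le> \<kappa>)"

text \<open>The weight of the earlier iterate at which the interpolated squared residual equals
  \<open>\<kappa>\<close>. The square root inverts the quadratic dependence established in
  \<open>res_interp\<close>.\<close>

definition stop_weight :: "nat \<Rightarrow> (nat \<Rightarrow> real) \<Rightarrow> real \<Rightarrow> (nat \<Rightarrow> real) \<Rightarrow> nat \<Rightarrow> real" where
  "stop_weight D x \<kappa> y k =
     sqrt ((\<kappa> - sq_residual D x y (gs_residual D x y k)) /
       (sq_residual D x y (gs_residual D x y (k - 1)) - sq_residual D x y (gs_residual D x y k)))"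

definition stopped_poly :: "nat \<Rightarrow> (nat \<Rightarrow> real) \<Rightarrow> real \<Rightarrow> (nat \<Rightarrow> real) \<Rightarrow> real poly" where
  "stopped_poly D x \<kappa> y = (let k = stop_index D x \<kappa> y in if k = 0 then 1 else
     Polynomial.smult (stop_weight D x \<kappa> y k) (gs_residual D x y (k - 1)) +
     Polynomial.smult (1 - stop_weight D x \<kappa> y k) (gs_residual D x y k))"

section \<open>Orthogonality, minimality and zeros of the residual polynomials\<close>

locale cg_points =
  fixes D :: nat and x y :: "nat \<Rightarrow> real"
  assumes D1: "D \<ge> 1"
    and x_pos: "\<And>i. i \<in> {1..D} \<Longrightarrow> x i > 0"
    and y_nz: "\<And>i. i \<in> {1..D} \<Longrightarrow> y i \<noteq> 0"
begin

definition ip :: "real poly \<Rightarrow> real poly \<Rightarrow> real" where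
  "ip q s = (\<Sum>i=1..D. (y i)\<^sup>2 * poly q (x i) * poly s (x i))"

definition "d = card (x ` {1..D})"

abbreviation "X \<equiv> [:0, 1::real:]"
abbreviation "P \<equiv> gs_poly D x y"
abbreviation "r \<equiv> gs_residual D x y"
abbreviation "res \<equiv> sq_residual D x y"

lemma ip_add_left: "ip (q + q') s = ip q s + ip q' s"
  by (simp add: ip_def algebra_simps sum.distrib)

lemma ip_smult_left: "ip (Polynomial.smult c q) s = c * ip q s"
  by (simp add: ip_def sum_distrib_left algebra_simps)

lemma ip_commute: "ip q s = ip s q"
  by (simp add: ip_def mult_ac)

lemma ip_add_right: "ip s (q + q') = ip s q + ip s q'"
  by (simp add: ip_def algebra_simps sum.distrib)

lemma ip_smult_right: "ip s (Polynomial.smult c q) = c * ip s q"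
  by (simp add: ip_def sum_distrib_left algebra_simps)

lemma ip_diff_left: "ip (q - q') s = ip q s - ip q' s"
  by (simp add: ip_def algebra_simps sum_subtractf)

lemma ip_sum_left: "ip (\<Sum>j\<in>J. q j) s = (\<Sum>j\<in>J. ip (q j) s)"
  by (induction J rule: infinite_finite_induct) (auto simp: ip_add_left, auto simp: ip_def)

lemma ip_self: "ip q q = res q"
  by (simp add: ip_def sq_residual_def power2_eq_square mult_ac)

lemma ip_self_nonneg: "ip q q \<ge> 0"
  unfolding ip_self sq_residual_def by (intro sum_nonneg) auto

lemma ip_X_self_nonneg: "ip q (X * q) \<ge> 0"
proof -
  have "ip q (X * q) = (\<Sum>i=1..D. (y i)\<^sup>2 * (x i * (poly q (x i))\<^sup>2))"
    by (simp add: ip_def power2_eq_square mult_ac)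
  also have "\<dots> \<ge> 0"
    using x_pos by (intro sum_nonneg mult_nonneg_nonneg) (auto simp: less_imp_le)
  finally show ?thesis .
qed

lemma degree_ge_if_vanishing:
  assumes "q \<noteq> 0" "\<And>i. i \<in> {1..D} \<Longrightarrow> poly q (x i) = 0"
  shows "d \<le> Polynomial.degree q"
proof -
  have "(\<Prod>a\<in>x ` {1..D}. [:-a, 1:]) dvd q" using assms by (intro prod_linear_dvd) auto
  then have "Polynomial.degree (\<Prod>a\<in>x ` {1..D}. [:-a, 1:]) \<le> Polynomial.degree q"
    using assms by (intro dvd_imp_degree_le)
  then show ?thesis by (simp add: degree_prod_linear d_def)
qed

lemma ip_self_eq_0:
  assumes "ip q q = 0" "i \<in> {1..D}" shows "poly q (x i) = 0"
proof -
  have "(y i)\<^sup>2 * (poly q (x i))\<^sup>2 = 0"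
    using assms unfolding ip_self sq_residual_def by (subst (asm) sum_nonneg_eq_0_iff) auto
  then show ?thesis using y_nz[OF assms(2)] by simp
qed

text \<open>The data-weighted form is definite only below degree \<open>d\<close>, because a nonzero
  polynomial vanishing at all \<open>d\<close> distinct points has degree at least \<open>d\<close>.
  This is the origin of the restriction \<open>k \<le> d\<close>.\<close>

lemma ip_X_self_pos:
  assumes "q \<noteq> 0" "Polynomial.degree q < d"
  shows "ip (X * q) (X * q) > 0"
proof (rule ccontr)
  assume "\<not> ?thesis"
  then have "ip (X * q) (X * q) = 0" using ip_self_nonneg[of "X * q"] by simp
  then have "poly (X * q) (x i) = 0" if "i \<in> {1..D}" for i using ip_self_eq_0 that by blast
  then have "poly q (x i) = 0" if "i \<in> {1..D}" for i using x_pos[of i] that by fastforce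
  then show False using degree_ge_if_vanishing[of q] assms by auto
qed

lemma P_eq: "P n = Polynomial.monom 1 n -
    (\<Sum>j<n. Polynomial.smult (ip (X * Polynomial.monom 1 n) (X * P j) / ip (X * P j) (X * P j)) (P j))"
  by (subst gs_poly.simps) (simp add: ip_def poly_monom power2_eq_square mult_ac)

lemma r_eq: "r k = 1 - X * (\<Sum>j<k. Polynomial.smult (ip 1 (X * P j) / ip (X * P j) (X * P j)) (P j))"
  by (simp add: gs_residual_def ip_def poly_monom power2_eq_square mult_ac)

lemma P_degree: "Polynomial.degree (P n) = n \<and> coeff (P n) n = 1"
proof (induction n rule: less_induct)
  case (less n)
  define s where
    "s = (\<Sum>j<n. Polynomial.smult (ip (X * Polynomial.monom 1 n) (X * P j) / ip (X * P j) (X * P j)) (P j))"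
  have "coeff s m = 0" if "m \<ge> n" for m
    unfolding s_def coeff_sum using that less by (intro sum.neutral) (auto simp: coeff_eq_0)
  moreover have "P n = Polynomial.monom 1 n - s" by (subst P_eq) (simp add: s_def)
  ultimately have c: "coeff (P n) n = 1" "\<forall>m>n. coeff (P n) m = 0" by auto
  then have "Polynomial.degree (P n) \<le> n" by (intro degree_le) auto
  moreover have "n \<le> Polynomial.degree (P n)" using c by (intro le_degree) auto
  ultimately show ?case using c by simp
qed

lemma P_nz: "P n \<noteq> 0" using P_degree[of n] by auto

lemma P_norm_pos: "n < d \<Longrightarrow> ip (X * P n) (X * P n) > 0"
  using ip_X_self_pos[of "P n"] P_nz P_degree by simp

lemma X_ip_sum_left: "ip (X * (\<Sum>j\<in>J. Polynomial.smult (c j) (q j))) s = (\<Sum>j\<in>J. c j * ip (X * q j) s)"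
  by (simp add: sum_distrib_left ip_sum_left ip_smult_left)

lemma P_orth: "n \<le> d \<Longrightarrow> j < n \<Longrightarrow> ip (X * P n) (X * P j) = 0"
proof (induction n arbitrary: j rule: less_induct)
  case (less n)
  have orth: "ip (X * P l) (X * P j) = 0" if "l < n" "l \<noteq> j" for l
  proof (cases "j < l")
    case True
    then show ?thesis using less.IH[of l j] that less.prems by simp
  next
    case False
    then show ?thesis using less.IH[of j l] that less.prems by (simp add: ip_commute)
  qed
  have "ip (X * P n) (X * P j) = ip (X * Polynomial.monom 1 n) (X * P j) -
      (\<Sum>l<n. ip (X * Polynomial.monom 1 n) (X * P l) / ip (X * P l) (X * P l) * ip (X * P l) (X * P j))"
    by (subst P_eq) (simp only: right_diff_distrib ip_diff_left X_ip_sum_left)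
  also have "(\<Sum>l<n. ip (X * Polynomial.monom 1 n) (X * P l) / ip (X * P l) (X * P l) * ip (X * P l) (X * P j))
     = (\<Sum>l\<in>{j}. ip (X * Polynomial.monom 1 n) (X * P l) / ip (X * P l) (X * P l) * ip (X * P l) (X * P j))"
    using less.prems orth by (intro sum.mono_neutral_right) auto
  also have "\<dots> = ip (X * Polynomial.monom 1 n) (X * P j)"
    using P_norm_pos[of j] less.prems by simp
  finally show ?case by simp
qed

lemma r_orth_P:
  assumes "k \<le> d" "j < k" shows "ip (r k) (X * P j) = 0"
proof -
  have "ip (r k) (X * P j) = ip 1 (X * P j)
      - (\<Sum>l<k. ip 1 (X * P l) / ip (X * P l) (X * P l) * ip (X * P l) (X * P j))"
    by (simp only: r_eq ip_diff_left X_ip_sum_left)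
  also have "(\<Sum>l<k. ip 1 (X * P l) / ip (X * P l) (X * P l) * ip (X * P l) (X * P j))
     = (\<Sum>l\<in>{j}. ip 1 (X * P l) / ip (X * P l) (X * P l) * ip (X * P l) (X * P j))"
  proof (intro sum.mono_neutral_right ballI)
    fix l assume l: "l \<in> {..<k} - {j}"
    then consider "l < j" | "j < l" by fastforce
    then have "ip (X * P l) (X * P j) = 0"
      using P_orth[of l j] P_orth[of j l] l assms by cases (auto simp: ip_commute)
    then show "ip 1 (X * P l) / ip (X * P l) (X * P l) * ip (X * P l) (X * P j) = 0" by simp
  qed (use assms in auto)
  also have "\<dots> = ip 1 (X * P j)" using P_norm_pos[of j] assms by simp
  finally show ?thesis by simp
qed

lemma r_orth:
  assumes k: "k \<le> d" and q: "Polynomial.degree q < k"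
  shows "ip (r k) (X * q) = 0"
  using q
proof (induction "Polynomial.degree q" arbitrary: q rule: less_induct)
  case less
  define m where "m = Polynomial.degree q"
  define s where "s = q - Polynomial.smult (coeff q m) (P m)"
  have qs: "q = s + Polynomial.smult (coeff q m) (P m)" by (simp add: s_def)
  have cs: "coeff s j = 0" if "j \<ge> m" for j
    using that P_degree[of m] by (cases "j = m") (auto simp: s_def coeff_eq_0 m_def)
  have "ip (r k) (X * s) = 0"
  proof (cases "s = 0")
    case True
    then show ?thesis by (simp add: ip_def)
  next
    case False
    then have "Polynomial.degree s < m"
      using cs by (metis leading_coeff_0_iff linorder_not_less)
    then show ?thesis using less by (simp add: m_def)
  qed
  moreover have "ip (r k) (X * P m) = 0" using less.prems k by (intro r_orth_P) (auto simp: m_def)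
  ultimately show ?case
    by (subst qs) (simp only: distrib_left ip_add_right mult_smult_right ip_smult_right mult_zero_right add_0)
qed

lemma r_residual: "r k \<in> residual_polys k"
proof -
  have "Polynomial.degree (\<Sum>j<k. Polynomial.smult (ip 1 (X * P j) / ip (X * P j) (X * P j)) (P j)) \<le> k - 1"
    using P_degree by (intro degree_sum_le) (auto intro: order_trans[OF degree_smult_le])
  then have "Polynomial.degree (r k) \<le> k"
  proof (cases "k = 0")
    case False
    assume *: "Polynomial.degree (\<Sum>j<k. Polynomial.smult (ip 1 (X * P j) / ip (X * P j) (X * P j)) (P j)) \<le> k - 1"
    have "Polynomial.degree (X * (\<Sum>j<k. Polynomial.smult (ip 1 (X * P j) / ip (X * P j) (X * P j)) (P j))) \<le> 1 + (k - 1)"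
      using * by (intro order_trans[OF degree_mult_le] add_mono) auto
    then show ?thesis unfolding r_eq using False by (intro degree_diff_le) auto
  qed (simp add: r_eq)
  moreover have "poly (r k) 0 = 1" by (simp add: r_eq)
  ultimately show ?thesis by (simp add: residual_polys_def)
qed

lemma residual_polys_diff:
  assumes "q \<in> residual_polys k" "q' \<in> residual_polys k"
  shows "q = q' \<or> (\<exists>s. q = q' + X * s \<and> s \<noteq> 0 \<and> Polynomial.degree s < k)"
proof (cases "q = q'")
  case False
  have "poly (q - q') 0 = 0" using assms by (simp add: residual_polys_def)
  then have "[:- 0, 1:] dvd q - q'" by (simp only: poly_eq_0_iff_dvd)
  then obtain s where s: "q - q' = X * s" by (auto simp: dvd_def)
  then have nz: "s \<noteq> 0" using False by auto
  have "Polynomial.degree (q - q') \<le> k"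
    using assms by (intro degree_diff_le) (auto simp: residual_polys_def)
  then have "Polynomial.degree s < k" using nz unfolding s by (simp add: mult_pCons_left)
  then show ?thesis using s nz by (intro disjI2 exI[of _ s]) (auto simp: algebra_simps)
qed simp

lemma r_pythagoras:
  assumes "k \<le> d" "Polynomial.degree s < k"
  shows "res (r k + X * s) = res (r k) + ip (X * s) (X * s)"
  unfolding ip_self[symmetric] using r_orth[OF assms]
  by (simp only: ip_add_left ip_add_right ip_commute[of "X * s" "r k"])

lemma r_minimal:
  assumes "k \<le> d" "q \<in> residual_polys k"
  shows "res (r k) \<le> res q" "res q = res (r k) \<Longrightarrow> q = r k"
proof -
  have "q = r k \<or> res q > res (r k)"
    using residual_polys_diff[OF assms(2) r_residual]
  proof
    assume "\<exists>s. q = r k + X * s \<and> s \<noteq> 0 \<and> Polynomial.degree s < k"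
    then obtain s where s: "q = r k + X * s" "s \<noteq> 0" "Polynomial.degree s < k" by blast
    then show ?thesis
      using r_pythagoras[OF assms(1) s(3)] ip_X_self_pos[of s] assms(1) by simp
  qed simp
  then show "res (r k) \<le> res q" "res q = res (r k) \<Longrightarrow> q = r k" by auto
qed

lemma r_unique:
  assumes "k \<le> d"
  shows "(THE q. q \<in> residual_polys k \<and> (\<forall>q'\<in>residual_polys k. res q \<le> res q')) = r k"
  using r_minimal[OF assms] r_residual by (intro the_equality) (auto intro!: antisym)

lemma res_antimono:
  assumes "k \<le> l" "l \<le> d" shows "res (r l) \<le> res (r k)"
  using r_residual[of k] assms by (intro r_minimal) (auto simp: residual_polys_def)

lemma res_d: "res (r d) = 0"
proof -
  define q where "q = (\<Prod>a\<in>x ` {1..D}. [:1, - 1 / a:])"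
  have "Polynomial.degree q \<le> sum (Polynomial.degree \<circ> (\<lambda>a. [:1, - 1 / a:])) (x ` {1..D})"
    unfolding q_def by (rule degree_prod_sum_le) auto
  also have "\<dots> \<le> (\<Sum>a\<in>x ` {1..D}. 1)" by (intro sum_mono) auto
  also have "\<dots> = d" by (simp add: d_def)
  finally have "q \<in> residual_polys d"
    by (auto simp: residual_polys_def q_def poly_prod)
  moreover have "poly q (x i) = 0" if "i \<in> {1..D}" for i
    using that x_pos[of i] by (auto simp: q_def poly_prod intro!: bexI[of _ i])
  then have "res q = 0" by (simp add: sq_residual_def)
  ultimately have "res (r d) \<le> 0" using r_minimal(1)[of d q] by simp
  then show ?thesis using ip_self_nonneg[of "r d"] by (simp add: ip_self)
qed

text \<open>\<open>r k - r (Suc k)\<close> is the variable times a polynomial of degree at most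
  \<open>k\<close>, hence orthogonal to \<open>r (Suc k)\<close>. So no mixed term appears, and the
  residual depends on the weight through its square alone.\<close>

lemma res_interp:
  assumes "k < d"
  shows "res (Polynomial.smult (1 - \<alpha>) (r k) + Polynomial.smult \<alpha> (r (Suc k)))
    = res (r (Suc k)) + (1 - \<alpha>)\<^sup>2 * (res (r k) - res (r (Suc k)))"
proof -
  have "r k \<in> residual_polys (Suc k)" using r_residual[of k] by (auto simp: residual_polys_def)
  then have "ip (r (Suc k)) (r k) = ip (r (Suc k)) (r (Suc k))"
  proof -
    consider "r k = r (Suc k)" | s where "r k = r (Suc k) + X * s" "Polynomial.degree s < Suc k"
      using residual_polys_diff[OF \<open>r k \<in> residual_polys (Suc k)\<close> r_residual] by blast
    then show ?thesis
    proof cases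
      case (2 s)
      then show ?thesis using r_orth[of "Suc k" s] assms by (simp add: ip_add_right)
    qed simp
  qed
  moreover from this have "ip (r k) (r (Suc k)) = ip (r (Suc k)) (r (Suc k))"
    by (simp add: ip_commute)
  ultimately show ?thesis unfolding ip_self[symmetric]
    by (simp add: ip_add_left ip_add_right ip_smult_left ip_smult_right power2_eq_square algebra_simps)
qed

text \<open>Orthogonality forces \<open>k\<close> sign changes on the positive axis.\<close>

lemma orth_roots:
  assumes k: "k \<le> d" and q: "poly q 0 = 1" and orth: "\<And>s. Polynomial.degree s < k \<Longrightarrow> ip q (X * s) = 0"
  shows "\<exists>F. finite F \<and> F \<subseteq> {0<..} \<and> k \<le> card F \<and> (\<Prod>a\<in>F. [:-a, 1:]) dvd q"
proof -
  have "q \<noteq> 0" using q by auto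
  then obtain F e where F: "finite F" "F \<subseteq> {0<..}" "q = (\<Prod>a\<in>F. [:-a, 1:]) * e"
    and e: "(\<forall>t>0. poly e t \<ge> 0) \<or> (\<forall>t>0. poly e t \<le> 0)"
    using poly_sign_split by blast
  show ?thesis
  proof (cases "k \<le> card F")
    case True
    then show ?thesis using F by (intro exI[of _ F]) auto
  next
    case False
    define s where "s = (\<Prod>a\<in>F. [:-a, 1::real:])"
    \<comment> \<open>Multiplying \<open>q\<close> by its own sign changes gives an integrand of
      constant sign; with vanishing integral, \<open>q\<close> must vanish at every data point. In
      that case the \<open>d \<ge> k\<close> data points themselves serve as the zeros.\<close>
    have "ip q (X * s) = 0" using False F by (intro orth) (simp add: s_def degree_prod_linear)
    then have sum0: "(\<Sum>i=1..D. (y i)\<^sup>2 * x i * (poly s (x i))\<^sup>2 * poly e (x i)) = 0"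
      by (simp add: ip_def F(3) s_def[symmetric] power2_eq_square mult_ac)
    have "(y i)\<^sup>2 * x i * (poly s (x i))\<^sup>2 * poly e (x i) = 0" if i: "i \<in> {1..D}" for i
      using e
    proof
      assume "\<forall>t>0. poly e t \<ge> 0"
      then have "\<forall>i\<in>{1..D}. 0 \<le> (y i)\<^sup>2 * x i * (poly s (x i))\<^sup>2 * poly e (x i)"
        using x_pos by (auto intro!: mult_nonneg_nonneg simp: less_imp_le)
      then show ?thesis using sum0 i by (subst (asm) sum_nonneg_eq_0_iff) auto
    next
      assume "\<forall>t>0. poly e t \<le> 0"
      then have "\<forall>i\<in>{1..D}. 0 \<le> - ((y i)\<^sup>2 * x i * (poly s (x i))\<^sup>2 * poly e (x i))"
        using x_pos by (auto intro!: mult_nonneg_nonpos simp: less_imp_le)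
      moreover have "(\<Sum>i=1..D. - ((y i)\<^sup>2 * x i * (poly s (x i))\<^sup>2 * poly e (x i))) = 0"
        using sum0 by (simp add: sum_negf)
      ultimately show ?thesis using i by (subst (asm) sum_nonneg_eq_0_iff) auto
    qed
    then have "poly q (x i) = 0" if "i \<in> {1..D}" for i
      using y_nz[OF that] x_pos[OF that] that by (fastforce simp: F(3) s_def[symmetric])
    then have "(\<Prod>a\<in>x ` {1..D}. [:-a, 1:]) dvd q" by (intro prod_linear_dvd) auto
    then show ?thesis using k x_pos by (intro exI[of _ "x ` {1..D}"]) (auto simp: d_def)
  qed
qed

lemma orth_factorization:
  assumes k: "k \<le> d" and q: "poly q 0 = 1" and orth: "\<And>s. Polynomial.degree s < k \<Longrightarrow> ip q (X * s) = 0"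
  shows "\<exists>B e. (\<forall>b\<in>#B. 0 < b) \<and> k \<le> size B \<and> q = lin_prod B * e \<and> poly e 0 = 1
    \<and> Polynomial.degree q = size B + Polynomial.degree e"
proof -
  obtain F e where F: "finite F" "F \<subseteq> {0<..}" "k \<le> card F" "q = (\<Prod>a\<in>F. [:-a, 1:]) * e"
    using orth_roots[OF assms] by (auto simp: dvd_def)
  define c where "c = (\<Prod>a\<in>F. - a)"
  have nz: "a \<noteq> 0" if "a \<in> F" for a using F that by auto
  have c: "c \<noteq> 0" using F nz by (simp add: c_def)
  define B where "B = image_mset inverse (mset_set F)"
  have "lin_prod B = (\<Prod>a\<in>F. [:1, - inverse a:])"
    by (simp add: lin_prod_def B_def image_mset.compositionality o_def prod_unfold_prod_mset)
  moreover have "[:-a, 1:] = Polynomial.smult (- a) [:1, - inverse a:]" if "a \<in> F" for a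
    using nz[OF that] by simp
  then have "(\<Prod>a\<in>F. [:-a, 1:]) = (\<Prod>a\<in>F. Polynomial.smult (- a) [:1, - inverse a:])"
    by (intro prod.cong) auto
  then have "(\<Prod>a\<in>F. [:-a, 1:]) = Polynomial.smult c (\<Prod>a\<in>F. [:1, - inverse a:])"
    by (simp only: prod_smult c_def)
  ultimately have eq: "q = lin_prod B * Polynomial.smult c e" by (simp add: F(4))
  have e0: "poly (Polynomial.smult c e) 0 = 1" using q unfolding eq poly_mult poly_lin_prod_0 by simp
  have "e \<noteq> 0" using e0 by auto
  moreover have "(\<Prod>a\<in>F. [:-a, 1:]) \<noteq> 0" using F by auto
  ultimately have "Polynomial.degree q = card F + Polynomial.degree e"
    unfolding F(4) using F by (simp add: degree_mult_eq degree_prod_linear)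
  then show ?thesis using F c e0 eq
    by (intro exI[of _ B] exI[of _ "Polynomial.smult c e"]) (auto simp: B_def)
qed

lemma degree_0_const:
  assumes "Polynomial.degree (e :: real poly) = 0" "poly e 0 = 1" shows "e = 1"
  using assms by (metis degree_eq_zeroE one_pCons poly_0 poly_pCons mult_zero_left add.right_neutral)

lemma r_factorization:
  assumes "k \<le> d" shows "\<exists>B. (\<forall>b\<in>#B. 0 < b) \<and> size B = k \<and> r k = lin_prod B"
proof -
  have r0: "poly (r k) 0 = 1" "Polynomial.degree (r k) \<le> k"
    using r_residual[of k] by (auto simp: residual_polys_def)
  obtain B e where B: "\<forall>b\<in>#B. 0 < b" "k \<le> size B" "r k = lin_prod B * e" "poly e 0 = 1"
    "Polynomial.degree (r k) = size B + Polynomial.degree e"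
    using orth_factorization[OF assms r0(1) r_orth[OF assms]] by blast
  then have "Polynomial.degree e = 0" "size B = k" using r0 by auto
  then show ?thesis using B degree_0_const[of e] by auto
qed

definition interp :: "nat \<Rightarrow> real \<Rightarrow> real poly" where
  "interp k \<alpha> = Polynomial.smult (1 - \<alpha>) (r k) + Polynomial.smult \<alpha> (r (Suc k))"

lemma interp_orth:
  assumes "k < d" "Polynomial.degree s < k" shows "ip (interp k \<alpha>) (X * s) = 0"
  using r_orth[of k s] r_orth[of "Suc k" s] assms
  by (simp add: interp_def ip_add_left ip_smult_left)

text \<open>Interpolation preserves orthogonality only below degree \<open>k\<close>, which yields
  \<open>k\<close> of the \<open>Suc k\<close> zeros. A single remaining factor is real, and its
  zero is positive by the leading sign: at degree \<open>Suc k\<close> only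
  \<open>\<alpha> * r (Suc k)\<close> contributes, and \<open>\<alpha> > 0\<close>.\<close>

lemma interp_factorization:
  assumes k: "k < d" and \<alpha>: "0 < \<alpha>" "\<alpha> \<le> 1"
  shows "\<exists>B. (\<forall>b\<in>#B. 0 < b) \<and> size B = Suc k \<and> interp k \<alpha> = lin_prod B"
proof -
  have rk: "r k \<in> residual_polys k" "r (Suc k) \<in> residual_polys (Suc k)" by (rule r_residual)+
  have i0: "poly (interp k \<alpha>) 0 = 1" using rk by (simp add: interp_def residual_polys_def)
  have deg: "Polynomial.degree (interp k \<alpha>) \<le> Suc k"
    unfolding interp_def using rk
    by (intro degree_add_le order_trans[OF degree_smult_le]) (auto simp: residual_polys_def)
  obtain B' where B': "\<forall>b\<in>#B'. 0 < b" "size B' = Suc k" "r (Suc k) = lin_prod B'"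
    using r_factorization[of "Suc k"] k by auto
  have "coeff (r k) (Suc k) = 0" using rk by (intro coeff_eq_0) (auto simp: residual_polys_def)
  then have lead: "(-1) ^ Suc k * coeff (interp k \<alpha>) (Suc k) > 0"
    using mult_pos_pos[OF \<alpha>(1) coeff_lin_prod_sign[of B']] B'
    by (simp add: interp_def mult.left_commute)
  obtain B e where B: "\<forall>b\<in>#B. 0 < b" "k \<le> size B" "interp k \<alpha> = lin_prod B * e" "poly e 0 = 1"
    "Polynomial.degree (interp k \<alpha>) = size B + Polynomial.degree e"
    using orth_factorization[OF less_imp_le[OF k] i0 interp_orth[OF k]] by blast
  have "Polynomial.degree (interp k \<alpha>) \<ge> Suc k" using lead by (intro le_degree) auto
  with deg have deg': "Polynomial.degree (interp k \<alpha>) = Suc k" by simp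
  show ?thesis
  proof (cases "size B = k")
    case False
    then have "size B = Suc k" "Polynomial.degree e = 0" using B deg' by auto
    then show ?thesis using B degree_0_const[of e] by auto
  next
    case True
    then have "Polynomial.degree e \<le> 1" using B deg' by simp
    then obtain b where e: "e = [:1, -b:]" using B(4)
    proof -
      have "e = [:coeff e 0, coeff e 1:]"
        by (rule poly_eqI) (use \<open>Polynomial.degree e \<le> 1\<close> in \<open>auto simp: coeff_pCons coeff_eq_0 split: nat.splits\<close>)
      then show ?thesis using B(4) that[of "- coeff e 1"] by (simp add: poly_0_coeff_0)
    qed
    have "coeff (lin_prod B) (Suc k) = 0"
      using degree_lin_prod_le[of B] True by (intro coeff_eq_0) auto
    then have "coeff (interp k \<alpha>) (Suc k) = - b * coeff (lin_prod B) k"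
      by (simp add: B(3) e mult_pCons_right)
    then have "((-1) ^ k * coeff (lin_prod B) k) * b > 0" using lead by (simp add: mult_ac)
    moreover have "(-1) ^ k * coeff (lin_prod B) k > 0" using coeff_lin_prod_sign[of B] B True by simp
    ultimately have "b > 0" by (simp add: zero_less_mult_iff)
    then show ?thesis using B True e by (intro exI[of _ "add_mset b B"]) (auto simp: mult.commute)
  qed
qed

text \<open>Nemirovskii's inequality: the residual is controlled by its part below the smallest zero
  \<open>1/\<beta>\<close>. It follows by testing the orthogonality relation with the polynomial divided by the linear
  factor of this zero; for interpolated polynomials the extra term has the favourable sign.\<close>

lemma interp_residual_le:
  assumes k: "k < d" and \<alpha>: "0 < \<alpha>" "\<alpha> \<le> 1"
    and B: "\<And>b. b \<in># B \<Longrightarrow> 0 < b" "size B = Suc k" "interp k \<alpha> = lin_prod B"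
    and \<beta>: "\<beta> \<in># B" "\<And>b. b \<in># B \<Longrightarrow> b \<le> \<beta>"
  shows "res (interp k \<alpha>) \<le>
    (\<Sum>i=1..D. if \<beta> * x i < 1 then (y i)\<^sup>2 * poly (interp k \<alpha>) (x i) else 0)"
proof -
  obtain B' where B': "B = add_mset \<beta> B'" using \<beta> by (auto dest: multi_member_split)
  define q where "q = lin_prod B'"
  have rq: "interp k \<alpha> = [:1, -\<beta>:] * q" using B by (simp add: B' q_def)
  obtain Bk where Bk: "\<forall>b\<in>#Bk. 0 < b" "size Bk = k" "r k = lin_prod Bk"
    using r_factorization[of k] k by auto
  have sz: "size B' = k" using B by (simp add: B')
  have pos: "(-1) ^ k * coeff q k > 0" "(-1) ^ k * coeff (r k) k > 0"
    using coeff_lin_prod_sign[of B'] coeff_lin_prod_sign[of Bk] Bk B sz by (auto simp: B' q_def)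
  \<comment> \<open>This ratio cancels the leading terms, so \<open>q - c * r k\<close> has degree
    below \<open>k\<close> and is annihilated by orthogonality. Testing with \<open>q\<close> thus
    reduces to testing with \<open>r k\<close>, where only the part \<open>1 - \<alpha>\<close> of
    the interpolation survives.\<close>
  define c where "c = coeff q k / coeff (r k) k"
  have "c = ((-1) ^ k * coeff q k) / ((-1) ^ k * coeff (r k) k)" by (simp add: c_def)
  then have c: "c > 0" using pos by (metis divide_pos_pos)
  define s where "s = q - Polynomial.smult c (r k)"
  have nz: "coeff (r k) k \<noteq> 0" using pos by auto
  have deg: "Polynomial.degree q \<le> k" "Polynomial.degree (r k) \<le> k"
    using degree_lin_prod_le[of B'] degree_lin_prod_le[of Bk] Bk sz by (auto simp: q_def)
  have cs: "coeff s j = 0" if "j \<ge> k" for j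
    using that deg nz by (cases "j = k") (auto simp: s_def c_def coeff_eq_0)
  have s0: "s = 0 \<or> Polynomial.degree s < k"
    using cs by (metis leading_coeff_0_iff linorder_not_less)
  then have "ip (interp k \<alpha>) (X * s) = 0" using interp_orth k by (auto simp: ip_def)
  moreover have "ip (r (Suc k)) (X * r k) = 0" using k deg by (intro r_orth) auto
  moreover have "q = s + Polynomial.smult c (r k)" by (simp add: s_def)
  ultimately have "ip (interp k \<alpha>) (X * q) = c * ((1 - \<alpha>) * ip (r k) (X * r k))"
    by (simp add: distrib_left ip_add_right ip_smult_right)
       (simp add: interp_def ip_add_left ip_smult_left)
  also have "\<dots> \<ge> 0" using c \<alpha> ip_X_self_nonneg by simp
  finally have "0 \<le> ip (interp k \<alpha>) (X * q)" .
  also have "\<dots> = (\<Sum>i=1..D. (y i)\<^sup>2 * x i * (1 - \<beta> * x i) * (poly q (x i))\<^sup>2)"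
    unfolding ip_def rq by (intro sum.cong) (auto simp: power2_eq_square algebra_simps)
  finally have nem: "0 \<le> (\<Sum>i=1..D. (y i)\<^sup>2 * x i * (1 - \<beta> * x i) * (poly q (x i))\<^sup>2)" .
  have \<beta>0: "\<beta> > 0" using \<beta> B by simp
  have "res (interp k \<alpha>) \<le> (\<Sum>i=1..D.
      (if \<beta> * x i < 1 then (y i)\<^sup>2 * poly (interp k \<alpha>) (x i) else 0)
      - \<beta> * ((y i)\<^sup>2 * x i * (1 - \<beta> * x i) * (poly q (x i))\<^sup>2))"
    unfolding sq_residual_def
  proof (rule sum_mono)
    fix i assume i: "i \<in> {1..D}"
    define u where "u = \<beta> * x i"
    define v where "v = poly q (x i)"
    have u: "u > 0" using \<beta>0 x_pos[OF i] by (simp add: u_def)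
    have ri: "poly (interp k \<alpha>) (x i) = (1 - u) * v" by (simp add: rq u_def v_def algebra_simps)
    \<comment> \<open>From \<open>(1 - u)\<^sup>2 = (1 - u) - u * (1 - u)\<close>: the subtracted
      part sums to \<open>\<beta>\<close> times the tested relation \<open>nem\<close>. The first
      part is at most \<open>(1 - u) * v\<close> below the zero, where \<open>v\<close> lies in
      \<open>[0,1]\<close>, and is not positive above it.\<close>
    have "((1 - u) * v)\<^sup>2 \<le> (if u < 1 then (1 - u) * v else 0) - u * (1 - u) * v\<^sup>2"
    proof (cases "u < 1")
      case True
      have v: "0 \<le> v" "v \<le> 1"
        using lin_prod_bounds[of B' \<beta> "x i"] B \<beta> True x_pos[OF i]
        by (auto simp: v_def q_def B' u_def)
      have "v\<^sup>2 \<le> v" using v by (simp add: power2_eq_square mult_left_le_one_le)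
      then have "(1 - u) * v\<^sup>2 \<le> (1 - u) * v" using True by (intro mult_left_mono) auto
      then show ?thesis using True by (simp add: power2_eq_square algebra_simps)
    next
      case False
      have "0 \<le> (u - 1) * v\<^sup>2" using False by simp
      then show ?thesis using False by (simp add: power2_eq_square algebra_simps)
    qed
    then have "(y i)\<^sup>2 * ((1 - u) * v)\<^sup>2 \<le> (y i)\<^sup>2 * ((if u < 1 then (1 - u) * v else 0) - u * (1 - u) * v\<^sup>2)"
      by (intro mult_left_mono) auto
    then show "(y i)\<^sup>2 * (poly (interp k \<alpha>) (x i))\<^sup>2 \<le>
       (if \<beta> * x i < 1 then (y i)\<^sup>2 * poly (interp k \<alpha>) (x i) else 0)
        - \<beta> * ((y i)\<^sup>2 * x i * (1 - \<beta> * x i) * (poly q (x i))\<^sup>2)"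
      unfolding ri u_def[symmetric] v_def[symmetric]
      by (simp add: algebra_simps u_def split: if_splits)
  qed
  also have "\<dots> \<le> (\<Sum>i=1..D. if \<beta> * x i < 1 then (y i)\<^sup>2 * poly (interp k \<alpha>) (x i) else 0)"
    unfolding sum_subtractf sum_distrib_left[symmetric] using nem \<beta>0 by simp
  finally show ?thesis .
qed

section \<open>The stopping time\<close>

lemma d_pos: "d \<ge> 1"
  using D1 by (simp add: d_def Suc_le_eq card_gt_0_iff)

lemma stop_index_props:
  assumes \<kappa>: "\<kappa> > 0"
  shows "stop_index D x \<kappa> y \<le> d" "res (r (stop_index D x \<kappa> y)) \<le> \<kappa>"
    "\<And>k. k < stop_index D x \<kappa> y \<Longrightarrow> \<kappa> < res (r k)"
proof -
  have d: "res (r d) \<le> \<kappa>" using res_d \<kappa> by simp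
  show "stop_index D x \<kappa> y \<le> d" "res (r (stop_index D x \<kappa> y)) \<le> \<kappa>"
    unfolding stop_index_def using d by (auto intro: Least_le LeastI)
  show "\<And>k. k < stop_index D x \<kappa> y \<Longrightarrow> \<kappa> < res (r k)"
    unfolding stop_index_def by (meson not_le not_less_Least)
qed

lemma stopped_poly_0: "stop_index D x \<kappa> y = 0 \<Longrightarrow> stopped_poly D x \<kappa> y = 1"
  by (simp add: stopped_poly_def)

lemma stopped_poly_Suc:
  assumes \<kappa>: "\<kappa> > 0" and k: "stop_index D x \<kappa> y = Suc k"
  defines "\<alpha> \<equiv> 1 - stop_weight D x \<kappa> y (Suc k)"
  shows "k < d" "0 < \<alpha>" "\<alpha> \<le> 1" "stopped_poly D x \<kappa> y = interp k \<alpha>" "res (interp k \<alpha>) = \<kappa>"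
proof -
  note props = stop_index_props[OF \<kappa>, unfolded k]
  show kd: "k < d" using props by simp
  have lt: "res (r (Suc k)) \<le> \<kappa>" "\<kappa> < res (r k)" using props by auto
  define h where "h = (\<kappa> - res (r (Suc k))) / (res (r k) - res (r (Suc k)))"
  have h: "0 \<le> h" "h < 1" using lt by (auto simp: h_def field_simps)
  have \<alpha>: "1 - \<alpha> = sqrt h" by (simp add: \<alpha>_def stop_weight_def h_def)
  have "sqrt h < 1" using h by simp
  then show "0 < \<alpha>" using \<alpha> by linarith
  show "\<alpha> \<le> 1" using \<alpha> h by (smt (verit) real_sqrt_ge_zero)
  show "stopped_poly D x \<kappa> y = interp k \<alpha>"
    by (simp add: stopped_poly_def k interp_def \<alpha>_def)
  have "res (interp k \<alpha>) = res (r (Suc k)) + (1 - \<alpha>)\<^sup>2 * (res (r k) - res (r (Suc k)))"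
    unfolding interp_def by (rule res_interp[OF kd])
  also have "\<dots> = \<kappa>" using lt h unfolding \<alpha> by (simp add: h_def)
  finally show "res (interp k \<alpha>) = \<kappa>" .
qed

text \<open>After a positive stopping time the interpolation makes the residual exactly
  \<open>\<kappa>\<close>, so the Nemirovskii bound becomes a lower bound on the data below the
  smallest zero. When stopping at time \<open>0\<close> only \<open>res 1 \<le> \<kappa>\<close> is
  known; hence the guard \<open>0 < \<rho>\<close>.\<close>

lemma stopped_poly_filter:
  assumes \<kappa>: "\<kappa> > 0"
  defines "q \<equiv> stopped_poly D x \<kappa> y"
  shows "\<exists>\<rho> \<beta>. 0 \<le> \<beta> \<and> \<beta> \<le> \<rho> \<and>
    (\<forall>t. 0 \<le> t \<and> \<beta> * t < 1 \<longrightarrow> 0 \<le> poly q t \<and> poly q t \<le> exp (- \<rho> * t) \<and> 1 - \<rho> * t \<le> poly q t) \<and>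
    (\<forall>s t. 0 \<le> s \<and> s \<le> t \<and> \<beta> * t < 1 \<longrightarrow> poly q t \<le> poly q s) \<and>
    res q \<le> \<kappa> \<and>
    (0 < \<rho> \<longrightarrow> \<kappa> \<le> (\<Sum>i=1..D. if \<beta> * x i < 1 then (y i)\<^sup>2 * poly q (x i) else 0))"
proof (cases "stop_index D x \<kappa> y")
  case 0
  then have "res (r 0) \<le> \<kappa>" "q = 1" using stop_index_props[OF \<kappa>] stopped_poly_0 by (auto simp: q_def)
  moreover have "r 0 = 1" by (simp add: gs_residual_def)
  ultimately show ?thesis by (intro exI[of _ 0] exI[of _ 0]) auto
next
  case (Suc k)
  define \<alpha> where "\<alpha> = 1 - stop_weight D x \<kappa> y (Suc k)"
  note st = stopped_poly_Suc[OF \<kappa> Suc, folded \<alpha>_def]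
  obtain B where B: "\<forall>b\<in>#B. 0 < b" "size B = Suc k" "interp k \<alpha> = lin_prod B"
    using interp_factorization[OF st(1-3)] by auto
  define \<beta> where "\<beta> = Max (set_mset B)"
  have "B \<noteq> {#}" using B by auto
  then have \<beta>: "\<beta> \<in># B" "\<And>b. b \<in># B \<Longrightarrow> b \<le> \<beta>" by (auto simp: \<beta>_def)
  have q: "q = lin_prod B" using st B by (simp add: q_def)
  obtain B' where B': "B = add_mset \<beta> B'" using \<beta> by (auto dest: multi_member_split)
  have "\<forall>b\<in>#B'. 0 < b" using B by (simp add: B')
  then have "0 \<le> sum_mset B'" by (induction B') auto
  then have "\<beta> \<le> sum_mset B" by (simp add: B')
  moreover have "0 \<le> \<beta>" using B \<beta> by (auto simp: less_imp_le)
  moreover have "\<kappa> \<le> (\<Sum>i=1..D. if \<beta> * x i < 1 then (y i)\<^sup>2 * poly q (x i) else 0)"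
    using interp_residual_le[OF st(1-3) _ B(2,3) \<beta>] B(1)
    unfolding q_def st(4) st(5) by blast
  moreover have "res q \<le> \<kappa>" using st by (simp add: q_def)
  ultimately show ?thesis
    using lin_prod_bounds[of B \<beta>] lin_prod_antimono[of B \<beta>] B \<beta>
    by (intro exI[of _ "sum_mset B"] exI[of _ \<beta>]) (auto simp: q)
qed

definition residual_at :: "real \<Rightarrow> real" where
  "residual_at t = res (interp (nat \<lceil>t\<rceil> - 1) (t - real (nat \<lceil>t\<rceil> - 1)))"

text \<open>The infimum over real times is a minimum: on earlier unit intervals the residual stays
  above the value at their right end point, which exceeds \<open>\<kappa>\<close>, and on the last
  one it is strictly decreasing until it reaches \<open>\<kappa>\<close> at
  \<open>k + \<alpha>\<close>.\<close>

lemma interp_at_Inf: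
  assumes \<kappa>: "\<kappa> > 0"
  defines "\<tau> \<equiv> Inf {t \<in> {0..real d}. residual_at t \<le> \<kappa>}"
  shows "\<tau> \<in> {0..real d}" "interp (nat \<lceil>\<tau>\<rceil> - 1) (\<tau> - real (nat \<lceil>\<tau>\<rceil> - 1)) = stopped_poly D x \<kappa> y"
proof -
  have r0: "r 0 = 1" by (simp add: gs_residual_def)
  have i0: "interp 0 0 = 1" by (simp add: interp_def r0)
  have "\<tau> \<in> {0..real d} \<and> interp (nat \<lceil>\<tau>\<rceil> - 1) (\<tau> - real (nat \<lceil>\<tau>\<rceil> - 1)) = stopped_poly D x \<kappa> y"
  proof (cases "stop_index D x \<kappa> y")
    case 0
    then have "res 1 \<le> \<kappa>" using stop_index_props[OF \<kappa>] r0 by auto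
    then have "\<tau> = 0" unfolding \<tau>_def
      by (intro cInf_eq_minimum) (auto simp: residual_at_def i0)
    then show ?thesis using stopped_poly_0[OF 0] by (simp add: i0)
  next
    case (Suc k)
    define \<alpha> where "\<alpha> = 1 - stop_weight D x \<kappa> y (Suc k)"
    note st = stopped_poly_Suc[OF \<kappa> Suc, folded \<alpha>_def]
    note props = stop_index_props[OF \<kappa>, unfolded Suc]
    \<comment> \<open>Since \<open>0 < \<alpha> \<le> 1\<close>, rounding up and subtracting one
      recovers \<open>k\<close>, also in the borderline case \<open>\<alpha> = 1\<close>.\<close>
    have c: "\<lceil>real k + \<alpha>\<rceil> = int k + 1" using st by linarith
    have at: "interp (nat \<lceil>real k + \<alpha>\<rceil> - 1) (real k + \<alpha> - real (nat \<lceil>real k + \<alpha>\<rceil> - 1)) = interp k \<alpha>"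
      by (simp add: c nat_add_distrib)
    have "\<tau> = real k + \<alpha>" unfolding \<tau>_def
    proof (rule cInf_eq_minimum)
      show "real k + \<alpha> \<in> {t \<in> {0..real d}. residual_at t \<le> \<kappa>}"
        using st at by (auto simp: residual_at_def)
    next
      fix t assume t: "t \<in> {t \<in> {0..real d}. residual_at t \<le> \<kappa>}"
      show "real k + \<alpha> \<le> t"
      proof (rule ccontr)
        assume less: "\<not> real k + \<alpha> \<le> t"
        define l where "l = nat \<lceil>t\<rceil> - 1"
        have tl: "real l \<le> t" "t \<le> real l + 1" using t by (auto simp: l_def) linarith+
        have lk: "l \<le> k" using less st by (auto simp: l_def) linarith
        have eq: "residual_at t = res (r (Suc l)) + (1 - (t - real l))\<^sup>2 * (res (r l) - res (r (Suc l)))"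
          unfolding residual_at_def l_def[symmetric] interp_def
          using lk st by (intro res_interp) auto
        have mono: "res (r (Suc l)) \<le> res (r l)" using lk st by (intro res_antimono) auto
        have "\<kappa> < residual_at t"
        proof (cases "l = k")
          case True
          have "(1 - \<alpha>)\<^sup>2 < (1 - (t - real l))\<^sup>2"
            using True less tl st by (intro power_strict_mono) auto
          moreover have "0 < res (r l) - res (r (Suc l))" using props(2) props(3)[of k] True by simp
          ultimately have "(1 - \<alpha>)\<^sup>2 * (res (r l) - res (r (Suc l)))
              < (1 - (t - real l))\<^sup>2 * (res (r l) - res (r (Suc l)))" by simp
          then show ?thesis using eq st(5) res_interp[OF st(1), of \<alpha>] True by (simp add: interp_def)
        next
          case False
          then have "\<kappa> < res (r (Suc l))" using lk by (intro props) auto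
          also have "\<dots> \<le> residual_at t" using eq mono by simp
          finally show ?thesis .
        qed
        then show False using t by simp
      qed
    qed
    then show ?thesis using st at by auto
  qed
  then show "\<tau> \<in> {0..real d}" "interp (nat \<lceil>\<tau>\<rceil> - 1) (\<tau> - real (nat \<lceil>\<tau>\<rceil> - 1)) = stopped_poly D x \<kappa> y"
    by auto
qed

end

declare mult_pCons_left [simp] mult_pCons_right [simp]

section \<open>Measurability in the data\<close>

lemma measurable_gs_poly [measurable]:
  assumes [measurable]: "\<And>i. i \<in> {1..D} \<Longrightarrow> (\<lambda>\<omega>. y \<omega> i) \<in> borel_measurable M"
  shows "(\<lambda>\<omega>. poly (gs_poly D x (y \<omega>) n) t) \<in> borel_measurable M"
proof (induction n arbitrary: t rule: less_induct)
  case (less n)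
  then have [measurable]: "(\<lambda>\<omega>. poly (gs_poly D x (y \<omega>) j) t) \<in> borel_measurable M" if "j \<in> {..<n}" for j t
    using that by simp
  show ?case
    by (subst gs_poly.simps) (simp only: poly_diff poly_sum poly_smult, measurable)
qed

lemma measurable_gs_residual [measurable]:
  assumes [measurable]: "\<And>i. i \<in> {1..D} \<Longrightarrow> (\<lambda>\<omega>. y \<omega> i) \<in> borel_measurable M"
  shows "(\<lambda>\<omega>. poly (gs_residual D x (y \<omega>) n) t) \<in> borel_measurable M"
  unfolding gs_residual_def poly_diff poly_mult poly_sum poly_smult by measurable

text \<open>The stopping index takes countably many values, so it suffices to treat each index
  separately, where the values are explicit expressions in the data.\<close>

lemma measurable_stopped_poly:
  assumes [measurable]: "\<And>i. i \<in> {1..D} \<Longrightarrow> (\<lambda>\<omega>. y \<omega> i) \<in> borel_measurable M"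
  shows "(\<lambda>\<omega>. poly (stopped_poly D x \<kappa> (y \<omega>)) t) \<in> borel_measurable M"
proof -
  have [measurable]: "(\<lambda>\<omega>. sq_residual D x (y \<omega>) (gs_residual D x (y \<omega>) k)) \<in> borel_measurable M" for k
    unfolding sq_residual_def by measurable
  have [measurable]: "(\<lambda>\<omega>. stop_index D x \<kappa> (y \<omega>)) \<in> measurable M (count_space UNIV)"
    unfolding stop_index_def by measurable
  have eq: "poly (stopped_poly D x \<kappa> (y \<omega>)) t = (\<lambda>k. if k = 0 then 1 else
     stop_weight D x \<kappa> (y \<omega>) k * poly (gs_residual D x (y \<omega>) (k - 1)) t +
     (1 - stop_weight D x \<kappa> (y \<omega>) k) * poly (gs_residual D x (y \<omega>) k) t) (stop_index D x \<kappa> (y \<omega>))" for \<omega>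
    by (simp add: stopped_poly_def Let_def)
  have "(\<lambda>\<omega>. if k = 0 then 1 else
     stop_weight D x \<kappa> (y \<omega>) k * poly (gs_residual D x (y \<omega>) (k - 1)) t +
     (1 - stop_weight D x \<kappa> (y \<omega>) k) * poly (gs_residual D x (y \<omega>) k) t) \<in> borel_measurable M" for k
    unfolding stop_weight_def by measurable
  then show ?thesis unfolding eq
    by (rule measurable_compose_countable) measurable
qed

section \<open>Gaussian concentration\<close>

abbreviation (input) gauss :: "'i set \<Rightarrow> ('i \<Rightarrow> real) measure" where
  "gauss I \<equiv> PiM I (\<lambda>_. std_normal_distribution)"

lemma prob_space_std_normal: "prob_space std_normal_distribution"
  by (rule prob_space_normal_density) simp

lemma product_prob_space_gauss: "product_prob_space (\<lambda>_. std_normal_distribution)"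
proof -
  interpret prob_space std_normal_distribution by (rule prob_space_std_normal)
  show ?thesis by unfold_locales
qed

lemma prob_space_gauss: "prob_space (gauss I)"
  by (rule prob_space_PiM) (rule prob_space_std_normal)

lemma pair_sigma_finite_gauss: "pair_sigma_finite (gauss I) (gauss J)"
proof -
  interpret A: prob_space "gauss I" by (rule prob_space_gauss)
  interpret B: prob_space "gauss J" by (rule prob_space_gauss)
  show ?thesis by unfold_locales
qed

lemma nn_integral_std_normal_exp_linear:
  "(\<integral>\<^sup>+t. ennreal (exp (s * t)) \<partial>std_normal_distribution) = ennreal (exp (s\<^sup>2 / 2))"
proof -
  have "(\<integral>\<^sup>+t. ennreal (exp (s * t)) \<partial>std_normal_distribution)
      = (\<integral>\<^sup>+t. ennreal (exp (s\<^sup>2 / 2)) * ennreal (normal_density s 1 t) \<partial>lborel)"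
  proof (subst nn_integral_density, simp, simp, intro nn_integral_cong)
    fix t :: real
    have "- t\<^sup>2 / 2 + s * t = s\<^sup>2 / 2 + (- (t - s)\<^sup>2 / 2)"
      by (simp add: power2_eq_square field_simps)
    then have "std_normal_density t * exp (s * t) = exp (s\<^sup>2 / 2) * normal_density s 1 t"
      by (simp add: normal_density_def exp_add[symmetric])
    then show "ennreal (std_normal_density t) * ennreal (exp (s * t))
      = ennreal (exp (s\<^sup>2 / 2)) * ennreal (normal_density s 1 t)"
      by (simp flip: ennreal_mult)
  qed
  also have "\<dots> = ennreal (exp (s\<^sup>2 / 2)) * emeasure (density lborel (normal_density s 1)) UNIV"
    by (subst nn_integral_cmult) (auto simp: emeasure_density)
  also have "emeasure (density lborel (normal_density s 1)) UNIV = 1"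
    using prob_space.emeasure_space_1[OF prob_space_normal_density[of 1 s]] by simp
  finally show ?thesis by simp
qed

lemma nn_integral_std_normal_exp_square:
  assumes s: "s < 1/2"
  shows "(\<integral>\<^sup>+t. ennreal (exp (s * t\<^sup>2)) \<partial>std_normal_distribution) = ennreal ((1 - 2 * s) powr (- 1/2))"
proof -
  define \<sigma> where "\<sigma> = (1 - 2 * s) powr (- 1/2)"
  have \<sigma>: "\<sigma> > 0" using s by (simp add: \<sigma>_def)
  have \<sigma>2: "\<sigma>\<^sup>2 = 1 / (1 - 2 * s)"
    using s by (simp add: \<sigma>_def powr_minus_divide powr_half_sqrt power_divide)
  have "(\<integral>\<^sup>+t. ennreal (exp (s * t\<^sup>2)) \<partial>std_normal_distribution)
      = (\<integral>\<^sup>+t. ennreal \<sigma> * ennreal (normal_density 0 \<sigma> t) \<partial>lborel)"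
  proof (subst nn_integral_density, simp, simp, intro nn_integral_cong)
    fix t :: real
    have "- t\<^sup>2 / 2 + s * t\<^sup>2 = - t\<^sup>2 / (2 * \<sigma>\<^sup>2)"
      using s by (simp add: \<sigma>2 field_simps)
    moreover have "sqrt (2 * pi * \<sigma>\<^sup>2) = sqrt (2 * pi) * \<sigma>" using \<sigma> by (simp add: real_sqrt_mult)
    ultimately have "std_normal_density t * exp (s * t\<^sup>2) = \<sigma> * normal_density 0 \<sigma> t"
      using \<sigma> by (simp add: normal_density_def exp_add[symmetric])
    then show "ennreal (std_normal_density t) * ennreal (exp (s * t\<^sup>2))
      = ennreal \<sigma> * ennreal (normal_density 0 \<sigma> t)"
      using \<sigma> by (simp flip: ennreal_mult)
  qed
  also have "\<dots> = ennreal \<sigma> * emeasure (density lborel (normal_density 0 \<sigma>)) UNIV"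
    by (subst nn_integral_cmult) (auto simp: emeasure_density)
  also have "emeasure (density lborel (normal_density 0 \<sigma>)) UNIV = 1"
    using prob_space.emeasure_space_1[OF prob_space_normal_density[OF \<sigma>, of 0]] by simp
  finally show ?thesis by (simp add: \<sigma>_def)
qed

lemma nn_integral_gauss_exp_linear:
  assumes "finite I"
  shows "(\<integral>\<^sup>+z. ennreal (exp (\<Sum>j\<in>I. c j * z j)) \<partial>gauss I) = ennreal (exp ((\<Sum>j\<in>I. (c j)\<^sup>2) / 2))"
proof -
  interpret product_prob_space "\<lambda>_. std_normal_distribution" I by (rule product_prob_space_gauss)
  have "(\<integral>\<^sup>+z. ennreal (exp (\<Sum>j\<in>I. c j * z j)) \<partial>gauss I)
      = (\<integral>\<^sup>+z. (\<Prod>j\<in>I. ennreal (exp (c j * z j))) \<partial>gauss I)"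
    using assms by (simp add: exp_sum prod_ennreal)
  also have "\<dots> = (\<Prod>j\<in>I. \<integral>\<^sup>+t. ennreal (exp (c j * t)) \<partial>std_normal_distribution)"
    using assms by (intro product_nn_integral_prod) auto
  also have "\<dots> = ennreal (exp ((\<Sum>j\<in>I. (c j)\<^sup>2) / 2))"
    using assms by (simp add: nn_integral_std_normal_exp_linear prod_ennreal exp_sum sum_divide_distrib)
  finally show ?thesis .
qed

lemma nn_integral_gauss_exp_square:
  assumes "finite I" "s < 1/2"
  shows "(\<integral>\<^sup>+z. ennreal (exp (s * (\<Sum>j\<in>I. (z j)\<^sup>2))) \<partial>gauss I) = ennreal (((1 - 2 * s) powr (- 1/2)) ^ card I)"
proof -
  interpret product_prob_space "\<lambda>_. std_normal_distribution" I by (rule product_prob_space_gauss)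
  have "(\<integral>\<^sup>+z. ennreal (exp (s * (\<Sum>j\<in>I. (z j)\<^sup>2))) \<partial>gauss I)
      = (\<integral>\<^sup>+z. (\<Prod>j\<in>I. ennreal (exp (s * (z j)\<^sup>2))) \<partial>gauss I)"
    using assms by (simp add: exp_sum prod_ennreal sum_distrib_left)
  also have "\<dots> = (\<Prod>j\<in>I. \<integral>\<^sup>+t. ennreal (exp (s * t\<^sup>2)) \<partial>std_normal_distribution)"
    using assms by (intro product_nn_integral_prod) auto
  also have "\<dots> = (\<Prod>j\<in>I. ennreal ((1 - 2 * s) powr (- 1/2)))"
    using nn_integral_std_normal_exp_square[OF assms(2)] by simp
  also have "\<dots> = ennreal (((1 - 2 * s) powr (- 1/2)) ^ card I)"
    by (subst prod_ennreal) auto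
  finally show ?thesis .
qed

lemma integral_std_normal_iexp:
  "(\<integral>t. exp (\<i> * complex_of_real (c * t)) \<partial>std_normal_distribution) = complex_of_real (exp (- c\<^sup>2 / 2))"
  using fun_cong[OF char_std_normal_distribution, of c] by (simp add: char_def mult_ac)

lemma integral_gauss_iexp:
  assumes "finite I"
  shows "(\<integral>z. exp (\<i> * complex_of_real (\<Sum>j\<in>I. c j * z j)) \<partial>gauss I)
    = complex_of_real (exp (- (\<Sum>j\<in>I. (c j)\<^sup>2) / 2))"
proof -
  interpret product_prob_space "\<lambda>_. std_normal_distribution" I by (rule product_prob_space_gauss)
  have fin: "finite_measure std_normal_distribution"
    by (rule prob_space.finite_measure[OF prob_space_std_normal])
  have "(\<integral>z. exp (\<i> * complex_of_real (\<Sum>j\<in>I. c j * z j)) \<partial>gauss I)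
      = (\<integral>z. (\<Prod>j\<in>I. exp (\<i> * complex_of_real (c j * z j))) \<partial>gauss I)"
    using assms by (simp add: exp_sum sum_distrib_left)
  also have "\<dots> = (\<Prod>j\<in>I. \<integral>t. exp (\<i> * complex_of_real (c j * t)) \<partial>std_normal_distribution)"
    using assms by (intro product_integral_prod finite_measure.integrable_const_bound[OF fin, where B=1]) auto
  also have "\<dots> = complex_of_real (exp (- (\<Sum>j\<in>I. (c j)\<^sup>2) / 2))"
    using assms unfolding integral_std_normal_iexp
    by (simp add: exp_sum sum_negf[symmetric] sum_divide_distrib del: sum_negf flip: of_real_prod)
  finally show ?thesis .
qed

text \<open>Chernoff's bound; every deviation below is reduced through it to one exponential
  moment.\<close>

lemma gauss_tail:
  assumes [measurable]: "h \<in> borel_measurable (gauss I)"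
    and le: "(\<integral>\<^sup>+z. ennreal (exp (h z)) \<partial>gauss I) \<le> ennreal v" and v: "v \<ge> 0"
  shows "measure (gauss I) {z \<in> space (gauss I). h z > t} \<le> exp (- t) * v"
proof -
  interpret prob_space "gauss I" by (rule prob_space_gauss)
  have "emeasure (gauss I) {z \<in> space (gauss I). h z > t}
      \<le> emeasure (gauss I) ({z \<in> space (gauss I). 1 \<le> ennreal (exp (- t)) * ennreal (exp (h z))})"
    by (intro emeasure_mono)
      (auto simp: ennreal_mult[symmetric] exp_add[symmetric] one_le_exp_iff simp flip: ennreal_1)
  also have "\<dots> \<le> ennreal (exp (- t)) * (\<integral>\<^sup>+z. ennreal (exp (h z)) * indicator (space (gauss I)) z \<partial>gauss I)"
    using nn_integral_Markov_inequality[of "\<lambda>z. ennreal (exp (h z))" "space (gauss I)" "gauss I" "ennreal (exp (- t))"]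
    by simp
  also have "(\<integral>\<^sup>+z. ennreal (exp (h z)) * indicator (space (gauss I)) z \<partial>gauss I)
     = (\<integral>\<^sup>+z. ennreal (exp (h z)) \<partial>gauss I)"
    by (intro nn_integral_cong) auto
  also have "ennreal (exp (- t)) * \<dots> \<le> ennreal (exp (- t)) * ennreal v"
    using le by (rule mult_left_mono) simp
  also have "\<dots> = ennreal (exp (- t) * v)" using v by (simp add: ennreal_mult)
  finally show ?thesis using v by (simp add: emeasure_eq_measure)
qed

section \<open>Noise coefficients in an orthonormal basis\<close>

locale gauss_basis =
  fixes D :: nat and u :: "nat \<Rightarrow> nat \<Rightarrow> real"
  assumes D1: "D \<ge> 1"
    and orthonormal: "\<And>i k. i \<in> {1..D} \<Longrightarrow> k \<in> {1..D} \<Longrightarrow>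
      (\<Sum>j<D. u i j * u k j) = (if i = k then 1 else 0)"
begin

abbreviation "\<gamma> \<equiv> gauss {..<D}"

definition \<epsilon> :: "(nat \<Rightarrow> real) \<Rightarrow> nat \<Rightarrow> real" where
  "\<epsilon> z i = (\<Sum>j<D. u i j * z j)"

lemma measurable_\<epsilon> [measurable]: "(\<lambda>z. \<epsilon> z i) \<in> borel_measurable \<gamma>"
  unfolding \<epsilon>_def by measurable

lemma combination_\<epsilon>: "(\<Sum>i\<in>J. c i * \<epsilon> z i) = (\<Sum>j<D. (\<Sum>i\<in>J. c i * u i j) * z j)"
  unfolding \<epsilon>_def sum_distrib_left sum_distrib_right
  by (subst sum.swap) (simp add: mult_ac)

lemma combination_norm:
  assumes "J \<subseteq> {1..D}"
  shows "(\<Sum>j<D. (\<Sum>i\<in>J. c i * u i j)\<^sup>2) = (\<Sum>i\<in>J. (c i)\<^sup>2)"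
proof -
  have J: "finite J" using assms finite_subset by blast
  have "(\<Sum>j<D. (\<Sum>i\<in>J. c i * u i j)\<^sup>2) = (\<Sum>j<D. \<Sum>i\<in>J. \<Sum>k\<in>J. c i * c k * (u i j * u k j))"
    unfolding power2_eq_square sum_product by (simp add: mult_ac)
  also have "\<dots> = (\<Sum>i\<in>J. \<Sum>j<D. \<Sum>k\<in>J. c i * c k * (u i j * u k j))"
    by (rule sum.swap)
  also have "\<dots> = (\<Sum>i\<in>J. \<Sum>k\<in>J. \<Sum>j<D. c i * c k * (u i j * u k j))"
    by (intro sum.cong[OF refl] sum.swap)
  also have "\<dots> = (\<Sum>i\<in>J. \<Sum>k\<in>J. c i * c k * (if i = k then 1 else 0))"
    unfolding sum_distrib_left[symmetric] using assms
    by (intro sum.cong refl) (subst orthonormal, auto)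
  also have "\<dots> = (\<Sum>i\<in>J. (c i)\<^sup>2)"
    using J by (intro sum.cong refl) (simp add: if_distrib power2_eq_square cong: if_cong)
  finally show ?thesis .
qed

lemma exp_combination:
  assumes "J \<subseteq> {1..D}"
  shows "(\<integral>\<^sup>+z. ennreal (exp (\<Sum>i\<in>J. c i * \<epsilon> z i)) \<partial>\<gamma>) = ennreal (exp ((\<Sum>i\<in>J. (c i)\<^sup>2) / 2))"
  unfolding combination_\<epsilon> by (subst nn_integral_gauss_exp_linear) (auto simp: combination_norm[OF assms])

text \<open>Linearising the square by an independent Gaussian vector (Hubbard--Stratonovich) avoids proving
  the rotation invariance of the Gaussian measure.\<close>

lemma exp_square_pos:
  assumes J: "J \<subseteq> {1..D}" and s: "0 \<le> s" "s < 1/2"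
  shows "(\<integral>\<^sup>+z. ennreal (exp (s * (\<Sum>i\<in>J. (\<epsilon> z i)\<^sup>2))) \<partial>\<gamma>) = ennreal (((1 - 2 * s) powr (- 1/2)) ^ card J)"
proof -
  have fin: "finite J" using J finite_subset by blast
  interpret pair_sigma_finite "\<gamma>" "gauss J" by (rule pair_sigma_finite_gauss)
  have "(\<integral>\<^sup>+z. ennreal (exp (s * (\<Sum>i\<in>J. (\<epsilon> z i)\<^sup>2))) \<partial>\<gamma>)
      = (\<integral>\<^sup>+z. (\<integral>\<^sup>+w. ennreal (exp (\<Sum>i\<in>J. (sqrt (2 * s) * \<epsilon> z i) * w i)) \<partial>gauss J) \<partial>\<gamma>)"
    using fin s by (subst nn_integral_gauss_exp_linear) (auto simp: power_mult_distrib sum_distrib_left sum_divide_distrib sum_negf)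
  also have "\<dots> = (\<integral>\<^sup>+w. (\<integral>\<^sup>+z. ennreal (exp (\<Sum>i\<in>J. (sqrt (2 * s) * \<epsilon> z i) * w i)) \<partial>\<gamma>) \<partial>gauss J)"
    unfolding \<epsilon>_def by (rule Fubini'[symmetric]) (measurable; simp)
  also have "\<dots> = (\<integral>\<^sup>+w. (\<integral>\<^sup>+z. ennreal (exp (\<Sum>i\<in>J. (sqrt (2 * s) * w i) * \<epsilon> z i)) \<partial>\<gamma>) \<partial>gauss J)"
    by (simp add: mult_ac)
  also have "\<dots> = (\<integral>\<^sup>+w. ennreal (exp (s * (\<Sum>i\<in>J. (w i)\<^sup>2))) \<partial>gauss J)"
    using s by (subst exp_combination[OF J]) (simp add: power_mult_distrib sum_distrib_left sum_divide_distrib sum_negf)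
  also have "\<dots> = ennreal (((1 - 2 * s) powr (- 1/2)) ^ card J)"
    by (rule nn_integral_gauss_exp_square[OF fin s(2)])
  finally show ?thesis .
qed

lemma iexp_combination:
  assumes "J \<subseteq> {1..D}"
  shows "(\<integral>z. exp (\<i> * complex_of_real (\<Sum>i\<in>J. c i * \<epsilon> z i)) \<partial>\<gamma>)
    = complex_of_real (exp (- (\<Sum>i\<in>J. (c i)\<^sup>2) / 2))"
  unfolding combination_\<epsilon> by (subst integral_gauss_iexp) (auto simp: combination_norm[OF assms])

text \<open>For a negative exponent the linearisation requires an imaginary parameter, so Fubini is
  applied to bounded complex integrands. Exchanging the integrals shows that the squared
  coefficients have the same Laplace transform as independent squares.\<close>

lemma exp_square_neg:
  assumes J: "J \<subseteq> {1..D}" and s: "0 \<le> s"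
  shows "(\<integral>\<^sup>+z. ennreal (exp (- s * (\<Sum>i\<in>J. (\<epsilon> z i)\<^sup>2))) \<partial>\<gamma>) = ennreal (((1 + 2 * s) powr (- 1/2)) ^ card J)"
proof -
  have fin: "finite J" using J finite_subset by blast
  interpret pair_sigma_finite "\<gamma>" "gauss J" by (rule pair_sigma_finite_gauss)
  interpret G: prob_space "\<gamma>" by (rule prob_space_gauss)
  interpret GJ: prob_space "gauss J" by (rule prob_space_gauss)
  interpret P: prob_space "\<gamma> \<Otimes>\<^sub>M gauss J" by (rule prob_space_pair) (rule prob_space_gauss)+
  have int: "integrable \<gamma> (\<lambda>z. exp (- s * (\<Sum>i\<in>J. (\<epsilon> z i)\<^sup>2)))"
    using s by (intro G.integrable_const_bound[where B=1]) (auto intro!: mult_nonneg_nonneg sum_nonneg)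
  have intJ: "integrable (gauss J) (\<lambda>w. exp (- s * (\<Sum>i\<in>J. (w i)\<^sup>2)))"
    using s by (intro GJ.integrable_const_bound[where B=1]) (auto intro!: mult_nonneg_nonneg sum_nonneg)
  have meas: "(\<lambda>(z, w). exp (\<i> * complex_of_real (\<Sum>i\<in>J. (sqrt (2 * s) * \<epsilon> z i) * w i)))
      \<in> borel_measurable (\<gamma> \<Otimes>\<^sub>M gauss J)"
    unfolding \<epsilon>_def by (measurable; simp)
  have intP: "integrable (\<gamma> \<Otimes>\<^sub>M gauss J)
     (\<lambda>(z, w). exp (\<i> * complex_of_real (\<Sum>i\<in>J. (sqrt (2 * s) * \<epsilon> z i) * w i)))"
    by (rule P.integrable_const_bound[where B=1, OF _ meas]) (auto simp: norm_exp_i_times simp del: of_real_sum of_real_mult)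
  have "complex_of_real (\<integral>z. exp (- s * (\<Sum>i\<in>J. (\<epsilon> z i)\<^sup>2)) \<partial>\<gamma>)
      = (\<integral>z. complex_of_real (exp (- s * (\<Sum>i\<in>J. (\<epsilon> z i)\<^sup>2))) \<partial>\<gamma>)"
    by simp
  also have "\<dots> = (\<integral>z. (\<integral>w. exp (\<i> * complex_of_real (\<Sum>i\<in>J. (sqrt (2 * s) * \<epsilon> z i) * w i)) \<partial>gauss J) \<partial>\<gamma>)"
    using fin s by (subst integral_gauss_iexp) (auto simp: power_mult_distrib sum_distrib_left sum_divide_distrib sum_negf)
  also have "\<dots> = (\<integral>w. (\<integral>z. exp (\<i> * complex_of_real (\<Sum>i\<in>J. (sqrt (2 * s) * \<epsilon> z i) * w i)) \<partial>\<gamma>) \<partial>gauss J)"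
    by (rule Fubini_integral[OF intP, symmetric])
  also have "\<dots> = (\<integral>w. (\<integral>z. exp (\<i> * complex_of_real (\<Sum>i\<in>J. (sqrt (2 * s) * w i) * \<epsilon> z i)) \<partial>\<gamma>) \<partial>gauss J)"
    by (simp add: mult_ac)
  also have "\<dots> = (\<integral>w. complex_of_real (exp (- s * (\<Sum>i\<in>J. (w i)\<^sup>2))) \<partial>gauss J)"
    using s by (subst iexp_combination[OF J]) (simp add: power_mult_distrib sum_distrib_left sum_divide_distrib sum_negf)
  also have "\<dots> = complex_of_real (\<integral>w. exp (- s * (\<Sum>i\<in>J. (w i)\<^sup>2)) \<partial>gauss J)"
    by simp
  finally have eq: "(\<integral>z. exp (- s * (\<Sum>i\<in>J. (\<epsilon> z i)\<^sup>2)) \<partial>\<gamma>) = (\<integral>w. exp (- s * (\<Sum>i\<in>J. (w i)\<^sup>2)) \<partial>gauss J)"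
    by (rule of_real_eq_iff[THEN iffD1])
  have "(\<integral>\<^sup>+z. ennreal (exp (- s * (\<Sum>i\<in>J. (\<epsilon> z i)\<^sup>2))) \<partial>\<gamma>)
      = ennreal (\<integral>z. exp (- s * (\<Sum>i\<in>J. (\<epsilon> z i)\<^sup>2)) \<partial>\<gamma>)"
    using int by (rule nn_integral_eq_integral) simp
  also have "\<dots> = (\<integral>\<^sup>+w. ennreal (exp (- s * (\<Sum>i\<in>J. (w i)\<^sup>2))) \<partial>gauss J)"
    unfolding eq using intJ by (rule nn_integral_eq_integral[symmetric]) simp
  also have "\<dots> = ennreal (((1 + 2 * s) powr (- 1/2)) ^ card J)"
    using nn_integral_gauss_exp_square[OF fin, of "- s"] s by simp
  finally show ?thesis .
qed

text \<open>The characteristic function identifies the law of a single coefficient as standard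
  normal, which has no atoms. This is what makes the observation generic almost surely.\<close>

lemma AE_\<epsilon>_neq:
  assumes i: "i \<in> {1..D}"
  shows "AE z in \<gamma>. \<epsilon> z i \<noteq> t"
proof -
  interpret G: prob_space "\<gamma>" by (rule prob_space_gauss)
  have eq: "distr \<gamma> borel (\<lambda>z. \<epsilon> z i) = std_normal_distribution"
  proof (rule Levy_uniqueness)
    show "real_distribution (distr \<gamma> borel (\<lambda>z. \<epsilon> z i))"
      by (simp add: G.real_distribution_distr)
    show "real_distribution std_normal_distribution" by (rule real_dist_normal_dist)
    show "char (distr \<gamma> borel (\<lambda>z. \<epsilon> z i)) = char std_normal_distribution"
    proof
      fix c
      have "char (distr \<gamma> borel (\<lambda>z. \<epsilon> z i)) c = (\<integral>z. exp (\<i> * complex_of_real (\<Sum>k\<in>{i}. c * \<epsilon> z k)) \<partial>\<gamma>)"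
        by (simp add: char_def integral_distr)
      also have "\<dots> = complex_of_real (exp (- (\<Sum>k\<in>{i}. c\<^sup>2) / 2))"
        using i by (intro iexp_combination) auto
      also have "\<dots> = char std_normal_distribution c" by (simp add: char_std_normal_distribution)
      finally show "char (distr \<gamma> borel (\<lambda>z. \<epsilon> z i)) c = char std_normal_distribution c" .
    qed
  qed
  have "AE x in std_normal_distribution. x \<noteq> t"
    using AE_lborel_singleton[of t] by (subst AE_density) auto
  then have "AE x in distr \<gamma> borel (\<lambda>z. \<epsilon> z i). x \<noteq> t" unfolding eq .
  then show ?thesis by (subst (asm) AE_distr_iff) auto
qed

text \<open>The corrections \<open>4 * s\<^sup>2\<close> and \<open>2 * s\<^sup>2\<close> come from
  elementary bounds on \<open>ln (1 - 2 * s)\<close> and \<open>ln (1 + 2 * s)\<close>. The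
  parameter \<open>s\<close> stays free: the total energy needs a small one, the partial sums use
  \<open>1/4\<close>.\<close>

lemma
  assumes J: "J \<subseteq> {1..D}"
  shows chi_square_upper: "\<lbrakk>0 \<le> s; s \<le> 1/4\<rbrakk> \<Longrightarrow>
      measure \<gamma> {z \<in> space \<gamma>. (\<Sum>i\<in>J. (\<epsilon> z i)\<^sup>2) * s > t} \<le> exp (- t + real (card J) * (s + 4 * s\<^sup>2))"
    and chi_square_lower: "\<lbrakk>0 \<le> s; s \<le> 1/2\<rbrakk> \<Longrightarrow>
      measure \<gamma> {z \<in> space \<gamma>. - (\<Sum>i\<in>J. (\<epsilon> z i)\<^sup>2) * s > t} \<le> exp (- t - real (card J) * (s - 2 * s\<^sup>2))"
proof -
  assume s: "0 \<le> s" "s \<le> 1/4"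
  have "(1 - 2 * s) powr (- 1/2) \<le> exp (s + 4 * s\<^sup>2)"
    using ln_one_minus_pos_lower_bound[of "2 * s"] s by (simp add: powr_def power2_eq_square)
  then have "((1 - 2 * s) powr (- 1/2)) ^ card J \<le> exp (real (card J) * (s + 4 * s\<^sup>2))"
    by (subst exp_of_nat_mult) (intro power_mono, auto)
  then have "measure \<gamma> {z \<in> space \<gamma>. (\<Sum>i\<in>J. (\<epsilon> z i)\<^sup>2) * s > t} \<le> exp (- t) * exp (real (card J) * (s + 4 * s\<^sup>2))"
    using exp_square_pos[OF J s(1)] s
    by (intro gauss_tail) (auto simp: mult.commute intro!: ennreal_leI)
  then show "measure \<gamma> {z \<in> space \<gamma>. (\<Sum>i\<in>J. (\<epsilon> z i)\<^sup>2) * s > t} \<le> exp (- t + real (card J) * (s + 4 * s\<^sup>2))"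
    by (simp add: exp_add[symmetric])
next
  assume s: "0 \<le> s" "s \<le> 1/2"
  have "(1 + 2 * s) powr (- 1/2) \<le> exp (- (s - 2 * s\<^sup>2))"
    using ln_one_plus_pos_lower_bound[of "2 * s"] s by (simp add: powr_def power2_eq_square)
  then have "((1 + 2 * s) powr (- 1/2)) ^ card J \<le> exp (real (card J) * - (s - 2 * s\<^sup>2))"
    by (subst exp_of_nat_mult) (intro power_mono, auto)
  then have "measure \<gamma> {z \<in> space \<gamma>. - (\<Sum>i\<in>J. (\<epsilon> z i)\<^sup>2) * s > t} \<le> exp (- t) * exp (real (card J) * - (s - 2 * s\<^sup>2))"
    using exp_square_neg[OF J s(1)] s
    by (intro gauss_tail) (auto simp: mult.commute intro!: ennreal_leI)
  then show "measure \<gamma> {z \<in> space \<gamma>. - (\<Sum>i\<in>J. (\<epsilon> z i)\<^sup>2) * s > t} \<le> exp (- t - real (card J) * (s - 2 * s\<^sup>2))"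
    by (simp add: exp_add[symmetric] algebra_simps)
qed

text \<open>At the exponential scale \<open>1 / (4 * \<delta>\<^sup>2)\<close> the logarithm of the
  moment equals the scaled allowance, one eighth of the signal energy. It cancels, and the
  probability depends on \<open>a\<close> only, whatever the signal.\<close>

lemma cross_tail:
  assumes J: "J \<subseteq> {1..D}" and \<delta>: "\<delta> > 0" and \<sigma>: "\<bar>\<sigma>\<bar> = 1"
  shows "measure \<gamma> {z \<in> space \<gamma>. \<sigma> * (\<Sum>i\<in>J. g i * (\<delta> * \<epsilon> z i)) > (\<Sum>i\<in>J. (g i)\<^sup>2) / 8 + \<delta>\<^sup>2 * a} \<le> exp (- a / 4)"
proof -
  define G where "G = (\<Sum>i\<in>J. (g i)\<^sup>2)"
  have \<sigma>2: "\<sigma>\<^sup>2 = 1" using \<sigma> by (simp add: abs_square_eq_1)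
  have eq: "(\<Sum>i\<in>J. (\<sigma> * g i / (4 * \<delta>)) * \<epsilon> z i) = \<sigma> * (\<Sum>i\<in>J. g i * (\<delta> * \<epsilon> z i)) / (4 * \<delta>\<^sup>2)" for z
    using \<delta> by (simp add: sum_distrib_left sum_divide_distrib power2_eq_square mult_ac)
  have "(\<Sum>i\<in>J. (\<sigma> * g i / (4 * \<delta>))\<^sup>2) / 2 = G / (32 * \<delta>\<^sup>2)"
    by (simp add: G_def power_divide power_mult_distrib \<sigma>2 sum_divide_distrib)
  then have "measure \<gamma> {z \<in> space \<gamma>. (\<Sum>i\<in>J. (\<sigma> * g i / (4 * \<delta>)) * \<epsilon> z i) > G / (32 * \<delta>\<^sup>2) + a / 4}
      \<le> exp (- (G / (32 * \<delta>\<^sup>2) + a / 4)) * exp (G / (32 * \<delta>\<^sup>2))"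
    by (intro gauss_tail) (auto simp del: times_divide_eq_left simp: exp_combination[OF J])
  also have "\<dots> = exp (- a / 4)" by (simp flip: exp_add)
  also have "{z \<in> space \<gamma>. (\<Sum>i\<in>J. (\<sigma> * g i / (4 * \<delta>)) * \<epsilon> z i) > G / (32 * \<delta>\<^sup>2) + a / 4}
     = {z \<in> space \<gamma>. \<sigma> * (\<Sum>i\<in>J. g i * (\<delta> * \<epsilon> z i)) > G / 8 + \<delta>\<^sup>2 * a}"
  proof -
    have "G / (32 * \<delta>\<^sup>2) + a / 4 = (G / 8 + \<delta>\<^sup>2 * a) / (4 * \<delta>\<^sup>2)" using \<delta> by (simp add: add_divide_distrib)
    then show ?thesis unfolding eq using \<delta> by (simp add: divide_less_cancel)
  qed
  finally show ?thesis by (simp add: G_def)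
qed

text \<open>Six bad events of probability at most \<open>exp (- \<zeta>)\<close> each: too much or
  too little total energy, and four unions over \<open>j\<close>. Within the unions the slack grows
  with the mean or with the signal energy, so each member has probability at most
  \<open>exp (- a / 4)\<close>.\<close>

lemma noise_event:
  fixes g :: "nat \<Rightarrow> real"
  assumes \<delta>: "\<delta> > 0" and z: "\<zeta> \<ge> 1" and a: "a \<ge> 10 * (sqrt (real D) * sqrt \<zeta> + \<zeta>)"
  shows "\<exists>Bad. Bad \<in> sets \<gamma> \<and> measure \<gamma> Bad \<le> 6 * exp (- \<zeta>) \<and>
    (\<forall>z \<in> space \<gamma> - Bad.
      \<bar>(\<Sum>i=1..D. (\<epsilon> z i)\<^sup>2) - real D\<bar> \<le> a \<and>
      (\<forall>j. 1 \<le> j \<and> j \<le> D \<longrightarrow> real j / 2 - a \<le> (\<Sum>i=1..j. (\<epsilon> z i)\<^sup>2) \<and>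
        (\<Sum>i=1..j. (\<epsilon> z i)\<^sup>2) \<le> 2 * real j + a \<and>
        \<bar>\<Sum>i=j..D. g i * (\<delta> * \<epsilon> z i)\<bar> \<le> (\<Sum>i=j..D. (g i)\<^sup>2) / 8 + \<delta>\<^sup>2 * a))"
proof -
  interpret G: prob_space "\<gamma>" by (rule prob_space_gauss)
  define W where "W j z = (\<Sum>i=1..j. (\<epsilon> z i)\<^sup>2)" for j z
  define T where "T j z = (\<Sum>i=j..D. g i * (\<delta> * \<epsilon> z i))" for j z
  define Q where "Q j = (\<Sum>i=j..D. (g i)\<^sup>2) / 8 + \<delta>\<^sup>2 * a" for j
  have [measurable]: "W j \<in> borel_measurable \<gamma>" "T j \<in> borel_measurable \<gamma>" for j
    unfolding W_def T_def by measurable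
  define A1 where "A1 = {z \<in> space \<gamma>. W D z > real D + a}"
  define A2 where "A2 = {z \<in> space \<gamma>. W D z < real D - a}"
  define B1 where "B1 j = {z \<in> space \<gamma>. W j z > 2 * real j + a}" for j
  define B2 where "B2 j = {z \<in> space \<gamma>. W j z < real j / 2 - a}" for j
  define B3 where "B3 j = {z \<in> space \<gamma>. 1 * T j z > Q j}" for j
  define B4 where "B4 j = {z \<in> space \<gamma>. - 1 * T j z > Q j}" for j
  have sets [measurable]: "A1 \<in> sets \<gamma>" "A2 \<in> sets \<gamma>" "B1 j \<in> sets \<gamma>" "B2 j \<in> sets \<gamma>" "B3 j \<in> sets \<gamma>" "B4 j \<in> sets \<gamma>" for j
    unfolding A1_def A2_def B1_def B2_def B3_def B4_def by measurable
  \<comment> \<open>The order of the optimal Chernoff parameter for a deviation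
    \<open>sqrt (D * \<zeta>)\<close>. The cap \<open>1/4\<close> is the range of
    \<open>chi_square_upper\<close> and takes over when \<open>\<zeta> \<ge> D\<close>.\<close>
  define s where "s = min 1 (sqrt (\<zeta> / real D)) / 4"
  have s: "0 \<le> s" "s \<le> 1/4" using z by (auto simp: s_def)
  have main: "\<zeta> \<le> s * a - real D * (4 * s\<^sup>2)"
  proof (cases "\<zeta> \<ge> real D")
    case True
    have s4: "s = 1/4" using True D1 by (simp add: s_def min_def)
    have "0 \<le> sqrt (real D) * sqrt \<zeta>" using z by simp
    then have "10 * \<zeta> \<le> a" using a by (simp add: algebra_simps)
    then show ?thesis using True z unfolding s4 by (simp add: power2_eq_square)
  next
    case False
    then have "sqrt (\<zeta> / real D) \<le> 1" using D1 by simp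
    then have s': "s = sqrt (\<zeta> / real D) / 4" by (simp add: s_def min_def)
    have "s * (sqrt (real D) * sqrt \<zeta>) = \<zeta> / 4"
      using D1 z by (simp add: s' real_sqrt_divide)
    moreover have "real D * (4 * s\<^sup>2) = \<zeta> / 4" using D1 z by (simp add: s' power_divide)
    moreover have "s * (10 * (sqrt (real D) * sqrt \<zeta> + \<zeta>)) \<le> s * a" using a s by (intro mult_left_mono)
    moreover have "0 \<le> s * \<zeta>" using s z by simp
    ultimately show ?thesis using z by (simp add: algebra_simps)
  qed
  have spos: "s > 0" using z D1 by (simp add: s_def)
  have "A1 = {z \<in> space \<gamma>. (\<Sum>i=1..D. (\<epsilon> z i)\<^sup>2) * s > s * (real D + a)}"
    using spos by (simp add: A1_def W_def mult.commute)
  also have "measure \<gamma> \<dots> \<le> exp (- (s * (real D + a)) + real (card {1..D}) * (s + 4 * s\<^sup>2))"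
    using s by (intro chi_square_upper) auto
  also have "\<dots> \<le> exp (- \<zeta>)" using main by (simp add: algebra_simps)
  finally have A1: "measure \<gamma> A1 \<le> exp (- \<zeta>)" .
  have "A2 = {z \<in> space \<gamma>. - (\<Sum>i=1..D. (\<epsilon> z i)\<^sup>2) * s > s * (a - real D)}"
  proof -
    have "v < real D - a \<longleftrightarrow> s * (a - real D) < - v * s" for v
      using spos mult_less_cancel_left_pos[OF spos, of "a - real D" "- v"] by (auto simp: mult.commute)
    then show ?thesis by (simp add: A2_def W_def)
  qed
  also have "measure \<gamma> \<dots> \<le> exp (- (s * (a - real D)) - real (card {1..D}) * (s - 2 * s\<^sup>2))"
    using s by (intro chi_square_lower) auto
  also have "\<dots> \<le> exp (- \<zeta>)"
  proof -
    have "real D * (2 * s\<^sup>2) \<le> real D * (4 * s\<^sup>2)" by (intro mult_left_mono) auto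
    moreover have "- (s * (a - real D)) - real D * (s - 2 * s\<^sup>2) = - (s * a) + real D * (2 * s\<^sup>2)"
      by (simp add: algebra_simps)
    ultimately have "- (s * (a - real D)) - real D * (s - 2 * s\<^sup>2) \<le> - \<zeta>" using main by linarith
    then show ?thesis by simp
  qed
  finally have A2: "measure \<gamma> A2 \<le> exp (- \<zeta>)" .
  have B1: "measure \<gamma> (B1 j) \<le> exp (- a / 4)" if j: "j \<in> {1..D}" for j
  proof -
    have "B1 j = {z \<in> space \<gamma>. (\<Sum>i=1..j. (\<epsilon> z i)\<^sup>2) * (1/4) > (2 * real j + a) / 4}"
      by (auto simp: B1_def W_def)
    also have "measure \<gamma> \<dots> \<le> exp (- ((2 * real j + a) / 4) + real (card {1..j}) * (1/4 + 4 * (1/4)\<^sup>2))"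
      using j by (intro chi_square_upper) auto
    also have "\<dots> \<le> exp (- a / 4)" by (simp add: power2_eq_square field_simps)
    finally show ?thesis .
  qed
  have B2: "measure \<gamma> (B2 j) \<le> exp (- a / 4)" if j: "j \<in> {1..D}" for j
  proof -
    have "B2 j = {z \<in> space \<gamma>. - (\<Sum>i=1..j. (\<epsilon> z i)\<^sup>2) * (1/4) > (a - real j / 2) / 4}"
      by (auto simp: B2_def W_def)
    also have "measure \<gamma> \<dots> \<le> exp (- ((a - real j / 2) / 4) - real (card {1..j}) * (1/4 - 2 * (1/4)\<^sup>2))"
      using j by (intro chi_square_lower) auto
    also have "\<dots> \<le> exp (- a / 4)" by (simp add: power2_eq_square field_simps)
    finally show ?thesis .
  qed
  have B3: "measure \<gamma> (B3 j) \<le> exp (- a / 4)" and B4: "measure \<gamma> (B4 j) \<le> exp (- a / 4)" if j: "j \<in> {1..D}" for j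
    unfolding B3_def B4_def T_def Q_def using j \<delta> by (intro cross_tail; simp)+
  \<comment> \<open>The union over \<open>j\<close> costs \<open>ln D\<close>, which is at most
    \<open>2 * sqrt D\<close> and hence absorbed by \<open>a / 4\<close>.\<close>
  have "ln (real D) = 2 * ln (sqrt (real D))" using D1 by (simp add: ln_sqrt)
  also have "\<dots> \<le> 2 * (sqrt (real D) - 1)" using D1 by (intro mult_left_mono ln_le_minus_one) auto
  finally have lnD: "ln (real D) \<le> 2 * sqrt (real D)" by simp
  have "sqrt (real D) * 1 \<le> sqrt (real D) * sqrt \<zeta>" using z by (intro mult_left_mono) auto
  then have "ln (real D) + \<zeta> \<le> a / 4" 
    using lnD a z real_sqrt_ge_zero[of "real D"] unfolding distrib_left by linarith
  then have "exp (ln (real D) + - a / 4) \<le> exp (- \<zeta>)" by simp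
  then have Dexp: "real D * exp (- a / 4) \<le> exp (- \<zeta>)" using D1 unfolding exp_add by simp
  have union: "measure \<gamma> (\<Union>j\<in>{1..D}. B j) \<le> exp (- \<zeta>)"
    if "\<And>j. B j \<in> sets \<gamma>" "\<And>j. j \<in> {1..D} \<Longrightarrow> measure \<gamma> (B j) \<le> exp (- a / 4)" for B
  proof -
    have "measure \<gamma> (\<Union>j\<in>{1..D}. B j) \<le> (\<Sum>j\<in>{1..D}. measure \<gamma> (B j))"
      using that by (intro G.finite_measure_subadditive_finite) auto
    also have "\<dots> \<le> (\<Sum>j\<in>{1..D}. exp (- a / 4))" using that by (intro sum_mono) auto
    also have "\<dots> \<le> exp (- \<zeta>)" using Dexp by simp
    finally show ?thesis .
  qed
  define U where "U B = (\<Union>j\<in>{1..D}. B j)" for B :: "nat \<Rightarrow> (nat \<Rightarrow> real) set"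
  have [measurable]: "U B1 \<in> sets \<gamma>" "U B2 \<in> sets \<gamma>" "U B3 \<in> sets \<gamma>" "U B4 \<in> sets \<gamma>"
    unfolding U_def by auto
  define Bad where "Bad = A1 \<union> (A2 \<union> (U B1 \<union> (U B2 \<union> (U B3 \<union> U B4))))"
  have un: "measure \<gamma> (A \<union> B) \<le> v + w" if "A \<in> sets \<gamma>" "B \<in> sets \<gamma>" "measure \<gamma> A \<le> v" "measure \<gamma> B \<le> w" for A B v w
    using measure_Un_le[OF that(1,2)] that(3,4) by linarith
  have "measure \<gamma> Bad \<le> exp (- \<zeta>) + (exp (- \<zeta>) + (exp (- \<zeta>) + (exp (- \<zeta>) + (exp (- \<zeta>) + exp (- \<zeta>)))))"
    unfolding Bad_def
    by (intro un A1 A2 union[OF _ B1, folded U_def] union[OF _ B2, folded U_def]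
        union[OF _ B3, folded U_def] union[OF _ B4, folded U_def]; measurable)
  then have m: "measure \<gamma> Bad \<le> 6 * exp (- \<zeta>)" by simp
  have good: "\<bar>W D z - real D\<bar> \<le> a \<and>
      (\<forall>j. 1 \<le> j \<and> j \<le> D \<longrightarrow> real j / 2 - a \<le> W j z \<and> W j z \<le> 2 * real j + a \<and> \<bar>T j z\<bar> \<le> Q j)"
    if "z \<in> space \<gamma> - Bad" for z
  proof (intro conjI allI impI)
    show "\<bar>W D z - real D\<bar> \<le> a" using that by (auto simp: Bad_def A1_def A2_def)
    fix j assume "1 \<le> j \<and> j \<le> D"
    then have "z \<notin> B1 j" "z \<notin> B2 j" "z \<notin> B3 j" "z \<notin> B4 j" using that by (auto simp: Bad_def U_def)
    then show "real j / 2 - a \<le> W j z" "W j z \<le> 2 * real j + a" "\<bar>T j z\<bar> \<le> Q j"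
      using that by (auto simp: B1_def B2_def B3_def B4_def)
  qed
  have "Bad \<in> sets \<gamma>" unfolding Bad_def by measurable
  then show ?thesis using m good by (intro exI[of _ Bad]) (simp add: W_def T_def Q_def)
qed

end

section \<open>Reduction to singular coordinates\<close>

locale svd_model =
  fixes D P :: nat and A :: "real mat" and lam :: "nat \<Rightarrow> real" and u v :: "nat \<Rightarrow> real vec"
  assumes model: "model D P A lam u v"
begin

lemma dims: "3 \<le> D" "D \<le> P" "A \<in> carrier_mat D P" "dim_row A = D" "dim_col A = P"
  and svd: "is_svd A lam u v"
  using model by (auto simp: model_def)

lemma
  assumes "i \<in> {1..D}"
  shows lam_pos: "lam i > 0"
    and u_carrier: "u i \<in> carrier_vec D" and v_carrier: "v i \<in> carrier_vec P"
    and A_v: "A *\<^sub>v v i = lam i \<cdot>\<^sub>v u i" and At_u: "transpose_mat A *\<^sub>v u i = lam i \<cdot>\<^sub>v v i"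
  using svd assms by (auto simp: is_svd_def dims)

lemma
  assumes "i \<in> {1..D}" "j \<in> {1..D}"
  shows u_orth: "u i \<bullet> u j = (if i = j then 1 else 0)"
    and v_orth: "v i \<bullet> v j = (if i = j then 1 else 0)"
    and lam_anti: "i \<le> j \<Longrightarrow> lam j \<le> lam i"
  using svd assms by (auto simp: is_svd_def dims)

lemma scalar_prod_lessThan: "w \<in> carrier_vec n \<Longrightarrow> w' \<bullet> w = (\<Sum>j<n. w' $ j * w $ j)"
  by (auto simp: scalar_prod_def atLeast0LessThan)

text \<open>Orthonormality says that the square matrix with rows \<open>u i\<close> has its
  transpose as right inverse. It is then also a left inverse, which is completeness.\<close>

lemma u_complete:
  assumes "j < D" "k < D"
  shows "(\<Sum>i=1..D. u i $ j * u i $ k) = (if j = k then 1 else 0)"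
proof -
  \<comment> \<open>Matrix rows count from \<open>0\<close>, singular vectors from \<open>1\<close>;
    hence the \<open>Suc\<close>.\<close>
  define U where "U = mat D D (\<lambda>(i, j). u (Suc i) $ j)"
  have U: "U \<in> carrier_mat D D" by (simp add: U_def)
  have "U * transpose_mat U = 1\<^sub>m D"
  proof (rule eq_matI)
    fix i k assume ik: "i < dim_row (1\<^sub>m D :: real mat)" "k < dim_col (1\<^sub>m D :: real mat)"
    have "(U * transpose_mat U) $$ (i, k) = u (Suc i) \<bullet> u (Suc k)"
      using ik u_carrier[of "Suc k"] u_carrier[of "Suc i"]
      by (auto simp: U_def scalar_prod_def intro!: sum.cong)
    then show "(U * transpose_mat U) $$ (i, k) = 1\<^sub>m D $$ (i, k)"
      using ik by (simp add: u_orth)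
  qed (auto simp: U_def)
  then have "transpose_mat U * U = 1\<^sub>m D"
    using U by (intro mat_mult_left_right_inverse[of U D]) auto
  then have "(transpose_mat U * U) $$ (j, k) = (if j = k then 1 else 0)" using assms by simp
  also have "(transpose_mat U * U) $$ (j, k) = (\<Sum>i<D. u (Suc i) $ j * u (Suc i) $ k)"
    using assms by (auto simp: U_def scalar_prod_def atLeast0LessThan intro!: sum.cong)
  also have "\<dots> = (\<Sum>i=1..D. u i $ j * u i $ k)"
    by (rule sum.reindex_bij_witness[where i="\<lambda>i. i - 1" and j=Suc]) auto
  finally show ?thesis .
qed

lemma u_parseval:
  assumes w: "w \<in> carrier_vec D" "w' \<in> carrier_vec D"
  shows "w \<bullet> w' = (\<Sum>i=1..D. (w \<bullet> u i) * (w' \<bullet> u i))"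
proof -
  have "(\<Sum>i=1..D. (w \<bullet> u i) * (w' \<bullet> u i))
      = (\<Sum>i=1..D. \<Sum>j<D. \<Sum>k<D. (w $ j * w' $ k) * (u i $ j * u i $ k))"
  proof (intro sum.cong refl)
    fix i assume "i \<in> {1..D}"
    then show "(w \<bullet> u i) * (w' \<bullet> u i) = (\<Sum>j<D. \<Sum>k<D. (w $ j * w' $ k) * (u i $ j * u i $ k))"
      by (simp add: scalar_prod_lessThan[OF u_carrier] sum_product mult_ac)
  qed
  also have "\<dots> = (\<Sum>j<D. \<Sum>i=1..D. \<Sum>k<D. (w $ j * w' $ k) * (u i $ j * u i $ k))"
    by (rule sum.swap)
  also have "\<dots> = (\<Sum>j<D. \<Sum>k<D. (w $ j * w' $ k) * (\<Sum>i=1..D. u i $ j * u i $ k))"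
    unfolding sum_distrib_left by (intro sum.cong refl sum.swap)
  also have "\<dots> = (\<Sum>j<D. w $ j * w' $ j)"
  proof (intro sum.cong refl)
    fix j assume j: "j \<in> {..<D}"
    then have "(\<Sum>k<D. (w $ j * w' $ k) * (\<Sum>i=1..D. u i $ j * u i $ k))
        = (\<Sum>k<D. if j = k then w $ j * w' $ k else 0)"
      by (intro sum.cong refl) (subst u_complete, auto)
    then show "(\<Sum>k<D. (w $ j * w' $ k) * (\<Sum>i=1..D. u i $ j * u i $ k)) = w $ j * w' $ j"
      using j by simp
  qed
  finally show ?thesis using w by (simp add: scalar_prod_lessThan)
qed

lemma u_ext:
  assumes w: "w \<in> carrier_vec D" "w' \<in> carrier_vec D"
    and eq: "\<And>i. i \<in> {1..D} \<Longrightarrow> w \<bullet> u i = w' \<bullet> u i"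
  shows "w = w'"
proof (rule eq_vecI)
  fix j assume j: "j < dim_vec w'"
  then have j: "j < D" using w by simp
  have *: "x $ j = x \<bullet> unit_vec D j" if "x \<in> carrier_vec D" for x :: "real vec"
    using that j by simp
  have "w \<bullet> unit_vec D j = w' \<bullet> unit_vec D j"
    using w eq by (simp add: u_parseval)
  then show "w $ j = w' $ j" using *[OF w(1)] *[OF w(2)] by simp
qed (use w in auto)

definition v_comb :: "(nat \<Rightarrow> real) \<Rightarrow> real vec" where
  "v_comb c = vec P (\<lambda>j. \<Sum>i=1..D. c i * v i $ j)"

lemma v_comb_carrier [simp]: "v_comb c \<in> carrier_vec P"
  by (simp add: v_comb_def)

lemma v_comb_dim [simp]: "dim_vec (v_comb c) = P"
  by (simp add: v_comb_def)

lemma v_comb_scalar: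
  assumes "w \<in> carrier_vec P"
  shows "w \<bullet> v_comb c = (\<Sum>i=1..D. c i * (w \<bullet> v i))"
proof -
  have "w \<bullet> v_comb c = (\<Sum>j<P. \<Sum>i=1..D. w $ j * (c i * v i $ j))"
    by (simp add: scalar_prod_lessThan[OF v_comb_carrier]) (simp add: v_comb_def sum_distrib_left)
  also have "\<dots> = (\<Sum>i=1..D. \<Sum>j<P. w $ j * (c i * v i $ j))"
    by (rule sum.swap)
  also have "\<dots> = (\<Sum>i=1..D. c i * (w \<bullet> v i))"
  proof (intro sum.cong refl)
    fix i assume "i \<in> {1..D}"
    then show "(\<Sum>j<P. w $ j * (c i * v i $ j)) = c i * (w \<bullet> v i)"
      by (simp add: scalar_prod_lessThan[OF v_carrier] sum_distrib_left mult_ac)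
  qed
  finally show ?thesis .
qed

lemma v_comb_coeff:
  assumes "i \<in> {1..D}" shows "v_comb c \<bullet> v i = c i"
proof -
  have "v_comb c \<bullet> v i = v i \<bullet> v_comb c"
    using assms v_carrier by (intro comm_scalar_prod[of _ P]) auto
  also have "\<dots> = (\<Sum>k=1..D. c k * (v i \<bullet> v k))" using assms v_carrier by (intro v_comb_scalar) auto
  also have "\<dots> = (\<Sum>k=1..D. if k = i then c k else 0)"
    using assms by (intro sum.cong refl) (auto simp: v_orth)
  also have "\<dots> = c i" using assms by simp
  finally show ?thesis .
qed

lemma v_comb_norm: "sq_norm (v_comb c) = (\<Sum>i=1..D. (c i)\<^sup>2)"
  by (simp add: v_comb_scalar v_comb_coeff power2_eq_square)

lemma v_comb_diff: "v_comb c - v_comb c' = v_comb (\<lambda>i. c i - c' i)"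
  by (rule eq_vecI) (auto simp: v_comb_def sum_subtractf algebra_simps)

text \<open>Only an inequality, since the \<open>v i\<close> span no more than the row space of
  dimension \<open>D \<le> P\<close>. It follows from expanding the squared distance of
  \<open>w\<close> to its projection \<open>s\<close>.\<close>

lemma v_bessel:
  assumes w: "w \<in> carrier_vec P"
  shows "(\<Sum>i=1..D. (w \<bullet> v i)\<^sup>2) \<le> sq_norm w"
proof -
  define s where "s = v_comb (\<lambda>i. w \<bullet> v i)"
  have s: "s \<in> carrier_vec P" by (simp add: s_def)
  have "0 \<le> (w - s) \<bullet> (w - s)" by (auto simp: scalar_prod_def intro!: sum_nonneg)
  also have "\<dots> = w \<bullet> w - w \<bullet> s - (s \<bullet> w - s \<bullet> s)"
    using w s minus_carrier_vec[OF w s] by (simp add: minus_scalar_prod_distrib[of _ P] scalar_prod_minus_distrib[of _ P])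
  also have "s \<bullet> w = w \<bullet> s" using w s by (rule comm_scalar_prod[of _ P, rotated])
  also have "w \<bullet> s = (\<Sum>i=1..D. (w \<bullet> v i)\<^sup>2)"
    using w by (simp add: s_def v_comb_scalar power2_eq_square)
  also have "s \<bullet> s = (\<Sum>i=1..D. (w \<bullet> v i)\<^sup>2)" by (simp add: s_def v_comb_norm)
  finally show ?thesis by simp
qed

lemma A_scalar_u:
  assumes "f \<in> carrier_vec P" "i \<in> {1..D}"
  shows "(A *\<^sub>v f) \<bullet> u i = lam i * (f \<bullet> v i)"
proof -
  have Af: "A *\<^sub>v f \<in> carrier_vec D" using dims assms by (simp add: mult_mat_vec_carrier)
  have "(A *\<^sub>v f) \<bullet> u i = u i \<bullet> (A *\<^sub>v f)"
    by (rule comm_scalar_prod[OF Af u_carrier[OF assms(2)]])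
  also have "\<dots> = (transpose_mat A *\<^sub>v u i) \<bullet> f"
    by (rule transpose_vec_mult_scalar[OF dims(3) assms(1) u_carrier[OF assms(2)], symmetric])
  also have "\<dots> = lam i * (v i \<bullet> f)" using v_carrier[OF assms(2)] assms by (simp add: At_u)
  also have "v i \<bullet> f = f \<bullet> v i" using v_carrier[OF assms(2)] assms by (intro comm_scalar_prod[of _ P])
  finally show ?thesis .
qed

lemma At_apply:
  assumes b: "b \<in> carrier_vec D"
  shows "transpose_mat A *\<^sub>v b = v_comb (\<lambda>i. lam i * (b \<bullet> u i))"
proof (rule eq_vecI)
  fix j assume "j < dim_vec (v_comb (\<lambda>i. lam i * (b \<bullet> u i)))"
  then have j: "j < P" by simp
  have r: "row (transpose_mat A) j \<in> carrier_vec D" using dims j by (simp add: col_carrier_vec)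
  have "(transpose_mat A *\<^sub>v b) $ j = row (transpose_mat A) j \<bullet> b"
    using j dims by (simp add: mult_mat_vec_def)
  also have "\<dots> = (\<Sum>i=1..D. (row (transpose_mat A) j \<bullet> u i) * (b \<bullet> u i))"
    by (rule u_parseval[OF r b])
  also have "\<dots> = (\<Sum>i=1..D. lam i * (b \<bullet> u i) * v i $ j)"
  proof (intro sum.cong refl)
    fix i assume i: "i \<in> {1..D}"
    have "row (transpose_mat A) j \<bullet> u i = (transpose_mat A *\<^sub>v u i) $ j"
      using j dims by (simp add: mult_mat_vec_def)
    also have "\<dots> = lam i * v i $ j" using At_u[OF i] v_carrier[OF i] j by simp
    finally show "(row (transpose_mat A) j \<bullet> u i) * (b \<bullet> u i) = lam i * (b \<bullet> u i) * v i $ j" by simp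
  qed
  finally show "(transpose_mat A *\<^sub>v b) $ j = v_comb (\<lambda>i. lam i * (b \<bullet> u i)) $ j"
    using j by (simp add: v_comb_def)
qed (use dims in auto)

lemma AAt_scalar_u:
  assumes "b \<in> carrier_vec D" "i \<in> {1..D}"
  shows "(A * transpose_mat A *\<^sub>v b) \<bullet> u i = (lam i)\<^sup>2 * (b \<bullet> u i)"
proof -
  have "A * transpose_mat A *\<^sub>v b = A *\<^sub>v (transpose_mat A *\<^sub>v b)"
    using dims assms by (intro assoc_mult_mat_vec[of _ D P _ D]) auto
  then show ?thesis using assms
    by (simp add: At_apply A_scalar_u v_comb_coeff power2_eq_square)
qed

section \<open>Pseudo-inverse and spectral calculus in singular coordinates\<close>

definition "B = the (mat_inverse (A * transpose_mat A))"

text \<open>The matrix is injective because it multiplies the coefficient along \<open>u i\<close>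
  by \<open>(lam i)\<^sup>2 > 0\<close>. Hence its determinant is nonzero, and the
  \<open>the\<close> in \<open>pinv\<close> selects a genuine inverse.\<close>

lemma B: "B \<in> carrier_mat D D" "A * transpose_mat A * B = 1\<^sub>m D"
proof -
  have C: "A * transpose_mat A \<in> carrier_mat D D" using dims by simp
  have "Determinant.det (A * transpose_mat A) \<noteq> 0"
  proof
    assume "Determinant.det (A * transpose_mat A) = 0"
    then obtain b where b: "b \<in> carrier_vec D" "b \<noteq> 0\<^sub>v D" "A * transpose_mat A *\<^sub>v b = 0\<^sub>v D"
      using det_0_iff_vec_prod_zero[OF C] by auto
    have "b = 0\<^sub>v D"
    proof (rule u_ext)
      fix i assume i: "i \<in> {1..D}"
      have "(lam i)\<^sup>2 * (b \<bullet> u i) = 0"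
        using AAt_scalar_u[OF b(1) i] b(3) u_carrier[OF i] by simp
      then show "b \<bullet> u i = 0\<^sub>v D \<bullet> u i" using lam_pos[OF i] u_carrier[OF i] by simp
    qed (use b in auto)
    with b show False by simp
  qed
  then have "A * transpose_mat A \<in> Units (ring_mat TYPE(real) D ())"
    by (rule det_non_zero_imp_unit[OF C])
  then obtain B' where B': "mat_inverse (A * transpose_mat A) = Some B'"
    using mat_inverse(1)[OF C, of "()"] by (cases "mat_inverse (A * transpose_mat A)") auto
  then show "B \<in> carrier_mat D D" "A * transpose_mat A * B = 1\<^sub>m D"
    using mat_inverse(2)[OF C B'] by (auto simp: B_def)
qed

lemma
  assumes w: "w \<in> carrier_vec D"
  shows pinv_apply: "pinv A *\<^sub>v w = v_comb (\<lambda>i. (w \<bullet> u i) / lam i)"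
    and A_pinv: "A *\<^sub>v (pinv A *\<^sub>v w) = w"
proof -
  define b where "b = B *\<^sub>v w"
  have b: "b \<in> carrier_vec D" using B w by (auto simp: b_def)
  have "A * transpose_mat A *\<^sub>v b = (A * transpose_mat A * B) *\<^sub>v w"
    unfolding b_def using dims B w by (intro assoc_mult_mat_vec[symmetric, of _ D D _ D]) auto
  then have Ab: "A * transpose_mat A *\<^sub>v b = w" using B w by simp
  have p: "pinv A *\<^sub>v w = transpose_mat A *\<^sub>v b"
    unfolding pinv_def b_def B_def[symmetric] using dims B w by (intro assoc_mult_mat_vec[of _ P D _ D]) auto
  have "w \<bullet> u i = (lam i)\<^sup>2 * (b \<bullet> u i)" if "i \<in> {1..D}" for i
    using AAt_scalar_u[OF b that] Ab by simp
  then have "lam i * (b \<bullet> u i) = (w \<bullet> u i) / lam i" if "i \<in> {1..D}" for i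
    using that lam_pos[OF that] by (simp add: power2_eq_square)
  then show "pinv A *\<^sub>v w = v_comb (\<lambda>i. (w \<bullet> u i) / lam i)"
    unfolding p At_apply[OF b] by (simp add: v_comb_def)
  show "A *\<^sub>v (pinv A *\<^sub>v w) = w"
    unfolding p by (rule trans[OF _ Ab], rule assoc_mult_mat_vec[symmetric, of _ D P _ D])
      (use dims b in auto)
qed

lemma min_norm_sol_eq:
  assumes "f \<in> carrier_vec P"
  shows "min_norm_sol A f = v_comb (\<lambda>i. f \<bullet> v i)"
proof -
  have "A *\<^sub>v f \<in> carrier_vec D" using dims assms by (simp add: mult_mat_vec_carrier)
  moreover have "lam i * (f \<bullet> v i) / lam i = f \<bullet> v i" if "i \<in> {1..D}" for i using lam_pos[OF that] by simp
  ultimately show ?thesis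
    using assms by (simp add: min_norm_sol_def pinv_apply v_comb_def A_scalar_u)
qed

lemma spectral_carrier [simp]: "w \<in> carrier_vec D \<Longrightarrow> spectral_apply lam u h w \<in> carrier_vec D"
  by (rule carrier_vecI) (simp add: spectral_apply_def)

lemma spectral_coeff:
  assumes w: "w \<in> carrier_vec D" and i: "i \<in> {1..D}"
  shows "spectral_apply lam u h w \<bullet> u i = h ((lam i)\<^sup>2) * (w \<bullet> u i)"
proof -
  have "spectral_apply lam u h w \<bullet> u i
      = (\<Sum>j<D. (\<Sum>k=1..D. h ((lam k)\<^sup>2) * (w \<bullet> u k) * u k $ j) * u i $ j)"
    unfolding scalar_prod_lessThan[OF u_carrier[OF i]]
    using w by (intro sum.cong refl) (simp add: spectral_apply_def)
  also have "\<dots> = (\<Sum>j<D. \<Sum>k=1..D. h ((lam k)\<^sup>2) * (w \<bullet> u k) * (u k $ j * u i $ j))"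
    unfolding sum_distrib_right by (simp add: mult.assoc)
  also have "\<dots> = (\<Sum>k=1..D. h ((lam k)\<^sup>2) * (w \<bullet> u k) * (u k \<bullet> u i))"
    unfolding scalar_prod_lessThan[OF u_carrier[OF i]] sum_distrib_left by (rule sum.swap)
  also have "\<dots> = (\<Sum>k=1..D. if k = i then h ((lam k)\<^sup>2) * (w \<bullet> u k) else 0)"
    using i by (intro sum.cong refl) (auto simp: u_orth)
  also have "\<dots> = h ((lam i)\<^sup>2) * (w \<bullet> u i)" using i by simp
  finally show ?thesis .
qed

definition "x i = (lam i)\<^sup>2"

lemma x_pos: "i \<in> {1..D} \<Longrightarrow> x i > 0"
  using lam_pos[of i] by (simp add: x_def)

lemma spectral_norm:
  assumes w: "w \<in> carrier_vec D"
  shows "sq_norm (spectral_apply lam u (poly q) w) = sq_residual D x (\<lambda>i. w \<bullet> u i) q"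
  using w by (simp add: u_parseval[of "spectral_apply lam u (poly q) w"] spectral_coeff sq_residual_def x_def power2_eq_square mult_ac)

lemma cg_est_eq:
  assumes Y: "Y \<in> carrier_vec D"
  shows "cg_est A lam u Y t = v_comb (\<lambda>i. (1 - poly (cg_interp lam u Y t) (x i)) * (Y \<bullet> u i) / lam i)"
proof -
  define S where "S = spectral_apply lam u (poly (cg_interp lam u Y t)) Y"
  have S: "S \<in> carrier_vec D" using Y by (simp add: S_def)
  have "(Y - S) \<bullet> u i = (1 - poly (cg_interp lam u Y t) (x i)) * (Y \<bullet> u i)" if "i \<in> {1..D}" for i
    using that Y S u_carrier[OF that]
    by (simp add: minus_scalar_prod_distrib[of _ D] S_def spectral_coeff x_def algebra_simps)
  then show ?thesis
    unfolding cg_est_def S_def[symmetric] using Y S by (simp add: pinv_apply v_comb_def)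
qed

lemma cg_sq_residual_eq:
  assumes Y: "Y \<in> carrier_vec D"
  shows "cg_sq_residual A lam u Y t = sq_residual D x (\<lambda>i. Y \<bullet> u i) (cg_interp lam u Y t)"
proof -
  define S where "S = spectral_apply lam u (poly (cg_interp lam u Y t)) Y"
  have S: "S \<in> carrier_vec D" using Y by (simp add: S_def)
  have "A *\<^sub>v cg_est A lam u Y t - Y = - S"
    unfolding cg_est_def S_def[symmetric] using Y S by (subst A_pinv) (auto intro!: eq_vecI)
  then have "cg_sq_residual A lam u Y t = sq_norm S" using S by (simp add: cg_sq_residual_def)
  then show ?thesis using Y by (simp add: S_def spectral_norm)
qed

text \<open>The observation has a nonzero component in every singular direction; this is slightly stronger
  than the standing assumption and still holds almost surely.\<close>

definition generic :: "real vec \<Rightarrow> bool" where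
  "generic Y \<longleftrightarrow> (\<forall>i\<in>{1..D}. Y \<bullet> u i \<noteq> 0)"

section \<open>Identification of the conjugate gradient estimator\<close>

lemma cg_points:
  assumes "generic Y" shows "cg_points D x (\<lambda>i. Y \<bullet> u i)"
  using assms dims x_pos by unfold_locales (auto simp: generic_def)

lemma num_distinct_eq:
  assumes "generic Y" shows "num_distinct lam D = cg_points.d D x"
proof -
  have "inj_on (\<lambda>t. t\<^sup>2 :: real) (lam ` {1..D})"
    using lam_pos by (auto intro!: inj_onI simp: power2_eq_iff_nonneg less_imp_le)
  then have "card ((\<lambda>t. t\<^sup>2) ` lam ` {1..D}) = card (lam ` {1..D})" by (rule card_image)
  moreover have "(\<lambda>t. t\<^sup>2) ` lam ` {1..D} = x ` {1..D}" by (auto simp: x_def image_image)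
  ultimately show ?thesis
    by (simp add: num_distinct_def cg_points.d_def[OF cg_points[OF assms]])
qed

lemma cg_poly_eq:
  assumes Y: "Y \<in> carrier_vec D" and gen: "generic Y" and k: "k \<le> num_distinct lam D"
  shows "cg_poly lam u Y k = gs_residual D x (\<lambda>i. Y \<bullet> u i) k"
  unfolding cg_poly_def spectral_norm[OF Y]
  using cg_points.r_unique[OF cg_points[OF gen]] k num_distinct_eq[OF gen] by simp

lemma cg_interp_eq:
  assumes Y: "Y \<in> carrier_vec D" and gen: "generic Y" and t: "t \<in> {0..real (num_distinct lam D)}"
  shows "cg_interp lam u Y t
    = cg_points.interp D x (\<lambda>i. Y \<bullet> u i) (nat \<lceil>t\<rceil> - 1) (t - real (nat \<lceil>t\<rceil> - 1))"
proof -
  \<comment> \<open>At \<open>t = 0\<close> the interpolation still mentions iterate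
    \<open>1\<close>, with weight \<open>0\<close>; this bound ensures that this iterate, too, is
    covered by \<open>cg_poly_eq\<close>.\<close>
  have "1 \<le> num_distinct lam D"
    using cg_points.d_pos[OF cg_points[OF gen]] num_distinct_eq[OF gen] by simp
  then have "Suc (nat \<lceil>t\<rceil> - 1) \<le> num_distinct lam D" using t by (auto simp: ceiling_le_iff) linarith
  then show ?thesis
    by (simp add: cg_interp_def Let_def cg_points.interp_def[OF cg_points[OF gen]] cg_poly_eq[OF Y gen])
qed

lemma cg_stopped_est_eq:
  assumes Y: "Y \<in> carrier_vec D" and gen: "generic Y" and \<kappa>: "\<kappa> > 0"
  shows "cg_stopped_est A lam u \<kappa> Y
    = v_comb (\<lambda>i. (1 - poly (stopped_poly D x \<kappa> (\<lambda>i. Y \<bullet> u i)) (x i)) * (Y \<bullet> u i) / lam i)"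
proof -
  interpret cg_points D x "\<lambda>i. Y \<bullet> u i" by (rule cg_points[OF gen])
  have "{t \<in> {0..real (num_distinct lam D)}. cg_sq_residual A lam u Y t \<le> \<kappa>}
      = {t \<in> {0..real d}. residual_at t \<le> \<kappa>}"
    by (auto simp: cg_sq_residual_eq[OF Y] residual_at_def cg_interp_eq[OF Y gen] num_distinct_eq[OF gen])
  then have stop: "cg_stop A lam u \<kappa> Y = Inf {t \<in> {0..real d}. residual_at t \<le> \<kappa>}"
    by (simp add: cg_stop_def dims)
  then have "cg_interp lam u Y (cg_stop A lam u \<kappa> Y) = stopped_poly D x \<kappa> (\<lambda>i. Y \<bullet> u i)"
    using interp_at_Inf[OF \<kappa>] by (subst cg_interp_eq[OF Y gen]) (auto simp: num_distinct_eq[OF gen])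
  then show ?thesis by (simp add: cg_stopped_est_def cg_est_eq[OF Y])
qed

end

section \<open>Upper bounds for the stopped estimator\<close>

text \<open>Transfers measurability from the explicit loss to the loss of the estimator, which is
  unspecified on a null set.\<close>

lemma measurable_completion_AE_eq:
  assumes f: "f \<in> measurable M N" and eq: "AE z in M. f z = g z" and g: "g \<in> space M \<rightarrow> space N"
  shows "g \<in> measurable (completion M) N"
proof (rule measurableI)
  show "z \<in> space (completion M) \<Longrightarrow> g z \<in> space N" for z using g by auto
  fix S assume S: "S \<in> sets N"
  show "g -` S \<inter> space (completion M) \<in> sets (completion M)"
  proof (rule completion.in_sets_AE)
    show "AE z in completion M. z \<in> f -` S \<inter> space M \<longleftrightarrow> z \<in> g -` S \<inter> space (completion M)"
      using AE_completion[OF eq] by eventually_elim auto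
  qed (use S f in auto)
qed

lemma summable_powr_exp_minus:
  fixes q :: real
  assumes "q > 0"
  shows "summable (\<lambda>n. (real n + 1) powr q * exp (- real n))"
proof (rule summable_comparison_test)
  \<comment> \<open>Half of the exponential decay absorbs the power, the other half leaves a
    geometric series.\<close>
  define c where "c = (2 * q) powr q * exp (1/2)"
  show "\<exists>N. \<forall>n\<ge>N. norm ((real n + 1) powr q * exp (- real n)) \<le> c * exp (- 1/2) ^ n"
  proof (intro exI[of _ 0] allI impI)
    fix n :: nat
    have "((real n + 1) / 2) powr q * exp (- ((real n + 1) / 2)) \<le> q powr q"
      using assms by (intro powr_mult_exp_minus_le) auto
    then have "(real n + 1) powr q \<le> (2 * q) powr q * exp ((real n + 1) / 2)"
      using assms by (simp add: powr_divide powr_mult exp_minus field_simps)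
    then have "(real n + 1) powr q * exp (- real n) \<le> (2 * q) powr q * exp ((real n + 1) / 2) * exp (- real n)"
      by (intro mult_right_mono) auto
    also have "\<dots> = (2 * q) powr q * (exp ((real n + 1) / 2) * exp (- real n))" by simp
    also have "exp ((real n + 1) / 2) * exp (- real n) = exp (1/2) * exp (real n * (- 1/2))"
      unfolding exp_add[symmetric] by (simp add: field_simps)
    also have "exp (real n * (- 1/2)) = exp (- 1/2 :: real) ^ n" by (rule exp_of_nat_mult)
    finally show "norm ((real n + 1) powr q * exp (- real n)) \<le> c * exp (- 1/2) ^ n"
      by (simp add: c_def mult.assoc)
  qed
  show "summable (\<lambda>n. c * exp (- 1/2 :: real) ^ n)"
    by (intro summable_mult summable_geometric) auto
qed

definition tail_const :: "real \<Rightarrow> real" where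
  "tail_const q = (\<Sum>n. 6 * ((real n + 1) powr q * exp (- real n)))"

text \<open>Summation over layers at integer \<open>\<zeta>\<close>: a point in its top layer
  satisfies \<open>X z \<le> V * (n + 1) powr q\<close>, and \<open>S n\<close> has mass at most
  \<open>6 * exp (- n)\<close>, which is trivial for \<open>n = 0\<close>.\<close>

lemma nn_integral_le_of_tail:
  fixes X :: "'a \<Rightarrow> real"
  assumes "prob_space M" and X [measurable]: "X \<in> borel_measurable M" and V: "V > 0" and q: "q > 0"
    and tail: "\<And>\<zeta>. \<zeta> \<ge> 1 \<Longrightarrow> measure M {z \<in> space M. X z > V * \<zeta> powr q} \<le> 6 * exp (- \<zeta>)"
  shows "(\<integral>\<^sup>+z. ennreal (X z) \<partial>M) \<le> ennreal (tail_const q * V)"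
proof -
  interpret prob_space M by fact
  define S where "S n = {z \<in> space M. X z > V * real n powr q}" for n
  have [measurable]: "S n \<in> sets M" for n unfolding S_def by measurable
  have S: "measure M (S n) \<le> 6 * exp (- real n)" for n
  proof (cases "n = 0")
    case True
    then show ?thesis using order_trans[OF prob_le_1[of "S n"]] by simp
  next
    case False
    then show ?thesis using tail[of "real n"] by (simp add: S_def)
  qed
  have pw: "ennreal (X z) \<le> (\<Sum>n. ennreal (V * (real n + 1) powr q) * indicator (S n) z)" if z: "z \<in> space M" for z
  proof (cases "X z \<le> 0")
    case False
    have "\<exists>n. X z \<le> V * (real n + 1) powr q"
    proof -
      define t where "t = (X z / V) powr (1 / q)"
      have "t \<le> real (nat \<lceil>t\<rceil>) + 1" by linarith
      then have "t powr q \<le> (real (nat \<lceil>t\<rceil>) + 1) powr q" using q by (intro powr_mono2) (auto simp: t_def)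
      moreover have "t powr q = X z / V" using False V q by (simp add: t_def powr_powr)
      ultimately show ?thesis using V by (intro exI[of _ "nat \<lceil>t\<rceil>"]) (simp add: field_simps)
    qed
    then obtain n where n: "X z \<le> V * (real n + 1) powr q" "\<And>m. m < n \<Longrightarrow> \<not> X z \<le> V * (real m + 1) powr q"
      using exists_least_iff[of "\<lambda>n. X z \<le> V * (real n + 1) powr q"] by blast
    \<comment> \<open>Leastness of \<open>n\<close> gives the lower threshold. For
      \<open>n = 0\<close> the threshold is \<open>V * 0 powr q = 0\<close>, and
      \<open>X z > 0\<close> suffices.\<close>
    have "z \<in> S n"
      using n(2)[of "n - 1"] False z by (cases n) (auto simp: S_def add.commute)
    then have "ennreal (X z) \<le> ennreal (V * (real n + 1) powr q) * indicator (S n) z"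
      using n(1) by (simp add: ennreal_leI)
    also have "\<dots> = sum (\<lambda>k. ennreal (V * (real k + 1) powr q) * indicator (S k) z) {n}"
      by (subst sum.insert) auto
    also have "\<dots> \<le> (\<Sum>n. ennreal (V * (real n + 1) powr q) * indicator (S n) z)"
      by (rule sum_le_suminf) auto
    finally show ?thesis .
  qed (simp add: ennreal_neg)
  have "(\<integral>\<^sup>+z. ennreal (X z) \<partial>M) \<le> (\<integral>\<^sup>+z. (\<Sum>n. ennreal (V * (real n + 1) powr q) * indicator (S n) z) \<partial>M)"
    using pw by (rule nn_integral_mono)
  also have "\<dots> = (\<Sum>n. ennreal (V * (real n + 1) powr q) * emeasure M (S n))"
    by (subst nn_integral_suminf) (auto simp: nn_integral_cmult_indicator)
  also have "\<dots> \<le> (\<Sum>n. ennreal (6 * ((real n + 1) powr q * exp (- real n)) * V))"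
  proof (intro suminf_le)
    fix n
    have "ennreal (V * (real n + 1) powr q) * emeasure M (S n) = ennreal (V * (real n + 1) powr q * measure M (S n))"
      using V by (simp add: emeasure_eq_measure ennreal_mult)
    also have "\<dots> \<le> ennreal (V * (real n + 1) powr q * (6 * exp (- real n)))"
      using V S by (intro ennreal_leI mult_left_mono) auto
    finally show "ennreal (V * (real n + 1) powr q) * emeasure M (S n)
        \<le> ennreal (6 * ((real n + 1) powr q * exp (- real n)) * V)"
      by (simp add: mult_ac)
  qed auto
  also have "\<dots> = ennreal (\<Sum>n. 6 * ((real n + 1) powr q * exp (- real n)) * V)"
    using V summable_powr_exp_minus[OF q] by (intro suminf_ennreal2 summable_mult2 summable_mult) auto
  also have "(\<Sum>n. 6 * ((real n + 1) powr q * exp (- real n)) * V) = tail_const q * V"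
    unfolding tail_const_def
    using summable_powr_exp_minus[OF q] by (intro suminf_mult2[symmetric] summable_mult)
  finally show ?thesis .
qed

lemma tail_const_pos: "q > 0 \<Longrightarrow> tail_const q > 0"
  unfolding tail_const_def using summable_powr_exp_minus
  by (intro suminf_pos summable_mult) auto

text \<open>The defining equation of \<open>filtered_noise.C8\<close> is conditional on the locale assumptions; the maximum
  with \<open>1\<close> makes the constant positive unconditionally.\<close>

definition upper_const :: "real \<Rightarrow> real \<Rightarrow> real \<Rightarrow> real \<Rightarrow> real \<Rightarrow> real \<Rightarrow> real" where
  "upper_const \<mu> p cA CA K C\<kappa> =
     max 1 (filtered_noise.C8 \<mu> p cA CA K) * (2 powr (2 * p + 1) * (10 + C\<kappa>) powr (2 * p + 1))"

definition risk_const :: "real \<Rightarrow> real \<Rightarrow> real \<Rightarrow> real \<Rightarrow> real \<Rightarrow> real \<Rightarrow> real" where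
  "risk_const \<mu> p cA CA K C\<kappa> =
     tail_const (2 * p + 1) * (upper_const \<mu> p cA CA K C\<kappa> * 2 powr (2 * p + 1))"

lemma upper_const_pos:
  assumes "0 \<le> C\<kappa>" shows "upper_const \<mu> p cA CA K C\<kappa> > 0"
proof -
  have "0 < max 1 (filtered_noise.C8 \<mu> p cA CA K)" by simp
  then show ?thesis using assms unfolding upper_const_def by (intro mult_pos_pos) auto
qed

lemma risk_const_pos:
  assumes "p > 0" "0 \<le> C\<kappa>" shows "risk_const \<mu> p cA CA K C\<kappa> > 0"
  unfolding risk_const_def using tail_const_pos upper_const_pos assms by (intro mult_pos_pos) auto

section \<open>The statistical model: probability bound\<close>

locale cg_model = svd_model D P A lam u v
  for D P :: nat and A :: "real mat" and lam :: "nat \<Rightarrow> real" and u v :: "nat \<Rightarrow> real vec" +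
  fixes \<mu> p cA CA K C\<kappa> R \<delta> \<kappa> :: real
  assumes \<mu>: "\<mu> > 0" and p: "p > 1/2" and cA: "cA > 0" and CA: "cA \<le> CA" and K: "K > 0"
    and C\<kappa>: "0 \<le> C\<kappa>"
    and decay: "\<forall>i\<in>{1..D}. cA * real i powr (- p) \<le> lam i \<and> lam i \<le> CA * real i powr (- p)"
    and R: "1 \<le> R" and \<delta>: "0 < \<delta>" "\<delta> < 1"
    and \<kappa>: "0 < \<kappa>" "\<bar>\<kappa> - \<delta>\<^sup>2 * real D\<bar> \<le> C\<kappa> * \<delta>\<^sup>2 * sqrt (real D)"
    and eff_dim_le: "eff_dim \<mu> p R \<delta> \<le> K * real D"
begin

sublocale gauss_basis D "\<lambda>i j. u i $ j"
proof
  show "1 \<le> D" using dims by simp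
  fix i k assume ik: "i \<in> {1..D}" "k \<in> {1..D}"
  show "(\<Sum>j<D. u i $ j * u k $ j) = (if i = k then 1 else 0)"
    using u_orth[OF ik] by (simp add: scalar_prod_lessThan[OF u_carrier[OF ik(2)]])
qed

lemma std_gauss_eq: "std_gauss D = completion \<gamma>"
  by (simp add: std_gauss_def)

definition y :: "real vec \<Rightarrow> (nat \<Rightarrow> real) \<Rightarrow> nat \<Rightarrow> real" where
  "y f z i = obs A f \<delta> z \<bullet> u i"

lemma obs_carrier: "f \<in> carrier_vec P \<Longrightarrow> obs A f \<delta> z \<in> carrier_vec D"
  using dims by (simp add: obs_def mult_mat_vec_carrier)

lemma y_eq:
  assumes f: "f \<in> carrier_vec P" and i: "i \<in> {1..D}"
  shows "y f z i = lam i * (f \<bullet> v i) + \<delta> * \<epsilon> z i"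
proof -
  have "A *\<^sub>v f \<in> carrier_vec D" using dims f by (simp add: mult_mat_vec_carrier)
  then have "y f z i = (A *\<^sub>v f) \<bullet> u i + \<delta> * (Matrix.vec D z \<bullet> u i)"
    unfolding y_def obs_def dims using u_carrier[OF i]
    by (subst add_scalar_prod_distrib[of _ D]) auto
  also have "Matrix.vec D z \<bullet> u i = \<epsilon> z i"
    by (simp add: \<epsilon>_def scalar_prod_lessThan[OF u_carrier[OF i]] mult.commute)
  finally show ?thesis using f i by (simp add: A_scalar_u)
qed

lemma measurable_y [measurable]:
  assumes "f \<in> carrier_vec P" "i \<in> {1..D}"
  shows "(\<lambda>z. y f z i) \<in> borel_measurable \<gamma>"
  unfolding y_eq[OF assms] by measurable

lemma AE_generic:
  assumes f: "f \<in> carrier_vec P"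
  shows "AE z in \<gamma>. generic (obs A f \<delta> z)"
proof -
  have "AE z in \<gamma>. \<forall>i\<in>{1..D}. \<epsilon> z i \<noteq> - lam i * (f \<bullet> v i) / \<delta>"
    using AE_\<epsilon>_neq by (intro AE_finite_allI) auto
  then show ?thesis
  proof eventually_elim
    case (elim z)
    have "y f z i \<noteq> 0" if i: "i \<in> {1..D}" for i
    proof
      assume "y f z i = 0"
      then have "\<delta> * \<epsilon> z i = - lam i * (f \<bullet> v i)" using y_eq[OF f i, of z] by linarith
      then have "\<delta> * \<epsilon> z i / \<delta> = - lam i * (f \<bullet> v i) / \<delta>" by (rule arg_cong)
      then have "\<epsilon> z i = - lam i * (f \<bullet> v i) / \<delta>" using \<delta> by simp
      then show False using elim i by blast
    qed
    then show ?case by (simp add: generic_def y_def)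
  qed
qed

text \<open>The loss in singular coordinates with the explicit stopped polynomial: Borel measurable
  for every signal in \<open>carrier_vec P\<close>, and almost surely equal to
  \<open>rec_loss\<close> of the stopped estimator.\<close>

definition loss :: "real vec \<Rightarrow> (nat \<Rightarrow> real) \<Rightarrow> real" where
  "loss f z = (\<Sum>i=1..D. ((1 - poly (stopped_poly D x \<kappa> (y f z)) (x i)) * y f z i / lam i - f \<bullet> v i)\<^sup>2)"

lemma measurable_loss [measurable]:
  assumes f: "f \<in> carrier_vec P" shows "loss f \<in> borel_measurable \<gamma>"
proof -
  have [measurable]: "(\<lambda>z. poly (stopped_poly D x \<kappa> (y f z)) t) \<in> borel_measurable \<gamma>" for t
    using f by (intro measurable_stopped_poly) auto
  have [measurable]: "(\<lambda>z. y f z i) \<in> borel_measurable \<gamma>" if "i \<in> {1..D}" for i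
    using f that by measurable
  show ?thesis unfolding loss_def by measurable
qed

lemma rec_loss_eq:
  assumes f: "f \<in> carrier_vec P" and gen: "generic (obs A f \<delta> z)"
  shows "rec_loss A \<delta> (cg_stopped_est A lam u \<kappa>) f z = loss f z"
  using cg_stopped_est_eq[OF obs_carrier[OF f] gen \<kappa>(1)] f
  by (simp add: rec_loss_def min_norm_sol_eq v_comb_diff v_comb_norm loss_def y_def[abs_def])

lemma AE_rec_loss_eq:
  assumes f: "f \<in> carrier_vec P"
  shows "AE z in \<gamma>. loss f z = rec_loss A \<delta> (cg_stopped_est A lam u \<kappa>) f z"
  using AE_generic[OF f] by eventually_elim (simp add: rec_loss_eq[OF f])

lemma measurable_rec_loss:
  assumes f: "f \<in> carrier_vec P"
  shows "rec_loss A \<delta> (cg_stopped_est A lam u \<kappa>) f \<in> borel_measurable (completion \<gamma>)"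
  using measurable_loss[OF f] AE_rec_loss_eq[OF f] by (rule measurable_completion_AE_eq) simp

abbreviation "N \<equiv> eff_dim \<mu> p R \<delta>"
abbreviation "C8 \<equiv> filtered_noise.C8 \<mu> p cA CA K"
abbreviation "C9 \<equiv> upper_const \<mu> p cA CA K C\<kappa>"
abbreviation "C10 \<equiv> risk_const \<mu> p cA CA K C\<kappa>"

lemma N_pos: "N > 0"
  using R \<delta> by (intro eff_dim_pos) auto

lemma signals_source:
  assumes "f \<in> signals D P lam v \<mu> R"
  shows "f \<in> carrier_vec P" "(\<Sum>i=1..D. lam i powr (- 4 * \<mu>) * (f \<bullet> v i)\<^sup>2) \<le> R\<^sup>2"
  using assms sqrt_le_D by (auto simp: signals_def source_norm_def)

lemma loss_deterministic:
  assumes f: "f \<in> signals D P lam v \<mu> R" and gen: "generic (obs A f \<delta> z)"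
    and a: "a \<ge> 1" "a \<ge> C\<kappa> * sqrt (real D)"
    and total: "\<bar>(\<Sum>i=1..D. (\<epsilon> z i)\<^sup>2) - real D\<bar> \<le> a"
    and partial: "\<And>j. 1 \<le> j \<Longrightarrow> j \<le> D \<Longrightarrow> real j / 2 - a \<le> (\<Sum>i=1..j. (\<epsilon> z i)\<^sup>2) \<and>
        (\<Sum>i=1..j. (\<epsilon> z i)\<^sup>2) \<le> 2 * real j + a \<and>
        \<bar>\<Sum>i=j..D. (lam i * (f \<bullet> v i)) * (\<delta> * \<epsilon> z i)\<bar> \<le> (\<Sum>i=j..D. (lam i * (f \<bullet> v i))\<^sup>2) / 8 + \<delta>\<^sup>2 * a"
  shows "loss f z \<le> max 1 C8 * (\<delta>\<^sup>2 * (N + a) powr (2 * p + 1))"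
proof -
  note src = signals_source[OF f]
  define q where "q = stopped_poly D x \<kappa> (y f z)"
  interpret C: cg_points D x "y f z"
    using cg_points[OF gen] by (simp add: y_def[abs_def])
  obtain \<rho> \<beta> where \<beta>: "0 \<le> \<beta>" "\<beta> \<le> \<rho>"
    and q1: "\<forall>t. 0 \<le> t \<and> \<beta> * t < 1 \<longrightarrow> 0 \<le> poly q t \<and> poly q t \<le> exp (- \<rho> * t) \<and> 1 - \<rho> * t \<le> poly q t"
    and q2: "\<forall>s t. 0 \<le> s \<and> s \<le> t \<and> \<beta> * t < 1 \<longrightarrow> poly q t \<le> poly q s"
    and q3: "sq_residual D x (y f z) q \<le> \<kappa>"
    and q4: "0 < \<rho> \<longrightarrow> \<kappa> \<le> (\<Sum>i=1..D. if \<beta> * x i < 1 then (y f z i)\<^sup>2 * poly q (x i) else 0)"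
    using C.stopped_poly_filter[OF \<kappa>(1)] unfolding q_def[symmetric] by blast
  have ka: "\<bar>\<kappa> - \<delta>\<^sup>2 * real D\<bar> \<le> \<delta>\<^sup>2 * a"
    using \<kappa>(2) mult_left_mono[OF a(2), of "\<delta>\<^sup>2"] by (simp add: mult_ac)
  have y: "y f z i = lam i * (f \<bullet> v i) + \<delta> * \<epsilon> z i" if "i \<in> {1..D}" for i
    by (rule y_eq[OF src(1) that])
  interpret F: filtered_noise D \<mu> p cA CA K lam "\<lambda>i. f \<bullet> v i" "\<epsilon> z" \<delta> R \<kappa> a "poly q" \<rho> \<beta>
  proof
    show "(\<Sum>i=1..D. (lam i * (f \<bullet> v i) + \<delta> * \<epsilon> z i)\<^sup>2 * (poly q ((lam i)\<^sup>2))\<^sup>2) \<le> \<kappa>"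
      using q3 by (simp add: sq_residual_def y x_def)
    show "\<kappa> \<le> (\<Sum>i=1..D. if \<beta> * (lam i)\<^sup>2 < 1
             then (lam i * (f \<bullet> v i) + \<delta> * \<epsilon> z i)\<^sup>2 * poly q ((lam i)\<^sup>2) else 0)" if "0 < \<rho>"
    proof -
      have "(\<Sum>i=1..D. if \<beta> * x i < 1 then (y f z i)\<^sup>2 * poly q (x i) else 0)
        = (\<Sum>i=1..D. if \<beta> * (lam i)\<^sup>2 < 1
             then (lam i * (f \<bullet> v i) + \<delta> * \<epsilon> z i)\<^sup>2 * poly q ((lam i)\<^sup>2) else 0)"
        by (intro sum.cong refl) (simp add: y x_def)
      then show ?thesis using q4 that by simp
    qed
    show "1 \<le> D" using dims by simp
    show "lam j \<le> lam i" if "1 \<le> i" "i \<le> j" "j \<le> D" for i j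
      using that by (intro lam_anti) auto
    show "0 \<le> poly q t" "poly q t \<le> exp (- \<rho> * t)" "1 - \<rho> * t \<le> poly q t" if "0 \<le> t" "\<beta> * t < 1" for t
      using q1 that by blast+
    show "poly q t \<le> poly q s" if "0 \<le> s" "s \<le> t" "\<beta> * t < 1" for s t
      using q2 that by blast
    show "cA * real i powr - p \<le> lam i" "lam i \<le> CA * real i powr - p" if "1 \<le> i" "i \<le> D" for i
      using decay that by auto
    show "0 < R" using R by simp
  qed (use \<mu> p cA CA K \<delta> a ka eff_dim_le src(2) total partial \<beta> in blast)+
  have "loss f z = F.loss"
    unfolding loss_def F.loss_def q_def[symmetric]
    by (intro sum.cong refl) (simp add: y F.x_def F.g_def x_def)
  also have "\<dots> \<le> C8 * (\<delta>\<^sup>2 * (N + a) powr (2 * p + 1))" using F.loss_le by (simp add: F.N_def)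
  also have "\<dots> \<le> max 1 C8 * (\<delta>\<^sup>2 * (N + a) powr (2 * p + 1))" by (intro mult_right_mono) auto
  finally show ?thesis .
qed

lemma loss_tail:
  assumes f: "f \<in> signals D P lam v \<mu> R" and \<zeta>: "\<zeta> \<ge> 1"
  defines "b \<equiv> C9 * (rec_rate \<mu> p R \<delta> + \<delta>\<^sup>2 * (sqrt (real D) * sqrt \<zeta> + \<zeta>) powr (2 * p + 1))"
  shows "measure \<gamma> {z \<in> space \<gamma>. loss f z > b} \<le> 6 * exp (- \<zeta>)"
proof -
  interpret G: prob_space \<gamma> by (rule prob_space_gauss)
  note src = signals_source[OF f]
  define m where "m = sqrt (real D) * sqrt \<zeta> + \<zeta>"
  \<comment> \<open>The \<open>10\<close> is required by \<open>noise_event\<close>, and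
    \<open>C\<kappa>\<close> covers the distance of \<open>\<kappa>\<close> from
    \<open>\<delta>\<^sup>2 * D\<close>.\<close>
  define a where "a = (10 + C\<kappa>) * m"
  have "sqrt (real D) * 1 \<le> sqrt (real D) * sqrt \<zeta>" using \<zeta> by (intro mult_left_mono) auto
  then have m: "m \<ge> 1" "sqrt (real D) \<le> m" using \<zeta> by (auto simp: m_def intro: add_nonneg_pos)
      (smt (verit) real_sqrt_ge_zero of_nat_0_le_iff mult_nonneg_nonneg)+
  have a: "a \<ge> 1" "a \<ge> 10 * m" "a \<ge> C\<kappa> * sqrt (real D)"
  proof -
    have "C\<kappa> * sqrt (real D) \<le> C\<kappa> * m" "0 \<le> C\<kappa> * m" using m C\<kappa> by (auto intro: mult_left_mono)
    then show "a \<ge> 1" "a \<ge> 10 * m" "a \<ge> C\<kappa> * sqrt (real D)" using m by (auto simp: a_def distrib_right)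
  qed
  obtain Bad where Bad: "Bad \<in> sets \<gamma>" "measure \<gamma> Bad \<le> 6 * exp (- \<zeta>)"
    and good: "\<forall>z \<in> space \<gamma> - Bad.
      \<bar>(\<Sum>i=1..D. (\<epsilon> z i)\<^sup>2) - real D\<bar> \<le> a \<and>
      (\<forall>j. 1 \<le> j \<and> j \<le> D \<longrightarrow> real j / 2 - a \<le> (\<Sum>i=1..j. (\<epsilon> z i)\<^sup>2) \<and>
        (\<Sum>i=1..j. (\<epsilon> z i)\<^sup>2) \<le> 2 * real j + a \<and>
        \<bar>\<Sum>i=j..D. (lam i * (f \<bullet> v i)) * (\<delta> * \<epsilon> z i)\<bar>
          \<le> (\<Sum>i=j..D. (lam i * (f \<bullet> v i))\<^sup>2) / 8 + \<delta>\<^sup>2 * a)"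
    using noise_event[OF \<delta>(1) \<zeta>, of a "\<lambda>i. lam i * (f \<bullet> v i)"] a by (auto simp: m_def)
  define q where "q = 2 * p + 1"
  have q: "q > 0" using p by (simp add: q_def)
  have bound: "max 1 C8 * (\<delta>\<^sup>2 * (N + a) powr q) \<le> b"
  proof -
    have "(N + a) powr q \<le> (2 * max N a) powr q" using N_pos a q by (intro powr_mono2) auto
    also have "\<dots> = 2 powr q * (max N a) powr q" using N_pos by (simp add: powr_mult)
    also have "(max N a) powr q \<le> N powr q + a powr q" by (simp add: max_def)
    also have "a powr q = (10 + C\<kappa>) powr q * m powr q" using C\<kappa> m by (simp add: a_def powr_mult)
    also have "N powr q + (10 + C\<kappa>) powr q * m powr q \<le> (10 + C\<kappa>) powr q * (N powr q + m powr q)"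
    proof -
      have "1 \<le> (10 + C\<kappa>) powr q" using C\<kappa> q by (intro ge_one_powr_ge_zero) auto
      then have "1 * N powr q \<le> (10 + C\<kappa>) powr q * N powr q" by (intro mult_right_mono) auto
      then show ?thesis by (simp add: distrib_left)
    qed
    finally have "(N + a) powr q \<le> 2 powr q * ((10 + C\<kappa>) powr q * (N powr q + m powr q))" by simp
    then have "max 1 C8 * (\<delta>\<^sup>2 * (N + a) powr q) \<le> max 1 C8 * (\<delta>\<^sup>2 * (2 powr q * ((10 + C\<kappa>) powr q * (N powr q + m powr q))))"
      by (intro mult_left_mono) auto
    also have "\<dots> = b"
    proof -
      have "rec_rate \<mu> p R \<delta> = \<delta>\<^sup>2 * N powr q" using \<mu> p R \<delta> by (simp add: rec_rate_eff_dim q_def)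
      then show ?thesis
        unfolding b_def upper_const_def q_def[symmetric] m_def[symmetric] by (simp add: algebra_simps)
    qed
    finally show ?thesis .
  qed
  \<comment> \<open>The inclusion is only almost sure, because the deterministic bound is available
    for generic observations only.\<close>
  have "AE z in \<gamma>. z \<in> {z \<in> space \<gamma>. loss f z > b} \<longrightarrow> z \<in> Bad"
    using AE_generic[OF src(1)]
  proof eventually_elim
    case (elim z)
    show ?case
    proof (intro impI, rule ccontr)
      assume z: "z \<in> {z \<in> space \<gamma>. loss f z > b}" "z \<notin> Bad"
      have "loss f z \<le> max 1 C8 * (\<delta>\<^sup>2 * (N + a) powr (2 * p + 1))"
        using good z by (intro loss_deterministic[OF f elim a(1) a(3)]) auto
      then have "loss f z \<le> b" using bound by (auto simp: q_def)
      then show False using z by simp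
    qed
  qed
  then have "measure \<gamma> {z \<in> space \<gamma>. loss f z > b} \<le> measure \<gamma> Bad"
    using Bad by (intro G.finite_measure_mono_AE)
  then show ?thesis using Bad by simp
qed

lemma C9_pos: "C9 > 0"
  using C\<kappa> by (rule upper_const_pos)

lemma rate_pos: "rec_rate \<mu> p R \<delta> > 0"
  using R \<delta> by (simp add: rec_rate_def)

lemma loss_probability:
  assumes f: "f \<in> signals D P lam v \<mu> R" and z: "z \<ge> 1"
  shows "measure (std_gauss D) {\<omega> \<in> space (std_gauss D).
      rec_loss A \<delta> (cg_stopped_est A lam u \<kappa>) f \<omega>
        \<le> C9 * (rec_rate \<mu> p R \<delta> +
             \<delta>\<^sup>2 * (sqrt (real D) * sqrt z + z powr ((4 * p + 1) / (4 * p))) powr (2 * p + 1))}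
     \<ge> 1 - 6 * exp (- z)"
proof -
  interpret G: prob_space \<gamma> by (rule prob_space_gauss)
  note src = signals_source[OF f]
  note [measurable] = measurable_loss[OF src(1)] measurable_rec_loss[OF src(1)]
  define b where "b = C9 * (rec_rate \<mu> p R \<delta> + \<delta>\<^sup>2 * (sqrt (real D) * sqrt z + z) powr (2 * p + 1))"
  define b' where "b' = C9 * (rec_rate \<mu> p R \<delta> +
    \<delta>\<^sup>2 * (sqrt (real D) * sqrt z + z powr ((4 * p + 1) / (4 * p))) powr (2 * p + 1))"
  \<comment> \<open>For \<open>z \<ge> 1\<close> the exponent
    \<open>(4 * p + 1) / (4 * p) > 1\<close> only enlarges the threshold, so the tail bound with a
    linear \<open>z\<close> implies the stated one.\<close>
  have "z powr 1 \<le> z powr ((4 * p + 1) / (4 * p))" using z p by (intro powr_mono) auto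
  then have "b \<le> b'"
    unfolding b_def b'_def using C9_pos z p
    by (intro mult_left_mono add_left_mono powr_mono2) (auto intro!: add_nonneg_nonneg)
  then have "measure \<gamma> {\<omega> \<in> space \<gamma>. loss f \<omega> > b'} \<le> measure \<gamma> {\<omega> \<in> space \<gamma>. loss f \<omega> > b}"
    by (intro G.finite_measure_mono) auto
  also have "\<dots> \<le> 6 * exp (- z)" unfolding b_def by (rule loss_tail[OF f z])
  finally have "1 - 6 * exp (- z) \<le> 1 - measure \<gamma> {\<omega> \<in> space \<gamma>. loss f \<omega> > b'}" by simp
  also have "\<dots> = measure \<gamma> (space \<gamma> - {\<omega> \<in> space \<gamma>. loss f \<omega> > b'})"
    by (rule G.prob_compl[symmetric]) measurable
  also have "space \<gamma> - {\<omega> \<in> space \<gamma>. loss f \<omega> > b'} = {\<omega> \<in> space \<gamma>. loss f \<omega> \<le> b'}"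
    by auto
  also have "measure \<gamma> {\<omega> \<in> space \<gamma>. loss f \<omega> \<le> b'} = measure (completion \<gamma>) {\<omega> \<in> space \<gamma>. loss f \<omega> \<le> b'}"
    by (rule measure_completion[symmetric]) measurable
  also have "\<dots> = measure (completion \<gamma>)
      {\<omega> \<in> space (completion \<gamma>). rec_loss A \<delta> (cg_stopped_est A lam u \<kappa>) f \<omega> \<le> b'}"
  proof (rule measure_eq_AE)
    show "AE \<omega> in completion \<gamma>. \<omega> \<in> {\<omega> \<in> space \<gamma>. loss f \<omega> \<le> b'} \<longleftrightarrow>
        \<omega> \<in> {\<omega> \<in> space (completion \<gamma>). rec_loss A \<delta> (cg_stopped_est A lam u \<kappa>) f \<omega> \<le> b'}"
      using AE_completion[OF AE_rec_loss_eq[OF src(1)]] by eventually_elim simp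
    show "{\<omega> \<in> space (completion \<gamma>). rec_loss A \<delta> (cg_stopped_est A lam u \<kappa>) f \<omega> \<le> b'} \<in> sets (completion \<gamma>)"
      by measurable
    have "{\<omega> \<in> space \<gamma>. loss f \<omega> \<le> b'} \<in> sets \<gamma>" by measurable
    then show "{\<omega> \<in> space \<gamma>. loss f \<omega> \<le> b'} \<in> sets (completion \<gamma>)" by (rule sets_completionI_sets)
  qed
  finally show ?thesis unfolding std_gauss_eq b'_def .
qed

section \<open>Bounds in expectation\<close>

lemma C10_pos: "C10 > 0"
  using p C\<kappa> by (intro risk_const_pos) auto

lemma nn_integral_loss:
  assumes f: "f \<in> signals D P lam v \<mu> R"
  shows "(\<integral>\<^sup>+z. ennreal (loss f z) \<partial>\<gamma>) \<le> ennreal (C10 * (rec_rate \<mu> p R \<delta> + \<delta>\<^sup>2 * real D powr (p + 1/2)))"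
proof -
  interpret G: prob_space \<gamma> by (rule prob_space_gauss)
  note src = signals_source[OF f]
  note [measurable] = measurable_loss[OF src(1)]
  define q where "q = 2 * p + 1"
  have q: "q > 0" using p by (simp add: q_def)
  define W where "W = rec_rate \<mu> p R \<delta> + \<delta>\<^sup>2 * real D powr (p + 1/2)"
  have W: "W > 0" unfolding W_def using rate_pos by (intro add_pos_nonneg) auto
  have "(\<integral>\<^sup>+z. ennreal (loss f z) \<partial>\<gamma>) \<le> ennreal (tail_const q * (C9 * 2 powr q * W))"
  proof (rule nn_integral_le_of_tail[OF prob_space_gauss _ _ q])
    show "0 < C9 * 2 powr q * W" using C9_pos W by simp
    fix \<zeta> :: real assume \<zeta>: "\<zeta> \<ge> 1"
    \<comment> \<open>Pulling \<open>\<zeta>\<close> out as a factor brings the threshold into the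
      form \<open>V * \<zeta> powr q\<close> required by \<open>nn_integral_le_of_tail\<close>. The
      \<open>2\<close> here is the source of \<open>2 powr (2 * p + 1)\<close> in
      \<open>risk_const\<close>.\<close>
    have "sqrt (real D) * sqrt \<zeta> + \<zeta> \<le> 2 * (sqrt (real D) * \<zeta>)"
    proof -
      have "sqrt \<zeta> \<le> \<zeta>" using \<zeta> by (intro real_le_lsqrt) (auto simp: power2_eq_square)
      then have "sqrt (real D) * sqrt \<zeta> \<le> sqrt (real D) * \<zeta>" by (intro mult_left_mono) auto
      moreover have "1 * \<zeta> \<le> sqrt (real D) * \<zeta>" using D1 \<zeta> by (intro mult_right_mono) auto
      ultimately show ?thesis by simp
    qed
    then have "(sqrt (real D) * sqrt \<zeta> + \<zeta>) powr q \<le> (2 * (sqrt (real D) * \<zeta>)) powr q"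
      using \<zeta> q by (intro powr_mono2) (auto intro!: add_nonneg_nonneg)
    also have "\<dots> = 2 powr q * (real D powr (p + 1/2) * \<zeta> powr q)"
      using \<zeta> by (simp add: powr_mult powr_half_sqrt[symmetric] powr_powr q_def field_simps)
    finally have 1: "(sqrt (real D) * sqrt \<zeta> + \<zeta>) powr q \<le> 2 powr q * (real D powr (p + 1/2) * \<zeta> powr q)" .
    have "1 * 1 \<le> 2 powr q * \<zeta> powr q" using \<zeta> q by (intro mult_mono ge_one_powr_ge_zero) auto
    then have 2: "rec_rate \<mu> p R \<delta> * 1 \<le> rec_rate \<mu> p R \<delta> * (2 powr q * \<zeta> powr q)"
      using rate_pos by (intro mult_left_mono) auto
    have "rec_rate \<mu> p R \<delta> + \<delta>\<^sup>2 * (sqrt (real D) * sqrt \<zeta> + \<zeta>) powr q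
       \<le> rec_rate \<mu> p R \<delta> * (2 powr q * \<zeta> powr q)
         + \<delta>\<^sup>2 * (2 powr q * (real D powr (p + 1/2) * \<zeta> powr q))"
      using 2 mult_left_mono[OF 1, of "\<delta>\<^sup>2"] by simp
    also have "\<dots> = 2 powr q * W * \<zeta> powr q" by (simp add: W_def algebra_simps)
    finally have le: "C9 * (rec_rate \<mu> p R \<delta> + \<delta>\<^sup>2 * (sqrt (real D) * sqrt \<zeta> + \<zeta>) powr q)
       \<le> C9 * (2 powr q * W * \<zeta> powr q)"
      using C9_pos by (intro mult_left_mono) auto
    have "measure \<gamma> {z \<in> space \<gamma>. loss f z > C9 * 2 powr q * W * \<zeta> powr q}
       \<le> measure \<gamma> {z \<in> space \<gamma>. loss f z > C9 * (rec_rate \<mu> p R \<delta> + \<delta>\<^sup>2 * (sqrt (real D) * sqrt \<zeta> + \<zeta>) powr q)}"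
      using le by (intro G.finite_measure_mono) (auto simp: mult_ac)
    also have "\<dots> \<le> 6 * exp (- \<zeta>)" unfolding q_def by (rule loss_tail[OF f \<zeta>])
    finally show "measure \<gamma> {z \<in> space \<gamma>. loss f z > C9 * 2 powr q * W * \<zeta> powr q} \<le> 6 * exp (- \<zeta>)" .
  qed measurable
  then show ?thesis by (simp add: risk_const_def q_def W_def mult_ac)
qed

lemma loss_expectation:
  assumes f: "f \<in> signals D P lam v \<mu> R"
  shows "integrable (std_gauss D) (rec_loss A \<delta> (cg_stopped_est A lam u \<kappa>) f)"
    and "(\<integral>\<omega>. rec_loss A \<delta> (cg_stopped_est A lam u \<kappa>) f \<omega> \<partial>std_gauss D)
      \<le> C10 * (rec_rate \<mu> p R \<delta> + \<delta>\<^sup>2 * real D powr (p + 1/2))"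
    and "rec_risk A \<delta> (cg_stopped_est A lam u \<kappa>) f
      \<le> ennreal (C10 * (rec_rate \<mu> p R \<delta> + \<delta>\<^sup>2 * real D powr (p + 1/2)))"
proof -
  note src = signals_source[OF f]
  define W where "W = C10 * (rec_rate \<mu> p R \<delta> + \<delta>\<^sup>2 * real D powr (p + 1/2))"
  have W: "W \<ge> 0" unfolding W_def using C10_pos rate_pos by (intro mult_nonneg_nonneg add_nonneg_nonneg) auto
  have "(\<integral>\<^sup>+z. ennreal (rec_loss A \<delta> (cg_stopped_est A lam u \<kappa>) f z) \<partial>completion \<gamma>)
      = (\<integral>\<^sup>+z. ennreal (loss f z) \<partial>\<gamma>)"
    unfolding nn_integral_completion using AE_rec_loss_eq[OF src(1)]
    by (intro nn_integral_cong_AE) auto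
  also have "\<dots> \<le> ennreal W" unfolding W_def by (rule nn_integral_loss[OF f])
  finally have nn: "(\<integral>\<^sup>+z. ennreal (rec_loss A \<delta> (cg_stopped_est A lam u \<kappa>) f z) \<partial>completion \<gamma>) \<le> ennreal W" .
  have nonneg: "rec_loss A \<delta> (cg_stopped_est A lam u \<kappa>) f z \<ge> 0" for z
    by (auto simp: rec_loss_def scalar_prod_def intro!: sum_nonneg)
  show int: "integrable (std_gauss D) (rec_loss A \<delta> (cg_stopped_est A lam u \<kappa>) f)"
    unfolding std_gauss_eq
    using nn measurable_rec_loss[OF src(1)] nonneg
    by (intro integrableI_nonneg) (auto simp: le_less_trans)
  have "ennreal (\<integral>\<omega>. rec_loss A \<delta> (cg_stopped_est A lam u \<kappa>) f \<omega> \<partial>std_gauss D)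
      = (\<integral>\<^sup>+z. ennreal (rec_loss A \<delta> (cg_stopped_est A lam u \<kappa>) f z) \<partial>std_gauss D)"
    by (rule nn_integral_eq_integral[OF int, symmetric]) (simp add: nonneg)
  also have "\<dots> \<le> ennreal W" using nn by (simp add: std_gauss_eq)
  finally show "(\<integral>\<omega>. rec_loss A \<delta> (cg_stopped_est A lam u \<kappa>) f \<omega> \<partial>std_gauss D)
      \<le> C10 * (rec_rate \<mu> p R \<delta> + \<delta>\<^sup>2 * real D powr (p + 1/2))"
    using W by (simp add: W_def)
  show "rec_risk A \<delta> (cg_stopped_est A lam u \<kappa>) f
      \<le> ennreal (C10 * (rec_rate \<mu> p R \<delta> + \<delta>\<^sup>2 * real D powr (p + 1/2)))"
    using nn by (simp add: rec_risk_def dims std_gauss_eq W_def)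
qed

text \<open>The stopped estimator need not be Borel on the null set where it is unspecified; redefined there
  it becomes an admissible estimator with the same risk.\<close>

definition borel_est :: "real vec \<Rightarrow> real vec" where
  "borel_est Y = (if generic Y
     then v_comb (\<lambda>i. (1 - poly (stopped_poly D x \<kappa> (\<lambda>i. Y \<bullet> u i)) (x i)) * (Y \<bullet> u i) / lam i)
     else v_comb (\<lambda>i. 0))"

lemma borel_est_estimator: "borel_est \<in> estimators D P"
proof -
  have m [measurable]: "(\<lambda>w. Matrix.vec D w \<bullet> u i) \<in> borel_measurable (PiM {..<D} (\<lambda>_. borel))"
    if "i \<in> {1..D}" for i
  proof -
    have "Matrix.vec D w \<bullet> u i = (\<Sum>j<D. w j * u i $ j)" for w :: "nat \<Rightarrow> real"
      by (simp add: scalar_prod_lessThan[OF u_carrier[OF that]])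
    then show ?thesis by simp
  qed
  have [measurable]: "(\<lambda>w. poly (stopped_poly D x \<kappa> (\<lambda>i. Matrix.vec D w \<bullet> u i)) t)
      \<in> borel_measurable (PiM {..<D} (\<lambda>_. borel))" for t
    by (rule measurable_stopped_poly) (rule m)
  have "(\<lambda>w. borel_est (Matrix.vec D w) $ j) \<in> borel_measurable (PiM {..<D} (\<lambda>_. borel))" if j: "j < P" for j
  proof -
    have "borel_est (Matrix.vec D w) $ j = (if \<forall>i\<in>{1..D}. Matrix.vec D w \<bullet> u i \<noteq> 0 then
        (\<Sum>i=1..D. (1 - poly (stopped_poly D x \<kappa> (\<lambda>i. Matrix.vec D w \<bullet> u i)) (x i))
          * (Matrix.vec D w \<bullet> u i) / lam i * v i $ j) else 0)" for w
      using j by (simp add: borel_est_def generic_def v_comb_def)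
    then show ?thesis by (simp only:) measurable
  qed
  then show ?thesis by (auto simp: estimators_def borel_est_def)
qed

lemma borel_est_risk:
  assumes f: "f \<in> carrier_vec P"
  shows "rec_risk A \<delta> borel_est f = rec_risk A \<delta> (cg_stopped_est A lam u \<kappa>) f"
  unfolding rec_risk_def dims std_gauss_eq nn_integral_completion
proof (rule nn_integral_cong_AE)
  show "AE z in \<gamma>. ennreal (rec_loss A \<delta> borel_est f z)
      = ennreal (rec_loss A \<delta> (cg_stopped_est A lam u \<kappa>) f z)"
    using AE_generic[OF f]
  proof eventually_elim
    case (elim z)
    have "borel_est (obs A f \<delta> z) = cg_stopped_est A lam u \<kappa> (obs A f \<delta> z)"
      using cg_stopped_est_eq[OF obs_carrier[OF f] elim \<kappa>(1)] elim by (simp add: borel_est_def)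
    then show ?case by (simp add: rec_loss_def)
  qed
qed

text \<open>The dimension term \<open>\<delta>\<^sup>2 * D powr (p + 1/2)\<close> is
  \<open>\<delta>\<^sup>2 * sqrt D powr (2 * p + 1)\<close>, so \<open>sqrt D \<le> K' * N\<close>
  reduces it to a multiple of the rate.\<close>

lemma risk_upper:
  assumes K': "K' > 0" and D: "sqrt (real D) \<le> K' * N"
  defines "C \<equiv> C10 * (1 + K' powr (2 * p + 1))"
  shows "(SUP f\<in>signals D P lam v \<mu> R. rec_risk A \<delta> (cg_stopped_est A lam u \<kappa>) f) \<le> ennreal (C * rec_rate \<mu> p R \<delta>)"
    and "minimax_risk A lam v \<mu> R \<delta> \<le> ennreal (C * rec_rate \<mu> p R \<delta>)"
proof -
  have "real D powr (p + 1/2) = sqrt (real D) powr (2 * p + 1)"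
    by (simp add: powr_half_sqrt[symmetric] powr_powr field_simps)
  also have "\<dots> \<le> (K' * N) powr (2 * p + 1)" using D p by (intro powr_mono2) auto
  also have "\<dots> = K' powr (2 * p + 1) * N powr (2 * p + 1)" using K' N_pos by (simp add: powr_mult)
  finally have "\<delta>\<^sup>2 * real D powr (p + 1/2) \<le> \<delta>\<^sup>2 * (K' powr (2 * p + 1) * N powr (2 * p + 1))"
    by (intro mult_left_mono) auto
  also have "\<dots> = K' powr (2 * p + 1) * rec_rate \<mu> p R \<delta>"
    using \<mu> p R \<delta> by (simp add: rec_rate_eff_dim)
  finally have "C10 * (rec_rate \<mu> p R \<delta> + \<delta>\<^sup>2 * real D powr (p + 1/2)) \<le> C * rec_rate \<mu> p R \<delta>"
    unfolding C_def mult.assoc using C10_pos by (intro mult_left_mono) (auto simp: algebra_simps)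
  then have "ennreal (C10 * (rec_rate \<mu> p R \<delta> + \<delta>\<^sup>2 * real D powr (p + 1/2))) \<le> ennreal (C * rec_rate \<mu> p R \<delta>)"
    by (rule ennreal_leI)
  then show cg: "(SUP f\<in>signals D P lam v \<mu> R. rec_risk A \<delta> (cg_stopped_est A lam u \<kappa>) f) \<le> ennreal (C * rec_rate \<mu> p R \<delta>)"
    using loss_expectation(3) by (intro SUP_least) (blast intro: order_trans)
  have "minimax_risk A lam v \<mu> R \<delta> \<le> (SUP f\<in>signals D P lam v \<mu> R. rec_risk A \<delta> borel_est f)"
    unfolding minimax_risk_def dims by (rule INF_lower[OF borel_est_estimator])
  also have "\<dots> = (SUP f\<in>signals D P lam v \<mu> R. rec_risk A \<delta> (cg_stopped_est A lam u \<kappa>) f)"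
    using signals_source(1) by (intro SUP_cong refl borel_est_risk)
  finally show "minimax_risk A lam v \<mu> R \<delta> \<le> ennreal (C * rec_rate \<mu> p R \<delta>)"
    using cg by simp
qed

end

section \<open>Minimax lower bound\<close>

lemma std_normal_shift:
  assumes A: "A \<in> sets borel"
  shows "(\<integral>\<^sup>+t. ennreal (exp (s * t - s\<^sup>2 / 2)) * indicator A t \<partial>std_normal_distribution)
    = emeasure std_normal_distribution {t. t + s \<in> A}"
proof -
  have [measurable]: "A \<in> sets borel" by fact
  have B: "{t. t + s \<in> A} \<in> sets borel" by measurable
  have eq: "std_normal_density t * exp (s * t - s\<^sup>2 / 2) = std_normal_density (t - s)" for t
    by (simp add: normal_density_def exp_add[symmetric] power2_eq_square field_simps)
  have "(\<integral>\<^sup>+t. ennreal (exp (s * t - s\<^sup>2 / 2)) * indicator A t \<partial>std_normal_distribution)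
      = (\<integral>\<^sup>+t. ennreal (std_normal_density (t - s)) * indicator A t \<partial>lborel)"
    by (subst nn_integral_density) (auto simp: eq[symmetric] ennreal_mult mult.assoc)
  also have "\<dots> = (\<integral>\<^sup>+t. ennreal (std_normal_density t) * indicator {t. t + s \<in> A} t \<partial>lborel)"
    by (subst nn_integral_real_affine[where c=1 and t=s]) (auto simp: add.commute indicator_def)
  also have "\<dots> = emeasure std_normal_distribution {t. t + s \<in> A}"
    using B by (subst emeasure_density) auto
  finally show ?thesis .
qed

text \<open>The likelihood ratio of the Gaussian law shifted by \<open>s\<close>
  (Cameron-Martin).\<close>

definition shift_density :: "'i set \<Rightarrow> ('i \<Rightarrow> real) \<Rightarrow> ('i \<Rightarrow> real) \<Rightarrow> real" where
  "shift_density I s z = exp ((\<Sum>i\<in>I. s i * z i) - (\<Sum>i\<in>I. (s i)\<^sup>2) / 2)"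

lemma measurable_shift_density [measurable]:
  "shift_density I s \<in> borel_measurable (gauss I)"
  unfolding shift_density_def by measurable

lemma shift_density_pos: "shift_density I s z > 0"
  by (simp add: shift_density_def)

lemma measurable_shift [measurable]:
  "(\<lambda>z. \<lambda>i\<in>I. z i + s i) \<in> measurable (gauss I) (gauss I)"
  by (rule measurable_restrict) measurable

text \<open>Both measures are compared on boxes, where they factor and the one-dimensional formula
  \<open>std_normal_shift\<close> applies.\<close>

lemma gauss_shift_distr:
  assumes I: "finite I"
  shows "distr (gauss I) (gauss I) (\<lambda>z. \<lambda>i\<in>I. z i + s i) = density (gauss I) (shift_density I s)"
proof -
  interpret product_prob_space "\<lambda>_. std_normal_distribution" I by (rule product_prob_space_gauss)
  interpret D: prob_space "distr (gauss I) (gauss I) (\<lambda>z. \<lambda>i\<in>I. z i + s i)"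
    by (rule prob_space.prob_space_distr[OF prob_space_gauss]) measurable
  show ?thesis
  proof (rule measure_eqI_PiM_finite[OF I])
    fix A assume A: "\<And>i. i \<in> I \<Longrightarrow> A i \<in> sets std_normal_distribution"
    then have A': "A i \<in> sets borel" if "i \<in> I" for i using that by simp
    have B: "{t. t + s i \<in> A i} \<in> sets borel" if "i \<in> I" for i
      using A'[OF that] by measurable
    have PA: "Pi\<^sub>E I A \<in> sets (gauss I)" using I A by (intro sets_PiM_I_finite) auto
    have "emeasure (distr (gauss I) (gauss I) (\<lambda>z. \<lambda>i\<in>I. z i + s i)) (Pi\<^sub>E I A)
        = emeasure (gauss I) ((\<lambda>z. \<lambda>i\<in>I. z i + s i) -` Pi\<^sub>E I A \<inter> space (gauss I))"
      using PA by (rule emeasure_distr[OF measurable_shift])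
    also have "(\<lambda>z. \<lambda>i\<in>I. z i + s i) -` Pi\<^sub>E I A \<inter> space (gauss I) = Pi\<^sub>E I (\<lambda>i. {t. t + s i \<in> A i})"
      by (auto simp: space_PiM PiE_iff)
    also have "emeasure (gauss I) \<dots> = (\<Prod>i\<in>I. emeasure std_normal_distribution {t. t + s i \<in> A i})"
      using I B by (intro emeasure_PiM) auto
    also have "\<dots> = (\<Prod>i\<in>I. \<integral>\<^sup>+t. ennreal (exp (s i * t - (s i)\<^sup>2 / 2)) * indicator (A i) t \<partial>std_normal_distribution)"
      using A' by (intro prod.cong refl std_normal_shift[symmetric])
    also have "\<dots> = (\<integral>\<^sup>+z. (\<Prod>i\<in>I. ennreal (exp (s i * z i - (s i)\<^sup>2 / 2)) * indicator (A i) (z i)) \<partial>gauss I)"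
      using I A' by (intro product_nn_integral_prod[symmetric]) auto
    also have "\<dots> = (\<integral>\<^sup>+z. ennreal (shift_density I s z) * indicator (Pi\<^sub>E I A) z \<partial>gauss I)"
    proof (intro nn_integral_cong)
      fix z assume z: "z \<in> space (gauss I)"
      have "(\<Prod>i\<in>I. indicator (A i) (z i) :: ennreal) = indicator (Pi\<^sub>E I A) z"
        using I z by (auto simp: indicator_def space_PiM PiE_iff intro!: prod.neutral)
      moreover have "(\<Prod>i\<in>I. ennreal (exp (s i * z i - (s i)\<^sup>2 / 2))) = ennreal (shift_density I s z)"
        using I by (simp add: prod_ennreal exp_sum[symmetric] shift_density_def sum_subtractf sum_divide_distrib)
      ultimately show "(\<Prod>i\<in>I. ennreal (exp (s i * z i - (s i)\<^sup>2 / 2)) * indicator (A i) (z i))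
          = ennreal (shift_density I s z) * indicator (Pi\<^sub>E I A) z"
        by (simp add: prod.distrib)
    qed
    also have "\<dots> = emeasure (density (gauss I) (shift_density I s)) (Pi\<^sub>E I A)"
      using PA by (subst emeasure_density) auto
    finally show "emeasure (distr (gauss I) (gauss I) (\<lambda>z. \<lambda>i\<in>I. z i + s i)) (Pi\<^sub>E I A)
      = emeasure (density (gauss I) (shift_density I s)) (Pi\<^sub>E I A)" .
  next
    show "range (\<lambda>_::nat. space (gauss I)) \<subseteq> prod_algebra I (\<lambda>_. std_normal_distribution)"
      using I by (auto simp: space_PiM intro!: prod_algebraI_finite)
    show "(\<Union>n::nat. space (gauss I)) = space (gauss I)" by simp
    show "emeasure (distr (gauss I) (gauss I) (\<lambda>z. \<lambda>i\<in>I. z i + s i)) (space (gauss I)) \<noteq> \<infinity>" for n :: nat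
      using D.emeasure_space_1 by simp
  qed auto
qed

lemma nn_integral_gauss_shift:
  assumes I: "finite I" and [measurable]: "F \<in> borel_measurable (gauss I)"
  shows "(\<integral>\<^sup>+z. F (\<lambda>i\<in>I. z i + s i) \<partial>gauss I) = (\<integral>\<^sup>+z. ennreal (shift_density I s z) * F z \<partial>gauss I)"
proof -
  have "(\<integral>\<^sup>+z. F (\<lambda>i\<in>I. z i + s i) \<partial>gauss I) = (\<integral>\<^sup>+z. F z \<partial>distr (gauss I) (gauss I) (\<lambda>z. \<lambda>i\<in>I. z i + s i))"
    by (rule nn_integral_distr[symmetric]) measurable
  then show ?thesis unfolding gauss_shift_distr[OF I] by (simp add: nn_integral_density)
qed

text \<open>The case \<open>k = 1\<close> is normalisation; \<open>k = 2\<close> gives the second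
  moment that bounds the distance of the two laws.\<close>

lemma nn_integral_shift_density_power:
  assumes "finite I"
  shows "(\<integral>\<^sup>+z. ennreal (shift_density I s z ^ k) \<partial>gauss I)
    = ennreal (exp ((real k ^ 2 - real k) * (\<Sum>i\<in>I. (s i)\<^sup>2) / 2))"
proof -
  define S where "S = (\<Sum>i\<in>I. (s i)\<^sup>2)"
  have "shift_density I s z ^ k = exp (- real k * S / 2) * exp (\<Sum>i\<in>I. (real k * s i) * z i)" for z
  proof -
    have "real k * ((\<Sum>i\<in>I. s i * z i) - S / 2) = - real k * S / 2 + (\<Sum>i\<in>I. (real k * s i) * z i)"
      by (simp add: right_diff_distrib sum_distrib_left mult.assoc)
    then show ?thesis
      unfolding shift_density_def S_def[symmetric] exp_of_nat_mult[symmetric] exp_add[symmetric] by simp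
  qed
  then have "(\<integral>\<^sup>+z. ennreal (shift_density I s z ^ k) \<partial>gauss I)
      = ennreal (exp (- real k * S / 2)) * (\<integral>\<^sup>+z. ennreal (exp (\<Sum>i\<in>I. (real k * s i) * z i)) \<partial>gauss I)"
    by (simp add: ennreal_mult nn_integral_cmult del: mult_minus_left)
  also have "\<dots> = ennreal (exp (- real k * S / 2)) * ennreal (exp (real k ^ 2 * S / 2))"
    using assms by (simp add: nn_integral_gauss_exp_linear power_mult_distrib sum_distrib_left S_def)
  also have "\<dots> = ennreal (exp ((real k ^ 2 - real k) * S / 2))"
    by (simp add: ennreal_mult[symmetric] exp_add[symmetric] algebra_simps diff_divide_distrib)
  finally show ?thesis by (simp add: S_def)
qed

text \<open>The affinity of the two laws is bounded below through \<open>min 1 L \<ge> L - L\<^sup>2/4\<close>.\<close>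

lemma shift_affinity:
  assumes I: "finite I" and s: "(\<Sum>i\<in>I. (s i)\<^sup>2) \<le> 1/4"
  shows "ennreal (1/2) \<le> (\<integral>\<^sup>+z. ennreal (min 1 (shift_density I s z)) \<partial>gauss I)"
proof -
  define L where "L = shift_density I s"
  have L: "L z > 0" for z by (simp add: L_def shift_density_pos)
  have [measurable]: "L \<in> borel_measurable (gauss I)" by (simp add: L_def measurable_shift_density)
  have L1: "(\<integral>\<^sup>+z. ennreal (L z) \<partial>gauss I) = 1"
    using nn_integral_shift_density_power[OF I, of s 1] by (simp add: L_def)
  have "(\<integral>\<^sup>+z. ennreal (L z ^ 2 / 4) \<partial>gauss I) = ennreal (1/4) * (\<integral>\<^sup>+z. ennreal (L z ^ 2) \<partial>gauss I)"
    by (subst nn_integral_cmult[symmetric]) (auto simp: ennreal_mult[symmetric])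
  also have "\<dots> = ennreal (1/4) * ennreal (exp (\<Sum>i\<in>I. (s i)\<^sup>2))"
    using nn_integral_shift_density_power[OF I, of s 2] by (simp add: L_def)
  also have "\<dots> \<le> ennreal (1/4) * ennreal 2"
  proof (intro mult_left_mono ennreal_leI)
    have "exp (\<Sum>i\<in>I. (s i)\<^sup>2) \<le> exp (1/4 :: real)" using s by simp
    also have "\<dots> \<le> 2" using exp_bound[of "1/4::real"] by (simp add: power2_eq_square)
    finally show "exp (\<Sum>i\<in>I. (s i)\<^sup>2) \<le> 2" .
  qed simp
  also have "\<dots> = ennreal (1/2)" by (simp add: ennreal_mult[symmetric] del: ennreal_numeral)
  finally have L2: "(\<integral>\<^sup>+z. ennreal (L z ^ 2 / 4) \<partial>gauss I) \<le> ennreal (1/2)" .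
  \<comment> \<open>For \<open>L z \<ge> 1\<close> this is \<open>(L z - 2)\<^sup>2 \<ge> 0\<close>;
    otherwise it is immediate.\<close>
  have "L z \<le> min 1 (L z) + L z ^ 2 / 4" for z
    using sum_squares_ge_zero[of "L z - 2" 0] L[of z] by (auto simp: min_def power2_eq_square algebra_simps)
  then have "(\<integral>\<^sup>+z. ennreal (L z) \<partial>gauss I) \<le> (\<integral>\<^sup>+z. ennreal (min 1 (L z)) + ennreal (L z ^ 2 / 4) \<partial>gauss I)"
    using L by (intro nn_integral_mono) (simp add: ennreal_plus[symmetric] less_imp_le ennreal_leI del: ennreal_plus)
  also have "\<dots> = (\<integral>\<^sup>+z. ennreal (min 1 (L z)) \<partial>gauss I) + (\<integral>\<^sup>+z. ennreal (L z ^ 2 / 4) \<partial>gauss I)"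
    by (rule nn_integral_add) measurable
  also have "\<dots> \<le> (\<integral>\<^sup>+z. ennreal (min 1 (L z)) \<partial>gauss I) + ennreal (1/2)"
    using L2 by (rule add_left_mono)
  finally have "ennreal (1/2) + ennreal (1/2) \<le> (\<integral>\<^sup>+z. ennreal (min 1 (L z)) \<partial>gauss I) + ennreal (1/2)"
    unfolding L1 by (subst ennreal_plus[symmetric]) auto
  then have "ennreal (1/2) + ennreal (1/2) \<le> ennreal (1/2) + (\<integral>\<^sup>+z. ennreal (min 1 (L z)) \<partial>gauss I)"
    by (simp only: add.commute)
  then show ?thesis unfolding L_def ennreal_add_left_cancel_le infinity_ennreal_def using ennreal_neq_top[of "1/2"] by blast
qed

text \<open>Le Cam's argument: one value cannot be close to both \<open>t0\<close> and
  \<open>t1\<close>, so its squared distances add up to at least half the squared separation.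
  Integrating this against the overlap of the two laws, at least \<open>1/2\<close>, gives the
  quarter.\<close>

lemma two_point_bound:
  fixes T :: "('i \<Rightarrow> real) \<Rightarrow> real"
  assumes I: "finite I" and [measurable]: "T \<in> borel_measurable (gauss I)" and s: "(\<Sum>i\<in>I. (s i)\<^sup>2) \<le> 1/4"
  shows "ennreal ((t1 - t0)\<^sup>2 / 4) \<le>
    (\<integral>\<^sup>+z. ennreal ((T z - t0)\<^sup>2) \<partial>gauss I) + (\<integral>\<^sup>+z. ennreal ((T (\<lambda>i\<in>I. z i + s i) - t1)\<^sup>2) \<partial>gauss I)"
proof -
  define L where "L = shift_density I s"
  have L: "L z > 0" for z by (simp add: L_def shift_density_pos)
  have [measurable]: "L \<in> borel_measurable (gauss I)" by (simp add: L_def measurable_shift_density)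
  have pw: "(t1 - t0)\<^sup>2 / 2 * min 1 (L z) \<le> (T z - t0)\<^sup>2 + L z * (T z - t1)\<^sup>2" for z
  proof -
    have "(t1 - t0)\<^sup>2 / 2 \<le> (T z - t0)\<^sup>2 + (T z - t1)\<^sup>2"
    proof -
      have "(T z - t0)\<^sup>2 + (T z - t1)\<^sup>2 = (t1 - t0)\<^sup>2 / 2 + (2 * T z - t0 - t1)\<^sup>2 / 2"
        by (simp add: power2_eq_square field_simps)
      then show ?thesis by simp
    qed
    then have "(t1 - t0)\<^sup>2 / 2 * min 1 (L z) \<le> ((T z - t0)\<^sup>2 + (T z - t1)\<^sup>2) * min 1 (L z)"
      using L[of z] by (intro mult_right_mono) auto
    also have "\<dots> = min 1 (L z) * (T z - t0)\<^sup>2 + min 1 (L z) * (T z - t1)\<^sup>2" by (simp add: algebra_simps)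
    also have "\<dots> \<le> 1 * (T z - t0)\<^sup>2 + L z * (T z - t1)\<^sup>2"
      by (intro add_mono mult_right_mono) auto
    finally show ?thesis by simp
  qed
  have "ennreal ((t1 - t0)\<^sup>2 / 4) = ennreal ((t1 - t0)\<^sup>2 / 2) * ennreal (1/2)"
    by (subst ennreal_mult[symmetric]) auto
  also have "\<dots> \<le> ennreal ((t1 - t0)\<^sup>2 / 2) * (\<integral>\<^sup>+z. ennreal (min 1 (L z)) \<partial>gauss I)"
    unfolding L_def by (intro mult_left_mono shift_affinity[OF I s]) auto
  also have "\<dots> = (\<integral>\<^sup>+z. ennreal ((t1 - t0)\<^sup>2 / 2 * min 1 (L z)) \<partial>gauss I)"
    using L by (subst nn_integral_cmult[symmetric]) (auto simp: ennreal_mult[symmetric] less_imp_le)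
  also have "\<dots> \<le> (\<integral>\<^sup>+z. ennreal ((T z - t0)\<^sup>2) + ennreal (L z) * ennreal ((T z - t1)\<^sup>2) \<partial>gauss I)"
    using pw L by (intro nn_integral_mono)
      (simp add: ennreal_mult[symmetric] ennreal_plus[symmetric] less_imp_le ennreal_leI del: ennreal_plus)
  also have "\<dots> = (\<integral>\<^sup>+z. ennreal ((T z - t0)\<^sup>2) \<partial>gauss I) + (\<integral>\<^sup>+z. ennreal (L z) * ennreal ((T z - t1)\<^sup>2) \<partial>gauss I)"
    by (rule nn_integral_add) measurable
  also have "(\<integral>\<^sup>+z. ennreal (L z) * ennreal ((T z - t1)\<^sup>2) \<partial>gauss I) = (\<integral>\<^sup>+z. ennreal ((T (\<lambda>i\<in>I. z i + s i) - t1)\<^sup>2) \<partial>gauss I)"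
    unfolding L_def by (rule nn_integral_gauss_shift[OF I, symmetric]) measurable
  finally show ?thesis .
qed

lemma sum_Pow_split:
  fixes h :: "'a set \<Rightarrow> 'b::comm_monoid_add"
  assumes "finite F" "i \<in> F"
  shows "(\<Sum>S\<in>Pow F. h S) = (\<Sum>S\<in>Pow (F - {i}). h S + h (insert i S))"
proof -
  have "Pow F = Pow (F - {i}) \<union> insert i ` Pow (F - {i})"
    using Pow_insert[of i "F - {i}"] assms by (simp add: insert_absorb)
  moreover have "inj_on (insert i) (Pow (F - {i}))" by (auto simp: inj_on_def)
  moreover have "Pow (F - {i}) \<inter> insert i ` Pow (F - {i}) = {}" by auto
  ultimately show ?thesis
    using assms by (simp add: sum.union_disjoint sum.reindex sum.distrib)
qed

text \<open>Only the upper half of the indices is counted: at least \<open>m / 2\<close> of them,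
  each of size at least \<open>m / 2\<close>.\<close>

lemma sum_powr_lower:
  fixes q :: real
  assumes "q \<ge> 0"
  shows "(real m / 2) powr (q + 1) \<le> (\<Sum>i=1..m. real i powr q)"
proof (cases "m = 0")
  case False
  have "(real m / 2) powr (q + 1) = (real m / 2) * (real m / 2) powr q"
    using False by (simp add: powr_add)
  also have "\<dots> \<le> (\<Sum>i=m - m div 2..m. (real m / 2) powr q)"
  proof -
    have "real m / 2 \<le> real (card {m - m div 2..m})" by simp
    then show ?thesis by (simp only: sum_constant) (intro mult_right_mono, auto)
  qed
  also have "\<dots> \<le> (\<Sum>i=m - m div 2..m. real i powr q)"
    using assms by (intro sum_mono powr_mono2) auto
  also have "\<dots> \<le> (\<Sum>i=1..m. real i powr q)"
    using False by (intro sum_mono2) auto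
  finally show ?thesis .
qed simp

text \<open>The bound \<open>1/4\<close> keeps opposite signs statistically indistinguishable; the
  power of \<open>cA\<close> keeps the signals inside the source ball.\<close>

definition lower_amp :: "real \<Rightarrow> real \<Rightarrow> real" where
  "lower_amp \<mu> cA = min (1/4) (cA powr (2 * \<mu> + 1))"

text \<open>The factor \<open>min (1/2) (1 / K)\<close> compares the number of directions used with
  the effective dimension; the division by \<open>2\<close> inside the power stems from
  \<open>sum_powr_lower\<close>, that outside from Assouad's averaging.\<close>

definition lower_const :: "real \<Rightarrow> real \<Rightarrow> real \<Rightarrow> real \<Rightarrow> real \<Rightarrow> real" where
  "lower_const \<mu> p cA CA K =
     (lower_amp \<mu> cA)\<^sup>2 / (2 * CA\<^sup>2) * (min (1/2) (1 / K) / 2) powr (2 * p + 1)"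

lemma lower_const_pos:
  assumes "cA > 0" "cA \<le> CA" "K > 0" shows "lower_const \<mu> p cA CA K > 0"
proof -
  have "0 < min (1/4) (cA powr (2 * \<mu> + 1))" "0 < min (1/2) (1 / K) / 2" "0 < CA" using assms by auto
  then show ?thesis unfolding lower_const_def lower_amp_def
    by (intro mult_pos_pos divide_pos_pos zero_less_power powr_gt_zero[THEN iffD2])
      (auto simp: min_def split: if_splits)
qed

section \<open>Assouad's argument\<close>

context cg_model
begin

definition signed_signal :: "nat \<Rightarrow> (nat \<Rightarrow> real) \<Rightarrow> nat set \<Rightarrow> nat \<Rightarrow> real" where
  "signed_signal m a S i = (if i \<in> {1..m} then if i \<in> S then a i else - a i else 0)"

lemma measurable_est_coeff:
  assumes est: "est \<in> estimators D P" and f: "f \<in> carrier_vec P" and i: "i \<in> {1..D}"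
  shows "(\<lambda>z. est (obs A f \<delta> z) \<bullet> v i) \<in> borel_measurable \<gamma>"
proof -
  have obs_vec: "obs A f \<delta> z = Matrix.vec D (\<lambda>j\<in>{..<D}. (A *\<^sub>v f) $ j + \<delta> * z j)" for z
    using dims f by (intro eq_vecI) (auto simp: obs_def)
  have aff: "(\<lambda>z. \<lambda>j\<in>{..<D}. (A *\<^sub>v f) $ j + \<delta> * z j) \<in> measurable \<gamma> (PiM {..<D} (\<lambda>_. borel))"
    by (rule measurable_restrict) measurable
  have "(\<lambda>w. est (Matrix.vec D w) $ j) \<in> borel_measurable (PiM {..<D} (\<lambda>_. borel))" if "j < P" for j
    using est that by (auto simp: estimators_def)
  then have [measurable]: "(\<lambda>z. est (obs A f \<delta> z) $ j) \<in> borel_measurable \<gamma>" if "j \<in> {..<P}" for j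
    unfolding obs_vec using measurable_compose[OF aff] that by simp
  show ?thesis unfolding scalar_prod_lessThan[OF v_carrier[OF i]] by measurable
qed

text \<open>Flipping the sign of coefficient \<open>i\<close> changes the observation exactly as a
  noise shift \<open>s\<close> along \<open>u i\<close> does, of norm at most \<open>1/2\<close>.
  Both risks are therefore integrals over the same noise, and the two-point bound applies with
  separation \<open>2 * a i\<close>.\<close>

lemma nn_integral_coeff_pair:
  assumes est: "est \<in> estimators D P" and m: "m \<le> D" and i: "i \<in> {1..m}" and S: "S \<subseteq> {1..m} - {i}"
    and a: "\<bar>a i * lam i\<bar> \<le> \<delta> / 4"
  defines "c \<equiv> signed_signal m a"
  shows "ennreal ((a i)\<^sup>2) \<le>
    (\<integral>\<^sup>+z. ennreal ((est (obs A (v_comb (c S)) \<delta> z) \<bullet> v i - c S i)\<^sup>2) \<partial>\<gamma>) +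
    (\<integral>\<^sup>+z. ennreal ((est (obs A (v_comb (c (insert i S))) \<delta> z) \<bullet> v i - c (insert i S) i)\<^sup>2) \<partial>\<gamma>)"
proof -
  have iD: "i \<in> {1..D}" using i m by auto
  define S' where "S' = insert i S"
  define s where "s j = 2 * a i * lam i / \<delta> * u i $ j" for j
  define T where "T z = est (obs A (v_comb (c S)) \<delta> z) \<bullet> v i" for z
  have T: "T \<in> borel_measurable \<gamma>"
    unfolding T_def by (rule measurable_est_coeff[OF est v_comb_carrier iD])
  have "(\<Sum>j<D. (s j)\<^sup>2) = (2 * a i * lam i / \<delta>)\<^sup>2 * (\<Sum>j<D. u i $ j * u i $ j)"
    by (simp only: s_def power_mult_distrib sum_distrib_left) (simp add: power2_eq_square)
  also have "\<dots> = (2 * (\<bar>a i * lam i\<bar> / \<delta>))\<^sup>2"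
    using orthonormal[OF iD iD] by (simp add: power_divide power_mult_distrib)
  also have "\<dots> \<le> (2 * (1/4))\<^sup>2"
    using a \<delta> by (intro power_mono mult_left_mono) (auto simp: field_simps)
  finally have s: "(\<Sum>j<D. (s j)\<^sup>2) \<le> 1/4" by (simp add: power2_eq_square)
  have cS: "c S' k = c S k + (if k = i then 2 * a i else 0)" for k
    using i S by (auto simp: c_def signed_signal_def S'_def)
  have shift: "obs A (v_comb (c S')) \<delta> z = obs A (v_comb (c S)) \<delta> (\<lambda>j\<in>{..<D}. z j + s j)" for z
  proof (rule u_ext)
    fix k assume k: "k \<in> {1..D}"
    have "\<epsilon> (\<lambda>j\<in>{..<D}. z j + s j) k = (\<Sum>j<D. u k $ j * z j) + (\<Sum>j<D. 2 * a i * lam i / \<delta> * (u k $ j * u i $ j))"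
      unfolding \<epsilon>_def sum.distrib[symmetric] by (intro sum.cong refl) (simp add: s_def algebra_simps)
    also have "\<dots> = \<epsilon> z k + 2 * a i * lam i / \<delta> * (if k = i then 1 else 0)"
      unfolding sum_distrib_left[symmetric] orthonormal[OF k iD] by (simp add: \<epsilon>_def)
    finally have e: "\<epsilon> (\<lambda>j\<in>{..<D}. z j + s j) k = \<dots>" .
    have "y (v_comb (c S')) z k = lam k * (c S k + (if k = i then 2 * a i else 0)) + \<delta> * \<epsilon> z k"
      using k by (simp add: y_eq v_comb_coeff cS)
    also have "\<dots> = lam k * c S k + \<delta> * (\<epsilon> z k + 2 * a i * lam i / \<delta> * (if k = i then 1 else 0))"
      using \<delta> by (simp add: distrib_left)
    also have "\<dots> = y (v_comb (c S)) (\<lambda>j\<in>{..<D}. z j + s j) k"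
      unfolding e[symmetric] using k by (simp only: y_eq v_comb_carrier v_comb_coeff)
    finally have "y (v_comb (c S')) z k = y (v_comb (c S)) (\<lambda>j\<in>{..<D}. z j + s j) k" .
    then show "obs A (v_comb (c S')) \<delta> z \<bullet> u k = obs A (v_comb (c S)) \<delta> (\<lambda>j\<in>{..<D}. z j + s j) \<bullet> u k"
      by (simp add: y_def)
  qed (simp_all add: obs_carrier)
  have "(a i)\<^sup>2 = (c S' i - c S i)\<^sup>2 / 4" by (simp add: cS power_mult_distrib)
  moreover have "ennreal ((c S' i - c S i)\<^sup>2 / 4) \<le> (\<integral>\<^sup>+z. ennreal ((T z - c S i)\<^sup>2) \<partial>\<gamma>)
      + (\<integral>\<^sup>+z. ennreal ((T (\<lambda>j\<in>{..<D}. z j + s j) - c S' i)\<^sup>2) \<partial>\<gamma>)"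
    by (rule two_point_bound[OF _ T s]) simp
  ultimately show ?thesis unfolding T_def shift[symmetric] S'_def[symmetric] by (simp only:)
qed

lemma rec_risk_ge_coeffs:
  assumes est: "est \<in> estimators D P" and m: "m \<le> D"
  shows "(\<Sum>i=1..m. \<integral>\<^sup>+z. ennreal ((est (obs A (v_comb c) \<delta> z) \<bullet> v i - c i)\<^sup>2) \<partial>\<gamma>)
    \<le> rec_risk A \<delta> est (v_comb c)"
proof -
  have [measurable]: "(\<lambda>z. est (obs A (v_comb c) \<delta> z) \<bullet> v i) \<in> borel_measurable \<gamma>" if "i \<in> {1..m}" for i
    using that m by (intro measurable_est_coeff est v_comb_carrier) auto
  have "(\<Sum>i=1..m. \<integral>\<^sup>+z. ennreal ((est (obs A (v_comb c) \<delta> z) \<bullet> v i - c i)\<^sup>2) \<partial>\<gamma>)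
      = (\<integral>\<^sup>+z. (\<Sum>i=1..m. ennreal ((est (obs A (v_comb c) \<delta> z) \<bullet> v i - c i)\<^sup>2)) \<partial>\<gamma>)"
    by (intro nn_integral_sum[symmetric]) measurable
  also have "\<dots> \<le> (\<integral>\<^sup>+z. ennreal (rec_loss A \<delta> est (v_comb c) z) \<partial>\<gamma>)"
  proof (intro nn_integral_mono)
    fix z
    define w where "w = est (obs A (v_comb c) \<delta> z)"
    have w: "w \<in> carrier_vec P" using est obs_carrier by (auto simp: w_def estimators_def)
    have sol: "min_norm_sol A (v_comb c) = v_comb c"
    proof -
      have "(\<Sum>i=1..D. (v_comb c \<bullet> v i) * v i $ j) = (\<Sum>i=1..D. c i * v i $ j)" for j
        by (intro sum.cong refl) (simp add: v_comb_coeff)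
      then show ?thesis
        unfolding min_norm_sol_eq[OF v_comb_carrier] v_comb_def[of "\<lambda>i. v_comb c \<bullet> v i"]
        by (simp only: v_comb_def[of c])
    qed
    have "(\<Sum>i=1..m. (w \<bullet> v i - c i)\<^sup>2) \<le> (\<Sum>i=1..D. (w \<bullet> v i - c i)\<^sup>2)"
      using m by (intro sum_mono2) auto
    also have "\<dots> = (\<Sum>i=1..D. ((w - v_comb c) \<bullet> v i)\<^sup>2)"
      using w v_carrier by (intro sum.cong refl)
        (simp add: minus_scalar_prod_distrib[of _ P] v_comb_coeff)
    also have "\<dots> \<le> sq_norm (w - v_comb c)" using w by (intro v_bessel) auto
    finally show "(\<Sum>i=1..m. ennreal ((est (obs A (v_comb c) \<delta> z) \<bullet> v i - c i)\<^sup>2))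
        \<le> ennreal (rec_loss A \<delta> est (v_comb c) z)"
      by (simp add: rec_loss_def sol w_def[symmetric] sum_ennreal ennreal_leI)
  qed
  also have "\<dots> = rec_risk A \<delta> est (v_comb c)"
    by (simp add: rec_risk_def dims std_gauss_eq nn_integral_completion)
  finally show ?thesis .
qed

text \<open>The worst case dominates the average over all \<open>2 ^ m\<close> sign patterns. For
  each direction the patterns are grouped into \<open>2 ^ (m - 1)\<close> pairs that differ only
  there, and each pair contributes at least \<open>(a i)\<^sup>2\<close>.\<close>

lemma assouad:
  assumes m: "m \<le> D" and a: "\<And>i. i \<in> {1..m} \<Longrightarrow> \<bar>a i * lam i\<bar> \<le> \<delta> / 4"
    and source: "(\<Sum>i=1..m. lam i powr (- 4 * \<mu>) * (a i)\<^sup>2) \<le> R\<^sup>2"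
  shows "ennreal ((\<Sum>i=1..m. (a i)\<^sup>2) / 2) \<le> minimax_risk A lam v \<mu> R \<delta>"
  unfolding minimax_risk_def dims
proof (rule INF_greatest)
  fix est assume est: "est \<in> estimators D P"
  define c where "c = signed_signal m a"
  define sup where "sup = (SUP f\<in>signals D P lam v \<mu> R. rec_risk A \<delta> est f)"
  have sig: "v_comb (c S) \<in> signals D P lam v \<mu> R" for S
  proof -
    have "(\<Sum>i=1..D. lam i powr (- 4 * \<mu>) * (v_comb (c S) \<bullet> v i)\<^sup>2)
        = (\<Sum>i=1..D. if i \<in> {1..m} then lam i powr (- 4 * \<mu>) * (a i)\<^sup>2 else 0)"
      by (intro sum.cong refl) (auto simp: v_comb_coeff c_def signed_signal_def)
    also have "\<dots> = (\<Sum>i\<in>{1..D} \<inter> {1..m}. lam i powr (- 4 * \<mu>) * (a i)\<^sup>2)"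
      by (rule sum.inter_restrict[symmetric]) simp
    also have "{1..D} \<inter> {1..m} = {1..m}" using m by auto
    finally have "(\<Sum>i=1..D. lam i powr (- 4 * \<mu>) * (v_comb (c S) \<bullet> v i)\<^sup>2) \<le> R\<^sup>2" using source by simp
    then show ?thesis using R by (simp add: signals_def source_norm_def real_le_lsqrt)
  qed
  define E where "E i S = (\<integral>\<^sup>+z. ennreal ((est (obs A (v_comb (c S)) \<delta> z) \<bullet> v i - c S i)\<^sup>2) \<partial>\<gamma>)" for i S
  have "ennreal (2 ^ m * ((\<Sum>i=1..m. (a i)\<^sup>2) / 2)) = (\<Sum>i=1..m. \<Sum>S\<in>Pow ({1..m} - {i}). ennreal ((a i)\<^sup>2))"
  proof (cases "m = 0")
    case False
    have "(\<Sum>i=1..m. \<Sum>S\<in>Pow ({1..m} - {i}). ennreal ((a i)\<^sup>2)) = (\<Sum>i=1..m. ennreal (2 ^ (m - 1) * (a i)\<^sup>2))"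
      by (intro sum.cong refl) (simp add: card_Pow ennreal_mult ennreal_power flip: ennreal_numeral)
    also have "\<dots> = ennreal (2 ^ (m - 1) * (\<Sum>i=1..m. (a i)\<^sup>2))" by (simp add: sum_distrib_left)
    also have "2 ^ (m - 1) * (\<Sum>i=1..m. (a i)\<^sup>2) = 2 ^ m * ((\<Sum>i=1..m. (a i)\<^sup>2) / 2)"
      using False by (cases m) auto
    finally show ?thesis by simp
  qed simp
  also have "\<dots> \<le> (\<Sum>i=1..m. \<Sum>S\<in>Pow ({1..m} - {i}). E i S + E i (insert i S))"
    unfolding E_def c_def using est m a by (intro sum_mono nn_integral_coeff_pair) auto
  also have "\<dots> = (\<Sum>i=1..m. \<Sum>S\<in>Pow {1..m}. E i S)"
    by (intro sum.cong refl sum_Pow_split[symmetric]) auto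
  also have "\<dots> = (\<Sum>S\<in>Pow {1..m}. \<Sum>i=1..m. E i S)" by (rule sum.swap)
  also have "\<dots> \<le> (\<Sum>S\<in>Pow {1..m}. sup)"
  proof (intro sum_mono)
    fix S
    have "(\<Sum>i=1..m. E i S) \<le> rec_risk A \<delta> est (v_comb (c S))"
      unfolding E_def by (rule rec_risk_ge_coeffs[OF est m])
    also have "\<dots> \<le> sup" unfolding sup_def using sig by (rule SUP_upper)
    finally show "(\<Sum>i=1..m. E i S) \<le> sup" .
  qed
  also have "\<dots> = ennreal (2 ^ m) * sup"
    by (simp add: card_Pow ennreal_power flip: ennreal_numeral)
  finally have "ennreal (2 ^ m * ((\<Sum>i=1..m. (a i)\<^sup>2) / 2)) \<le> ennreal (2 ^ m) * sup" .
  moreover have "ennreal (2 ^ m * ((\<Sum>i=1..m. (a i)\<^sup>2) / 2)) = ennreal (2 ^ m) * ennreal ((\<Sum>i=1..m. (a i)\<^sup>2) / 2)"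
    by (rule ennreal_mult) (auto intro: sum_nonneg)
  ultimately have "ennreal (2 ^ m) * ennreal ((\<Sum>i=1..m. (a i)\<^sup>2) / 2) \<le> ennreal (2 ^ m) * sup" by simp
  then show "ennreal ((\<Sum>i=1..m. (a i)\<^sup>2) / 2) \<le> (SUP f\<in>signals D P lam v \<mu> R. rec_risk A \<delta> est f)"
    unfolding sup_def[symmetric] by (subst (asm) ennreal_mult_le_mult_iff) (auto simp: less_top[symmetric])
qed

lemma N_ge_1: "N \<ge> 1"
proof -
  have "\<delta>\<^sup>2 \<le> 1" using \<delta> by (simp add: power_le_one)
  also have "1 \<le> R\<^sup>2" using R by simp
  finally have "1 \<le> R\<^sup>2 / \<delta>\<^sup>2" using \<delta> by (simp add: field_simps)
  then show ?thesis unfolding eff_dim_def using \<mu> p by (intro ge_one_powr_ge_zero) auto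
qed

text \<open>With amplitudes \<open>b * \<delta> / lam i\<close>, a fixed fraction of the noise level
  after inversion, the sum of their squares is of order
  \<open>\<delta>\<^sup>2 * m powr (2 * p + 1)\<close>, which matches the variance form of the rate
  once \<open>m\<close> is comparable to \<open>N\<close>.\<close>

lemma minimax_lower: "ennreal (lower_const \<mu> p cA CA K * rec_rate \<mu> p R \<delta>) \<le> minimax_risk A lam v \<mu> R \<delta>"
proof -
  define b where "b = lower_amp \<mu> cA"
  have b: "b > 0" "b \<le> 1/4" "b \<le> cA powr (2 * \<mu> + 1)" using cA by (auto simp: b_def lower_amp_def)
  \<comment> \<open>\<open>m \<le> N\<close> bounds the source norm, since each direction
    contributes at most \<open>\<delta>\<^sup>2 * N powr \<theta>\<close> and \<open>N\<close> of
    these make up \<open>R\<^sup>2\<close>. Rounding costs at most one half because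
    \<open>N \<ge> 1\<close>, and the cap \<open>D\<close> at most \<open>1 / K\<close> because
    \<open>N \<le> K * D\<close>.\<close>
  define m where "m = min (nat \<lfloor>N\<rfloor>) D"
  have m: "m \<le> D" "real m \<le> N" using N_pos by (auto simp: m_def min_def) linarith
  have mN: "min (1/2) (1 / K) * N \<le> real m"
  proof -
    have "1 \<le> \<lfloor>N\<rfloor>" using N_ge_1 by simp
    then have "(1::real) \<le> of_int \<lfloor>N\<rfloor>" "real (nat \<lfloor>N\<rfloor>) = of_int \<lfloor>N\<rfloor>" by auto
    moreover have "N < of_int \<lfloor>N\<rfloor> + 1" by linarith
    ultimately have "N / 2 \<le> real (nat \<lfloor>N\<rfloor>)" by linarith
    moreover have "N / K \<le> real D" using eff_dim_le K by (simp add: field_simps)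
    moreover have "min (1/2) (1 / K) * N \<le> N / 2" "min (1/2) (1 / K) * N \<le> N / K"
      using N_pos mult_right_mono[of "min (1/2) (1 / K)" "1/2" N] mult_right_mono[of "min (1/2) (1 / K)" "1/K" N] by auto
    ultimately show ?thesis by (auto simp: m_def min_def)
  qed
  define a where "a i = b * \<delta> / lam i" for i
  have iD: "i \<in> {1..D}" if "i \<in> {1..m}" for i using that m by auto
  have small: "\<bar>a i * lam i\<bar> \<le> \<delta> / 4" if "i \<in> {1..m}" for i
    using b \<delta> lam_pos[OF iD[OF that]] by (simp add: a_def abs_mult)
  define \<theta> where "\<theta> = 4 * \<mu> * p + 2 * p"
  have \<theta>: "\<theta> > 0" using \<mu> p by (simp add: \<theta>_def add_pos_pos)
  have "lam i powr (- 4 * \<mu>) * (a i)\<^sup>2 \<le> \<delta>\<^sup>2 * N powr \<theta>" if i: "i \<in> {1..m}" for i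
  proof -
    have l: "lam i > 0" "cA * real i powr (- p) \<le> lam i" using iD[OF i] lam_pos decay by auto
    have "lam i powr (- 4 * \<mu>) * (a i)\<^sup>2 = b\<^sup>2 * \<delta>\<^sup>2 * lam i powr (- (4 * \<mu> + 2))"
    proof -
      have "lam i powr (- (4 * \<mu> + 2)) = lam i powr (- 4 * \<mu>) * lam i powr (- 2)"
        by (simp flip: powr_add)
      also have "lam i powr (- 2) = 1 / (lam i)\<^sup>2" using l by (simp add: powr_minus_divide)
      finally show ?thesis by (simp add: a_def power_divide power_mult_distrib)
    qed
    also have "\<dots> \<le> b\<^sup>2 * \<delta>\<^sup>2 * (cA * real i powr (- p)) powr (- (4 * \<mu> + 2))"
      using l cA i \<mu> by (intro mult_left_mono powr_mono2') auto
    also have "(cA * real i powr (- p)) powr (- (4 * \<mu> + 2)) = cA powr (- (4 * \<mu> + 2)) * real i powr \<theta>"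
      using cA by (simp add: powr_mult powr_powr \<theta>_def algebra_simps)
    also have "b\<^sup>2 * \<delta>\<^sup>2 * (cA powr (- (4 * \<mu> + 2)) * real i powr \<theta>)
        = \<delta>\<^sup>2 * ((b\<^sup>2 * cA powr (- (4 * \<mu> + 2))) * real i powr \<theta>)" by simp
    also have "\<dots> \<le> \<delta>\<^sup>2 * (1 * N powr \<theta>)"
    proof (intro mult_left_mono mult_mono)
      have "b\<^sup>2 \<le> (cA powr (2 * \<mu> + 1))\<^sup>2" using b by (intro power_mono) auto
      also have "\<dots> = cA powr (4 * \<mu> + 2)" using cA by (simp add: powr_powr algebra_simps flip: powr_numeral)
      finally show "b\<^sup>2 * cA powr (- (4 * \<mu> + 2)) \<le> 1"
        using cA by (simp only: powr_minus) (simp add: field_simps)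
      show "real i powr \<theta> \<le> N powr \<theta>" using i m \<theta> by (intro powr_mono2) auto
    qed auto
    finally show ?thesis by simp
  qed
  then have "(\<Sum>i=1..m. lam i powr (- 4 * \<mu>) * (a i)\<^sup>2) \<le> (\<Sum>i=1..m. \<delta>\<^sup>2 * N powr \<theta>)" by (rule sum_mono)
  also have "\<dots> = real m * (\<delta>\<^sup>2 * N powr \<theta>)" by simp
  also have "\<dots> \<le> N * (\<delta>\<^sup>2 * N powr \<theta>)" using m by (intro mult_right_mono) auto
  also have "\<dots> = R\<^sup>2"
    using eff_dim_powr[of \<mu> p R \<delta>] \<mu> p R \<delta> N_pos by (simp add: \<theta>_def powr_add mult_ac)
  finally have "(\<Sum>i=1..m. lam i powr (- 4 * \<mu>) * (a i)\<^sup>2) \<le> R\<^sup>2" .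
  then have "ennreal ((\<Sum>i=1..m. (a i)\<^sup>2) / 2) \<le> minimax_risk A lam v \<mu> R \<delta>"
    using small by (intro assouad m)
  moreover have "lower_const \<mu> p cA CA K * rec_rate \<mu> p R \<delta> \<le> (\<Sum>i=1..m. (a i)\<^sup>2) / 2"
  proof -
    have CA0: "CA > 0" using cA CA by simp
    have "(min (1/2) (1 / K) / 2) powr (2 * p + 1) * N powr (2 * p + 1) = (min (1/2) (1 / K) * N / 2) powr (2 * p + 1)"
      using K N_pos by (simp add: powr_mult[symmetric])
    also have "\<dots> \<le> (real m / 2) powr (2 * p + 1)"
      using mN K N_pos p by (intro powr_mono2) auto
    also have "\<dots> \<le> (\<Sum>i=1..m. real i powr (2 * p))" using p by (intro sum_powr_lower) auto
    finally have "b\<^sup>2 * \<delta>\<^sup>2 / (2 * CA\<^sup>2) * ((min (1/2) (1 / K) / 2) powr (2 * p + 1) * N powr (2 * p + 1))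
        \<le> b\<^sup>2 * \<delta>\<^sup>2 / (2 * CA\<^sup>2) * (\<Sum>i=1..m. real i powr (2 * p))"
      by (intro mult_left_mono) auto
    moreover have "lower_const \<mu> p cA CA K * rec_rate \<mu> p R \<delta>
        = b\<^sup>2 * \<delta>\<^sup>2 / (2 * CA\<^sup>2) * ((min (1/2) (1 / K) / 2) powr (2 * p + 1) * N powr (2 * p + 1))"
      using \<mu> p R \<delta> by (simp add: lower_const_def b_def rec_rate_eff_dim)
    ultimately have "lower_const \<mu> p cA CA K * rec_rate \<mu> p R \<delta>
        \<le> b\<^sup>2 * \<delta>\<^sup>2 / (2 * CA\<^sup>2) * (\<Sum>i=1..m. real i powr (2 * p))" by simp
    also have "\<dots> = (\<Sum>i=1..m. b\<^sup>2 * \<delta>\<^sup>2 * (real i powr (2 * p) / CA\<^sup>2)) / 2"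
      by (simp add: sum_distrib_left sum_divide_distrib mult_ac)
    also have "\<dots> \<le> (\<Sum>i=1..m. (a i)\<^sup>2) / 2"
    proof (intro divide_right_mono sum_mono)
      fix i assume i: "i \<in> {1..m}"
      have l: "lam i > 0" "lam i \<le> CA * real i powr (- p)" using iD[OF i] lam_pos decay by auto
      have "(lam i)\<^sup>2 \<le> (CA * real i powr (- p))\<^sup>2" using l by (intro power_mono) auto
      also have "\<dots> = CA\<^sup>2 * real i powr (- (2 * p))" by (simp add: power_mult_distrib powr_powr mult.commute flip: powr_numeral)
      finally have "(lam i)\<^sup>2 \<le> CA\<^sup>2 / real i powr (2 * p)" by (simp add: powr_minus_divide)
      then have "real i powr (2 * p) / CA\<^sup>2 \<le> 1 / (lam i)\<^sup>2"
        using l CA0 i by (simp add: field_simps)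
      then have "b\<^sup>2 * \<delta>\<^sup>2 * (real i powr (2 * p) / CA\<^sup>2) \<le> b\<^sup>2 * \<delta>\<^sup>2 * (1 / (lam i)\<^sup>2)"
        by (rule mult_left_mono) simp
      then show "b\<^sup>2 * \<delta>\<^sup>2 * (real i powr (2 * p) / CA\<^sup>2) \<le> (a i)\<^sup>2"
        by (simp add: a_def power_divide power_mult_distrib)
    qed simp
    finally show ?thesis .
  qed
  ultimately show ?thesis by (meson ennreal_leI order_trans)
qed

end

theorem theorem7p10:
  fixes \<mu> p c\<^sub>A C\<^sub>A C\<^sub>\<kappa> :: real
  assumes "\<mu> > 0" "p > 1/2" "0 < c\<^sub>A" "c\<^sub>A \<le> C\<^sub>A" "0 \<le> C\<^sub>\<kappa>"
  shows
    "(\<forall>K>0. \<exists>C>0. \<exists>C'>0. \<forall>(D::nat) (P::nat) A lam u v R \<delta> \<kappa> f.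
        model D P A lam u v \<and>
        (\<forall>i\<in>{1..D}. c\<^sub>A * real i powr (- p) \<le> lam i \<and> lam i \<le> C\<^sub>A * real i powr (- p)) \<and>
        1 \<le> R \<and> 0 < \<delta> \<and> \<delta> < 1 \<and>
        0 < \<kappa> \<and> \<bar>\<kappa> - \<delta>\<^sup>2 * real D\<bar> \<le> C\<^sub>\<kappa> * \<delta>\<^sup>2 * sqrt (real D) \<and>
        f \<in> signals D P lam v \<mu> R \<and>
        eff_dim \<mu> p R \<delta> \<le> K * real D
        \<longrightarrow>
        (\<forall>z\<ge>1. measure (std_gauss D)
             {\<omega> \<in> space (std_gauss D).
                rec_loss A \<delta> (cg_stopped_est A lam u \<kappa>) f \<omega>
                  \<le> C * (rec_rate \<mu> p R \<delta> +
                       \<delta>\<^sup>2 * (sqrt (real D) * sqrt z + z powr ((4 * p + 1) / (4 * p))) powr (2 * p + 1))}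
           \<ge> 1 - 6 * exp (- z)) \<and>
        integrable (std_gauss D) (rec_loss A \<delta> (cg_stopped_est A lam u \<kappa>) f) \<and>
        (\<integral>\<omega>. rec_loss A \<delta> (cg_stopped_est A lam u \<kappa>) f \<omega> \<partial>std_gauss D)
          \<le> C' * (rec_rate \<mu> p R \<delta> + \<delta>\<^sup>2 * real D powr (p + 1/2)))
     \<and>
     (\<forall>K>0. \<forall>K'>0. \<exists>c>0. \<exists>C>0. \<forall>(D::nat) (P::nat) A lam u v R \<delta> \<kappa>.
        model D P A lam u v \<and>
        (\<forall>i\<in>{1..D}. c\<^sub>A * real i powr (- p) \<le> lam i \<and> lam i \<le> C\<^sub>A * real i powr (- p)) \<and>
        1 \<le> R \<and> 0 < \<delta> \<and> \<delta> < 1 \<and>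
        0 < \<kappa> \<and> \<bar>\<kappa> - \<delta>\<^sup>2 * real D\<bar> \<le> C\<^sub>\<kappa> * \<delta>\<^sup>2 * sqrt (real D) \<and>
        sqrt (real D) \<le> K' * eff_dim \<mu> p R \<delta> \<and>
        eff_dim \<mu> p R \<delta> \<le> K * real D
        \<longrightarrow>
        ennreal (c * rec_rate \<mu> p R \<delta>) \<le> minimax_risk A lam v \<mu> R \<delta> \<and>
        minimax_risk A lam v \<mu> R \<delta> \<le> ennreal (C * rec_rate \<mu> p R \<delta>) \<and>
        (SUP f\<in>signals D P lam v \<mu> R. rec_risk A \<delta> (cg_stopped_est A lam u \<kappa>) f)
          \<le> ennreal (C * rec_rate \<mu> p R \<delta>))"
proof (intro conjI allI impI, goal_cases)
  case (1 K)
  \<comment> \<open>Both constants are terms in the parameters \<open>\<mu>\<close>,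
    \<open>p\<close>, \<open>c\<^sub>A\<close>, \<open>C\<^sub>A\<close>, \<open>K\<close> and
    \<open>C\<^sub>\<kappa>\<close> alone, so they can be fixed before the dimensions, the operator,
    the signal and the noise level.\<close>
  define C where "C = upper_const \<mu> p c\<^sub>A C\<^sub>A K C\<^sub>\<kappa>"
  define C' where "C' = risk_const \<mu> p c\<^sub>A C\<^sub>A K C\<^sub>\<kappa>"
  have pos: "C > 0" "C' > 0"
    using assms by (auto simp: C_def C'_def intro!: upper_const_pos risk_const_pos)
  show ?case
  proof (rule exI[of _ C], rule conjI[OF pos(1)], rule exI[of _ C'], rule conjI[OF pos(2)],
      intro allI impI, elim conjE)
    fix D P A lam u v R \<delta> \<kappa> f
    assume as: "model D P A lam u v"
      "\<forall>i\<in>{1..D}. c\<^sub>A * real i powr (- p) \<le> lam i \<and> lam i \<le> C\<^sub>A * real i powr (- p)"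
      "1 \<le> R" "0 < \<delta>" "\<delta> < 1" "0 < \<kappa>" "\<bar>\<kappa> - \<delta>\<^sup>2 * real D\<bar> \<le> C\<^sub>\<kappa> * \<delta>\<^sup>2 * sqrt (real D)"
      "eff_dim \<mu> p R \<delta> \<le> K * real D"
      and f: "f \<in> signals D P lam v \<mu> R"
    interpret cg_model D P A lam u v \<mu> p c\<^sub>A C\<^sub>A K C\<^sub>\<kappa> R \<delta> \<kappa>
      by unfold_locales (fact as assms 1)+
    show "(\<forall>z\<ge>1. measure (std_gauss D)
             {\<omega> \<in> space (std_gauss D).
                rec_loss A \<delta> (cg_stopped_est A lam u \<kappa>) f \<omega>
                  \<le> C * (rec_rate \<mu> p R \<delta> +
                       \<delta>\<^sup>2 * (sqrt (real D) * sqrt z + z powr ((4 * p + 1) / (4 * p))) powr (2 * p + 1))}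
           \<ge> 1 - 6 * exp (- z)) \<and>
        integrable (std_gauss D) (rec_loss A \<delta> (cg_stopped_est A lam u \<kappa>) f) \<and>
        (\<integral>\<omega>. rec_loss A \<delta> (cg_stopped_est A lam u \<kappa>) f \<omega> \<partial>std_gauss D)
          \<le> C' * (rec_rate \<mu> p R \<delta> + \<delta>\<^sup>2 * real D powr (p + 1/2))"
      using loss_probability[OF f] loss_expectation(1,2)[OF f] unfolding C_def C'_def by blast
  qed
next
  case (2 K K')
  define c where "c = lower_const \<mu> p c\<^sub>A C\<^sub>A K"
  define C where "C = risk_const \<mu> p c\<^sub>A C\<^sub>A K C\<^sub>\<kappa> * (1 + K' powr (2 * p + 1))"
  have c: "c > 0" using assms 2 by (simp add: c_def lower_const_pos)
  have "risk_const \<mu> p c\<^sub>A C\<^sub>A K C\<^sub>\<kappa> > 0" using assms by (intro risk_const_pos) auto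
  then have C: "C > 0" unfolding C_def by (intro mult_pos_pos add_pos_nonneg) auto
  show ?case
  proof (rule exI[of _ c], rule conjI[OF c], rule exI[of _ C], rule conjI[OF C],
      intro allI impI, elim conjE)
    fix D P A lam u v R \<delta> \<kappa>
    assume as: "model D P A lam u v"
      "\<forall>i\<in>{1..D}. c\<^sub>A * real i powr (- p) \<le> lam i \<and> lam i \<le> C\<^sub>A * real i powr (- p)"
      "1 \<le> R" "0 < \<delta>" "\<delta> < 1" "0 < \<kappa>" "\<bar>\<kappa> - \<delta>\<^sup>2 * real D\<bar> \<le> C\<^sub>\<kappa> * \<delta>\<^sup>2 * sqrt (real D)"
      "eff_dim \<mu> p R \<delta> \<le> K * real D"
      and D: "sqrt (real D) \<le> K' * eff_dim \<mu> p R \<delta>"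
    interpret cg_model D P A lam u v \<mu> p c\<^sub>A C\<^sub>A K C\<^sub>\<kappa> R \<delta> \<kappa>
      by unfold_locales (fact as assms 2)+
    show "ennreal (c * rec_rate \<mu> p R \<delta>) \<le> minimax_risk A lam v \<mu> R \<delta> \<and>
        minimax_risk A lam v \<mu> R \<delta> \<le> ennreal (C * rec_rate \<mu> p R \<delta>) \<and>
        (SUP f\<in>signals D P lam v \<mu> R. rec_risk A \<delta> (cg_stopped_est A lam u \<kappa>) f)
          \<le> ennreal (C * rec_rate \<mu> p R \<delta>)"
      using minimax_lower risk_upper[OF 2(2) D] unfolding c_def C_def by blast
  qed
qed

end
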